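(* Let $\omega\in[-\tfrac12,\tfrac12]$. For all $\epsilon\ge 0$, there exists a minimizer of the energy $$F_{LG}[Q_{11},Q_{12}]=\int_{-1}^{1}\Big((Q_{11}')^2+(Q_{12}')^2\Big)+\epsilon\,(Q_{11}^2+Q_{12}^2)\big(2(Q_{11}^2+Q_{12}^2)-1\big)\,\mathrm{d}y$$ in the admissible space $$\mathcal{A}=\Big\{\mathbf{Q}\in W^{1,2}([-1,1];S_2):\ Q_{11}(\pm1)=\tfrac{\cos(2\omega\pi)}{2},\ Q_{12}(-1)=-\tfrac{\sin(2\omega\pi)}{2},\ Q_{12}(1)=\tfrac{\sin(2\omega\pi)}{2}\Big\}.$$ Moreover, the system $$Q_{11}''=\epsilon\,Q_{11}\big(4(Q_{11}^2+Q_{12}^2)-1\big),\qquad Q_{12}''=\epsilon\,Q_{12}\big(4(Q_{11}^2+Q_{12}^2)-1\big)\quad\text{on }[-1,1]$$ admits an analytic solution in $\mathcal{A}$ for all $\epsilon\ge0$. Finally, OR (order reconstruction) solutions of this system in $\mathcal{A}$ exist only for $\omega=\pm\tfrac14$.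
   Context: $S_2$ is the space of real symmetric traceless $2\times2$ matrices; $\mathbf{Q}\in S_2$ is identified with its two independent components $(Q_{11},Q_{12})$. Primes denote $d/dy$. The scalar order parameter $s$ and the director angle $\theta$ of $\mathbf{Q}$ are related to its components by $Q_{11}=\frac{s}{2}\cos2\theta$, $Q_{12}=\frac{s}{2}\sin2\theta$, with $s=2\sqrt{Q_{11}^2+Q_{12}^2}$ (so $s=0$ exactly where $\mathbf{Q}=0$). An OR (order reconstruction) solution is a solution for which the domain $[-1,1]$ is partitioned into finitely many (at least two) sub-intervals, called polydomains, such that $\theta$ is constant on each polydomain and neighbouring polydomains are separated by domain walls, i.e. points where $s=0$ (equivalently $\mathbf{Q}=0$), which account for jumps of $\theta$ from one polydomain to the next. In particular, a solution with $s\equiv1$ and $\theta$ constant is not an OR solution. *)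

theory Defs
  imports "HOL-Analysis.Analysis"
begin

text \<open>
  A field \<open>Q\<close> of symmetric traceless \<open>2 \<times> 2\<close> matrices on \<open>[-1,1]\<close> is given by its two independent
  components \<open>Q11, Q12 :: real \<Rightarrow> real\<close>. Values outside \<open>[-1,1]\<close> are irrelevant throughout.
\<close>

definition L2 :: "(real \<Rightarrow> real) \<Rightarrow> bool" where
  "L2 f \<longleftrightarrow> set_borel_measurable lborel {-1..1} f \<and>
            set_integrable lborel {-1..1} (\<lambda>y. (f y)\<^sup>2)"

definition test_function :: "(real \<Rightarrow> real) \<Rightarrow> bool" where
  "test_function \<phi> \<longleftrightarrow> (\<forall>n x. ((deriv ^^ n) \<phi>) differentiable (at x)) \<and>
     compact (closure {x. \<phi> x \<noteq> 0}) \<and> closure {x. \<phi> x \<noteq> 0} \<subseteq> {-1<..<1}"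

definition has_weak_derivative :: "(real \<Rightarrow> real) \<Rightarrow> (real \<Rightarrow> real) \<Rightarrow> bool" where
  "has_weak_derivative u g \<longleftrightarrow>
     (\<forall>\<phi>. test_function \<phi> \<longrightarrow>
        (LBINT y:{-1..1}. u y * deriv \<phi> y) = - (LBINT y:{-1..1}. g y * \<phi> y))"

text \<open>
  Every class in \<open>W\<^sup>1\<^sup>,\<^sup>2\<close> on a bounded interval has exactly one representative that is continuous
  on the closed interval. \<open>W12\<close> consists of these representatives (so \<open>u \<in> L\<^sup>2\<close> is automatic), and
  the boundary conditions are evaluated on them.
\<close>

definition W12 :: "(real \<Rightarrow> real) set" where
  "W12 = {u. continuous_on {-1..1} u \<and> (\<exists>g. L2 g \<and> has_weak_derivative u g)}"

text \<open>The weak derivative is unique only up to null sets; the choice does not affect the energy.\<close>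

definition weak_deriv :: "(real \<Rightarrow> real) \<Rightarrow> real \<Rightarrow> real" where
  "weak_deriv u = (SOME g. L2 g \<and> has_weak_derivative u g)"

definition F_LG :: "real \<Rightarrow> (real \<Rightarrow> real) \<Rightarrow> (real \<Rightarrow> real) \<Rightarrow> real" where
  "F_LG \<epsilon> Q11 Q12 =
     (LBINT y:{-1..1}. ((weak_deriv Q11 y)\<^sup>2 + (weak_deriv Q12 y)\<^sup>2)
        + \<epsilon> * ((Q11 y)\<^sup>2 + (Q12 y)\<^sup>2) * (2 * ((Q11 y)\<^sup>2 + (Q12 y)\<^sup>2) - 1))"

definition admissible :: "real \<Rightarrow> ((real \<Rightarrow> real) \<times> (real \<Rightarrow> real)) set" where
  "admissible \<omega> = {(Q11, Q12). Q11 \<in> W12 \<and> Q12 \<in> W12 \<and>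
     Q11 (-1) = cos (2 * \<omega> * pi) / 2 \<and> Q11 1 = cos (2 * \<omega> * pi) / 2 \<and>
     Q12 (-1) = - sin (2 * \<omega> * pi) / 2 \<and> Q12 1 = sin (2 * \<omega> * pi) / 2}"

definition is_minimizer :: "real \<Rightarrow> real \<Rightarrow> (real \<Rightarrow> real) \<Rightarrow> (real \<Rightarrow> real) \<Rightarrow> bool" where
  "is_minimizer \<epsilon> \<omega> Q11 Q12 \<longleftrightarrow> (Q11, Q12) \<in> admissible \<omega> \<and>
     (\<forall>R11 R12. (R11, R12) \<in> admissible \<omega> \<longrightarrow> F_LG \<epsilon> Q11 Q12 \<le> F_LG \<epsilon> R11 R12)"

text \<open>The system holds classically on \<open>[-1,1]\<close>, with one-sided derivatives at the end points.\<close>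

definition has_second_derivative :: "(real \<Rightarrow> real) \<Rightarrow> (real \<Rightarrow> real) \<Rightarrow> bool" where
  "has_second_derivative f h \<longleftrightarrow>
     (\<exists>f'. \<forall>y\<in>{-1..1}. (f has_real_derivative f' y) (at y within {-1..1}) \<and>
                        (f' has_real_derivative h y) (at y within {-1..1}))"

definition solves_system :: "real \<Rightarrow> (real \<Rightarrow> real) \<Rightarrow> (real \<Rightarrow> real) \<Rightarrow> bool" where
  "solves_system \<epsilon> Q11 Q12 \<longleftrightarrow>
     has_second_derivative Q11 (\<lambda>y. \<epsilon> * Q11 y * (4 * ((Q11 y)\<^sup>2 + (Q12 y)\<^sup>2) - 1)) \<and>
     has_second_derivative Q12 (\<lambda>y. \<epsilon> * Q12 y * (4 * ((Q11 y)\<^sup>2 + (Q12 y)\<^sup>2) - 1))"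

text \<open>
  Since the power series at an end point defines an extension beyond it, this is the same as being
  the restriction of an analytic function on an open neighbourhood of the interval \<open>S\<close>.
\<close>

definition real_analytic_on :: "(real \<Rightarrow> real) \<Rightarrow> real set \<Rightarrow> bool" where
  "real_analytic_on f S \<longleftrightarrow>
     (\<forall>x\<in>S. \<exists>r>0. \<exists>a. \<forall>y\<in>S. \<bar>y - x\<bar> < r \<longrightarrow> (\<lambda>n. a n * (y - x) ^ n) sums f y)"

definition scalar_order :: "real \<Rightarrow> real \<Rightarrow> real" where
  "scalar_order q11 q12 = 2 * sqrt (q11\<^sup>2 + q12\<^sup>2)"

text \<open>Where \<open>q11 = q12 = 0\<close> (that is, \<open>s = 0\<close>) every \<open>\<theta>\<close> is a director angle.\<close>

definition director_angle :: "real \<Rightarrow> real \<Rightarrow> real \<Rightarrow> bool" where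
  "director_angle \<theta> q11 q12 \<longleftrightarrow>
     q11 = scalar_order q11 q12 / 2 * cos (2 * \<theta>) \<and> q12 = scalar_order q11 q12 / 2 * sin (2 * \<theta>)"

text \<open>
  The points \<open>t 0 < \<dots> < t n\<close> cut \<open>[-1,1]\<close> into \<open>n \<ge> 2\<close> polydomains; the interior points are the
  domain walls, so the polydomains may be taken closed.
\<close>

definition has_polydomains :: "(real \<Rightarrow> real) \<Rightarrow> (real \<Rightarrow> real) \<Rightarrow> bool" where
  "has_polydomains Q11 Q12 \<longleftrightarrow>
     (\<exists>n\<ge>2. \<exists>t :: nat \<Rightarrow> real. t 0 = -1 \<and> t n = 1 \<and> (\<forall>i<n. t i < t (Suc i)) \<and>
        (\<forall>i\<in>{0<..<n}. scalar_order (Q11 (t i)) (Q12 (t i)) = 0) \<and>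
        (\<forall>i<n. \<exists>\<theta>. \<forall>y\<in>{t i..t (Suc i)}. director_angle \<theta> (Q11 y) (Q12 y)))"

definition OR_solution :: "real \<Rightarrow> real \<Rightarrow> (real \<Rightarrow> real) \<Rightarrow> (real \<Rightarrow> real) \<Rightarrow> bool" where
  "OR_solution \<epsilon> \<omega> Q11 Q12 \<longleftrightarrow>
     (Q11, Q12) \<in> admissible \<omega> \<and> solves_system \<epsilon> Q11 Q12 \<and> has_polydomains Q11 Q12"

end

theory Submission
  imports Defs "HOL-Computational_Algebra.Polynomial" "HOL-Complex_Analysis.Great_Picard"
begin

text \<open>
  \<^emph>\<open>Minimizer.\<close> Functions in \<open>W\<^sup>1\<^sup>,\<^sup>2\<close> are exactly the primitives of square integrable functions, so the
  energy is a function of the pair of derivatives. A minimizing sequence is equicontinuous, hence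
  converges uniformly along a subsequence and the potential energies converge. Since midpoints of
  admissible pairs are admissible, the parallelogram identity turns this into the statement that the
  derivatives are Cauchy in \<open>L\<^sup>2\<close>; thus weak compactness and lower semicontinuity are not needed.

  \<^emph>\<open>Analytic solution.\<close> Varying the minimizer in the direction \<open>\<phi>' = Q' - G - d\<close>, where \<open>G\<close> is a primitive of
  the nonlinearity and \<open>d\<close> makes \<open>\<phi>\<close> vanish at the end points, gives \<open>Q' = G + d\<close> almost everywhere.
  Near each point the Taylor coefficients determined by the equation are bounded by a geometric
  sequence, and the sum of the power series is the solution by uniqueness.

  \<^emph>\<open>OR solutions.\<close> On the first polydomain \<open>Q\<close> moves on a line through \<open>0\<close>. The component orthogonal to that
  line solves a linear equation, so it vanishes on all of \<open>[-1,1]\<close> and the two boundary values are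
  parallel: \<open>\<omega>\<close> is a multiple of \<open>1/4\<close>. The equation on the line has the first integral
  \<open>u'\<^sup>2 - 2 \<epsilon> (u\<^sup>2 - 1/4)\<^sup>2\<close>, so that a nonconstant solution starting at \<open>u = \<plusminus>1/2\<close> is injective; it cannot return
  to its initial value, which excludes \<open>\<omega> = 0, \<plusminus>1/2\<close>, and for \<open>\<omega> = \<plusminus>1/4\<close> the scalar minimizer has exactly one zero.
\<close>

section \<open>Smooth bump functions\<close>

text \<open>\<open>test_function\<close> asks for all iterated derivatives, so identifying
  \<open>W12\<close> with primitives rests on an explicit smooth bump and a du Bois-Reymond
  argument. After that the energy is a function of derivatives with prescribed integrals, and test
  functions disappear. L2 estimates use Young's inequality |g| <= \<eta> g^2 + 1/\<eta> with a free
  parameter in place of the Cauchy-Schwarz inequality.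

  The potential is a nonconvex double well, so it is handled by uniform convergence, apart from the
  quadratic kinetic term. The variational argument is abstract because it is needed twice: for the
  full energy and for its restriction to the line \<open>Q11 = 0\<close>. The restriction matters
  because nothing forces a minimizer of the full energy to stay on that line and so to have a domain
  wall.

  The boundary values have length 1/2, a zero of (u^2 - 1/4)^2. They are therefore equilibria, and
  the first integral has the value u'(-1)^2; hence u' cannot vanish unless u is constant.\<close>

definition flat :: "real poly \<Rightarrow> real \<Rightarrow> real" where
  "flat p x = (if x > 0 then poly p (1 / x) * exp (- 1 / x) else 0)"

lemma poly_times_exp_minus_tendsto:
  "((\<lambda>z. poly p z * exp (- z)) \<longlongrightarrow> 0) at_top" for p :: "real poly"
proof -
  have "((\<lambda>z. \<Sum>i\<le>degree p. coeff p i * (z ^ i / exp z)) \<longlongrightarrow> (\<Sum>i\<le>degree p. coeff p i * 0)) at_top"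
    by (intro tendsto_intros tendsto_power_div_exp_0)
  moreover have "(\<lambda>z. \<Sum>i\<le>degree p. coeff p i * (z ^ i / exp z)) = (\<lambda>z. poly p z * exp (- z))"
    by (simp add: poly_altdef sum_distrib_right exp_minus divide_inverse mult.assoc fun_eq_iff)
  ultimately show ?thesis by simp
qed

lemma flat_tendsto_0: "(flat p \<longlongrightarrow> 0) (at 0)"
proof -
  have "((\<lambda>x. poly p (inverse x) * exp (- inverse x)) \<longlongrightarrow> 0) (at_right 0)"
    by (rule filterlim_compose[OF poly_times_exp_minus_tendsto filterlim_inverse_at_top_right])
  then have "(flat p \<longlongrightarrow> 0) (at_right 0)"
    by (rule Lim_transform_eventually)
      (auto simp: flat_def divide_inverse eventually_at_right_less
        intro!: eventually_mono[OF eventually_at_right_less[of 0]])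
  moreover have "(flat p \<longlongrightarrow> 0) (at_left 0)"
    by (rule Lim_transform_eventually[OF tendsto_const])
      (auto simp: flat_def eventually_at intro!: exI[of _ 1])
  ultimately show ?thesis by (simp add: filterlim_split_at)
qed

text \<open>With z = 1/x, differentiating p(z) exp(-z) in x multiplies p'(z) - p(z) by dz/dx = -z^2;
  this explains the factor \<open>[:0, 0, 1:]\<close> and the order of the difference. The functions
  \<open>flat p\<close> thus form a class closed under differentiation.\<close>

definition flat_diff :: "real poly \<Rightarrow> real poly" where
  "flat_diff p = [:0, 0, 1:] * (p - pderiv p)"

lemma flat_has_derivative: "(flat p has_real_derivative flat (flat_diff p) x) (at x)"
proof -
  consider "x > 0" | "x < 0" | "x = 0" by linarith
  then show ?thesis
  proof cases
    case 1
    have "((\<lambda>x. poly p (1 / x) * exp (- 1 / x)) has_real_derivative flat (flat_diff p) x) (at x)"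
      using 1 by (auto intro!: derivative_eq_intros DERIV_chain'[OF _ poly_DERIV]
          simp: flat_def flat_diff_def field_simps power2_eq_square)
    then show ?thesis
      by (rule DERIV_cong_ev[THEN iffD1, rotated 3])
        (use 1 in \<open>auto simp: flat_def intro!: eventually_mono[OF eventually_gt_at_top]
          eventually_nhds_in_open[of "{0<..}", THEN eventually_mono]\<close>)
  next
    case 2
    have "((\<lambda>x. 0) has_real_derivative flat (flat_diff p) x) (at x)"
      using 2 by (auto simp: flat_def)
    then show ?thesis
      by (rule DERIV_cong_ev[THEN iffD1, rotated 3])
        (use 2 in \<open>auto simp: flat_def intro!: eventually_nhds_in_open[of "{..<0}", THEN eventually_mono]\<close>)
  next
    case 3
    \<comment> \<open>The difference quotient at 0 is again flat: dividing by h multiplies the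
      polynomial in 1/h by its variable, which turns \<open>p\<close> into
      \<open>pCons 0 p\<close>.\<close>
    have "((\<lambda>h. flat (pCons 0 p) h) \<longlongrightarrow> 0) (at 0)"
      by (rule flat_tendsto_0)
    then have "((\<lambda>h. (flat p (0 + h) - flat p 0) / h) \<longlongrightarrow> 0) (at 0)"
      by (rule Lim_transform_eventually) (auto simp: flat_def eventually_at intro!: exI[of _ 1])
    then show ?thesis using 3 by (simp add: DERIV_def flat_def)
  qed
qed

text \<open>A class closed under differentiation contains all iterated derivatives of its members,
  so smoothness follows without a formula for the n-th derivative.\<close>

lemma deriv_closed_imp_smooth:
  assumes "S f"
    and "\<And>g. S g \<Longrightarrow> \<exists>g'. S g' \<and> (\<forall>x. (g has_real_derivative g' x) (at x))"
  shows "(deriv ^^ n) f differentiable (at x)"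
proof -
  have step: "S (deriv g)" if g: "S g" for g
  proof -
    obtain g' where g': "S g'" "\<And>x. (g has_real_derivative g' x) (at x)" using assms(2)[OF g] by auto
    then have "deriv g = g'" by (auto simp: fun_eq_iff intro!: DERIV_imp_deriv)
    then show ?thesis using g' by simp
  qed
  have "S ((deriv ^^ n) f)" by (induction n) (auto simp: assms(1) step)
  then show ?thesis using assms(2) by (metis real_differentiable_def)
qed

text \<open>The product rule turns a generator into a difference of two generators, because d - (x -
  a) has derivative -1. Closing under subtraction alone thus gives a class closed under
  differentiation.\<close>

inductive bump_span :: "real \<Rightarrow> (real \<Rightarrow> real) \<Rightarrow> bool" for d where
  prod: "bump_span d (\<lambda>x. flat p (d - (x - a)) * flat q (d + (x - a)))"
| diff: "bump_span d f \<Longrightarrow> bump_span d g \<Longrightarrow> bump_span d (\<lambda>x. f x - g x)"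

lemma bump_span_deriv:
  "bump_span d f \<Longrightarrow> \<exists>f'. bump_span d f' \<and> (\<forall>x. (f has_real_derivative f' x) (at x))"
proof (induction rule: bump_span.induct)
  case (prod p a q)
  have 1: "((\<lambda>x. flat q (d + (x - a))) has_real_derivative flat (flat_diff q) (d + (x - a))) (at x)" for q x
    by (rule DERIV_cong[OF DERIV_chain'[OF _ flat_has_derivative, of _ 1]]) (auto intro!: derivative_eq_intros)
  have 2: "((\<lambda>x. flat p (d - (x - a))) has_real_derivative - flat (flat_diff p) (d - (x - a))) (at x)" for p x
    by (rule DERIV_cong[OF DERIV_chain'[OF _ flat_has_derivative, of _ "- 1"]]) (auto intro!: derivative_eq_intros)
  show ?case
    by (rule exI[of _ "\<lambda>x. flat p (d - (x - a)) * flat (flat_diff q) (d + (x - a))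
      - flat (flat_diff p) (d - (x - a)) * flat q (d + (x - a))"])
      (auto intro!: bump_span.intros derivative_eq_intros 1 2)
next
  case (diff f g)
  then obtain f' g' where "bump_span d f'" "bump_span d g'"
    "\<And>x. (f has_real_derivative f' x) (at x)" "\<And>x. (g has_real_derivative g' x) (at x)" by auto
  then show ?case
    by (intro exI[of _ "\<lambda>x. f' x - g' x"]) (auto intro!: bump_span.intros derivative_eq_intros)
qed

definition bump :: "real \<Rightarrow> real \<Rightarrow> real" where
  "bump d x = flat 1 (d - x) * flat 1 (d + x)"

lemma bump_nonneg: "bump d x \<ge> 0"
  by (simp add: bump_def flat_def)

lemma bump_pos: "\<bar>x\<bar> < d \<Longrightarrow> bump d x > 0"
  by (auto simp: bump_def flat_def)

lemma bump_eq_0: "\<bar>x\<bar> \<ge> d \<Longrightarrow> bump d x = 0"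
  by (auto simp: bump_def flat_def)

lemma isCont_bump: "isCont (bump d) x"
proof -
  have "isCont (flat p) y" for p y by (rule DERIV_isCont[OF flat_has_derivative])
  then have "isCont (\<lambda>x. flat p (h x)) x" if "isCont h x" for p h
    using isCont_o2[OF that] by blast
  then show ?thesis unfolding bump_def by (intro continuous_intros) auto
qed

lemma bump_span_bump: "bump_span d (\<lambda>x. bump d (x - a) - bump d (x - b))"
  unfolding bump_def by (intro bump_span.intros)

lemma bump_antiderivative:
  obtains P where "\<And>x. (P has_real_derivative bump d x) (at x)"
proof -
  define P where "P x = (LBINT t=ereal 0..x. bump d t)" for x :: real
  have "(P has_real_derivative bump d x) (at x)" for x
  proof -
    have "((\<lambda>u. LBINT y=ereal 0..u. bump d y) has_vector_derivative bump d x) (at x within {min 0 x - 1..max 0 x + 1})"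
      by (rule interval_integral_FTC2)
        (auto intro!: continuous_at_imp_continuous_on isCont_bump)
    then have "((\<lambda>u. LBINT y=ereal 0..u. bump d y) has_vector_derivative bump d x) (at x)"
      by (simp add: at_within_Icc_at)
    then show ?thesis
      by (simp add: P_def [abs_def] has_real_derivative_iff_has_vector_derivative)
  qed
  then show ?thesis using that by blast
qed

text \<open>The two bumps have equal mass, so the difference of the shifted antiderivatives vanishes
  on both sides of the supports. A primitive of a single bump cannot have compact support.\<close>

lemma test_function_bump_difference:
  assumes d: "d > 0" and a: "-1 < a - d" "a + d < 1" and b: "-1 < b - d" "b + d < 1"
  obtains \<phi> where "test_function \<phi>" "\<And>x. (\<phi> has_real_derivative bump d (x - a) - bump d (x - b)) (at x)"
proof -
  obtain P where P: "\<And>x. (P has_real_derivative bump d x) (at x)" using bump_antiderivative by blast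
  define \<phi> where "\<phi> x = P (x - a) - P (x - b)" for x
  have shift: "((\<lambda>x. P (x - c)) has_real_derivative bump d (x - c)) (at x)" for c x
    by (rule DERIV_cong[OF DERIV_chain'[OF _ P, of _ 1]]) (auto intro!: derivative_eq_intros)
  have D: "(\<phi> has_real_derivative bump d (x - a) - bump d (x - b)) (at x)" for x
    unfolding \<phi>_def by (intro DERIV_diff shift)
  define l r where "l = min (a - d) (b - d)" and "r = max (a + d) (b + d)"
  have cont: "continuous_on S P" for S
    by (intro continuous_at_imp_continuous_on ballI DERIV_isCont[OF P])
  have P0: "(P has_real_derivative 0) (at x)" if "\<bar>x\<bar> \<ge> d" for x
    using P[of x] bump_eq_0[OF that] by simp
  have Pl: "P x = P (- d)" if "x \<le> - d" for x
  proof (cases "x = - d")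
    case False
    then have "P (- d) = P x"
      using that d by (intro DERIV_isconst_end cont P0) auto
    then show ?thesis by simp
  qed simp
  have Pr: "P x = P d" if "x \<ge> d" for x
  proof (cases "x = d")
    case False
    then show ?thesis
      using that d by (intro DERIV_isconst_end cont P0) auto
  qed simp
  have "\<phi> x = 0" if "x \<notin> {l..r}" for x
  proof (cases "x < l")
    case True
    then have "x - a \<le> - d" "x - b \<le> - d" by (auto simp: l_def)
    then show ?thesis using Pl[of "x - a"] Pl[of "x - b"] by (simp add: \<phi>_def)
  next
    case False
    then have "x - a \<ge> d" "x - b \<ge> d" using that by (auto simp: r_def)
    then show ?thesis using Pr[of "x - a"] Pr[of "x - b"] by (simp add: \<phi>_def)
  qed
  then have "{x. \<phi> x \<noteq> 0} \<subseteq> {l..r}" by blast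
  then have supp: "closure {x. \<phi> x \<noteq> 0} \<subseteq> {l..r}"
    by (intro closure_minimal) auto
  have "(deriv ^^ n) \<phi> differentiable (at x)" for n x
  \<comment> \<open>\<open>\<phi>\<close> itself is built from antiderivatives; the closed class
    \<open>bump_span\<close> takes over only from the first derivative on.\<close>
  proof (cases n)
    case 0
    then show ?thesis using D real_differentiable_def by auto
  next
    case (Suc m)
    have "deriv \<phi> = (\<lambda>x. bump d (x - a) - bump d (x - b))"
      using D by (auto intro!: DERIV_imp_deriv)
    then have "(deriv ^^ n) \<phi> = (deriv ^^ m) (\<lambda>x. bump d (x - a) - bump d (x - b))"
      by (simp add: Suc funpow_swap1)
    then show ?thesis
      using deriv_closed_imp_smooth[OF bump_span_bump bump_span_deriv] by simp
  qed
  moreover have "compact (closure {x. \<phi> x \<noteq> 0})"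
    using compact_Icc[of l r] supp by (metis closed_closure compact_Int_closed inf.absorb_iff2 inf_commute)
  moreover have "closure {x. \<phi> x \<noteq> 0} \<subseteq> {-1<..<1}"
    by (rule subset_trans[OF supp]) (use a b in \<open>auto simp: l_def r_def\<close>)
  ultimately have "test_function \<phi>" by (auto simp: test_function_def)
  then show ?thesis using that D by blast
qed

section \<open>Square integrable functions and their primitives\<close>

text \<open>Restricting the measure turns the set integrals of the energy into ordinary integrals
  over a finite measure. Its total mass is the 2 in \<open>2 / \<eta>\<close>, \<open>2 * B\<close>
  and \<open>m1 / 2\<close>.\<close>

abbreviation \<L> :: "real measure" where
  "\<L> \<equiv> restrict_space lborel {-1..1}"

lemma space_L [simp]: "space \<L> = {-1..1}"
  by (simp add: space_restrict_space)

lemma measure_L: "measure \<L> {-1..1} = 2"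
  by (simp add: measure_restrict_space)

interpretation L: finite_measure \<L>
  by standard (simp add: emeasure_restrict_space)

interpretation LL: pair_sigma_finite \<L> \<L> ..

lemma set_integral_eq_L: "(LBINT y:{-1..1}. f y) = (\<integral>y. f y \<partial>\<L>)" for f :: "real \<Rightarrow> real"
  by (simp add: integral_restrict_space set_lebesgue_integral_def)

lemma set_integrable_iff_L: "set_integrable lborel {-1..1} f \<longleftrightarrow> integrable \<L> f" for f :: "real \<Rightarrow> real"
  by (simp add: integrable_restrict_space set_integrable_def)

lemma L2_iff: "L2 f \<longleftrightarrow> f \<in> borel_measurable \<L> \<and> integrable \<L> (\<lambda>y. (f y)\<^sup>2)"
  by (simp add: L2_def set_integrable_iff_L set_borel_measurable_def borel_measurable_restrict_space_iff)

lemma L2_measurable: "L2 f \<Longrightarrow> f \<in> borel_measurable \<L>"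
  and L2_integrable_power2: "L2 f \<Longrightarrow> integrable \<L> (\<lambda>y. (f y)\<^sup>2)"
  by (auto simp: L2_iff)

lemma L2_integrable_mult:
  assumes "L2 f" "L2 g" shows "integrable \<L> (\<lambda>y. f y * g y)"
proof (rule Bochner_Integration.integrable_bound)
  show "integrable \<L> (\<lambda>y. (f y)\<^sup>2 + (g y)\<^sup>2)" using assms by (simp add: L2_iff)
  show "(\<lambda>y. f y * g y) \<in> borel_measurable \<L>" using assms by (auto simp: L2_iff)
  have "\<bar>a * b\<bar> \<le> \<bar>a\<^sup>2 + b\<^sup>2\<bar>" for a b :: real
  proof -
    have "2 * (\<bar>a\<bar> * \<bar>b\<bar>) \<le> a\<^sup>2 + b\<^sup>2"
      using sum_squares_bound[of "\<bar>a\<bar>" "\<bar>b\<bar>"] by (simp add: mult.assoc)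
    moreover have "0 \<le> \<bar>a\<bar> * \<bar>b\<bar>" by simp
    ultimately show ?thesis unfolding abs_mult by linarith
  qed
  then show "AE y in \<L>. norm (f y * g y) \<le> norm ((f y)\<^sup>2 + (g y)\<^sup>2)" by simp
qed

lemma L2_continuous:
  assumes "continuous_on {-1..1} f" shows "L2 f"
proof -
  have "set_integrable lborel {-1..1} (\<lambda>y. (f y)\<^sup>2)"
    by (intro borel_integrable_atLeastAtMost' continuous_intros assms)
  moreover have "f \<in> borel_measurable \<L>"
    using borel_measurable_continuous_on_restrict[OF assms]
    by (simp cong: measurable_cong_sets add: sets_restrict_space)
  ultimately show ?thesis by (simp add: L2_iff set_integrable_iff_L)
qed

lemma L2_const: "L2 (\<lambda>_. c)"
  by (intro L2_continuous continuous_intros)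

lemma L2_integrable: "L2 f \<Longrightarrow> integrable \<L> f"
  using L2_integrable_mult[OF _ L2_const[of 1]] by simp

lemma L2_add:
  assumes "L2 f" "L2 g" shows "L2 (\<lambda>y. f y + g y)"
  using assms L2_integrable_mult[OF assms]
  by (auto simp: L2_iff power2_sum mult.assoc)

lemma L2_cmult: "L2 f \<Longrightarrow> L2 (\<lambda>y. c * f y)"
  by (auto simp: L2_iff power_mult_distrib)

lemma L2_diff:
  assumes "L2 f" "L2 g" shows "L2 (\<lambda>y. f y - g y)"
  using L2_add[OF assms(1) L2_cmult[OF assms(2), of "-1"]] by simp

section \<open>Lebesgue primitives: modulus of continuity, fundamental theorem, integration by
  parts\<close>

definition primitive :: "(real \<Rightarrow> real) \<Rightarrow> real \<Rightarrow> real" where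
  "primitive g y = (\<integral>t. indicator {-1..y} t * g t \<partial>\<L>)"

lemma borel_measurable_indicator_L: "A \<in> sets borel \<Longrightarrow> indicator A \<in> borel_measurable \<L>"
  for A :: "real set"
  by (intro measurable_restrict_space1 borel_measurable_indicator) simp

lemma integrable_indicator_mult:
  fixes g :: "real \<Rightarrow> real"
  assumes "integrable \<L> g" "A \<in> sets borel"
  shows "integrable \<L> (\<lambda>t. indicator A t * g t)"
proof (rule Bochner_Integration.integrable_bound[OF assms(1)])
  show "(\<lambda>t. indicator A t * g t) \<in> borel_measurable \<L>"
    using assms by (intro borel_measurable_times borel_measurable_indicator_L) auto
qed (auto simp: indicator_def)

lemma primitive_add:
  "integrable \<L> f \<Longrightarrow> integrable \<L> g \<Longrightarrow> primitive (\<lambda>t. f t + g t) y = primitive f y + primitive g y"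
  by (simp add: primitive_def distrib_left integrable_indicator_mult)

lemma primitive_diff:
  "integrable \<L> f \<Longrightarrow> integrable \<L> g \<Longrightarrow> primitive (\<lambda>t. f t - g t) y = primitive f y - primitive g y"
  by (simp add: primitive_def right_diff_distrib integrable_indicator_mult)

lemma primitive_cmult: "primitive (\<lambda>t. c * f t) y = c * primitive f y"
  by (simp add: primitive_def mult.left_commute)

lemma primitive_1: "primitive g 1 = (\<integral>t. g t \<partial>\<L>)"
  unfolding primitive_def by (rule Bochner_Integration.integral_cong) auto

lemma AE_L_neq: "AE t in \<L>. t \<noteq> c"
  by (auto simp: AE_restrict_space_iff intro: eventually_mono[OF AE_lborel_singleton])

lemma primitive_minus_1: "primitive g (-1) = 0"
proof -
  have "AE t in \<L>. indicator {-1..-1} t * g t = 0"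
    by (rule eventually_mono[OF AE_L_neq[of "-1"]]) (auto simp: indicator_def)
  then show ?thesis unfolding primitive_def by (rule integral_eq_zero_AE)
qed

lemma primitive_cong_AE:
  assumes "AE t in \<L>. f t = g t" "f \<in> borel_measurable \<L>" "g \<in> borel_measurable \<L>"
  shows "primitive f y = primitive g y"
  unfolding primitive_def
  by (rule integral_cong_AE)
    (use assms in \<open>auto intro!: borel_measurable_times borel_measurable_indicator_L\<close>)

lemma primitive_const: "-1 \<le> y \<Longrightarrow> y \<le> 1 \<Longrightarrow> primitive (\<lambda>_. c) y = c * (y + 1)"
  by (simp add: primitive_def measure_restrict_space Int_absorb2)

text \<open>Integrate |g| <= \<eta> g^2 + 1/\<eta> over (x, y]. A suitable parameter later makes the
  increment small uniformly over all \<open>g\<close> of bounded energy.\<close>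

lemma primitive_increment_le:
  assumes g: "L2 g" and xy: "-1 \<le> x" "x \<le> y" "y \<le> 1" and \<eta>: "\<eta> > 0"
  shows "\<bar>primitive g y - primitive g x\<bar> \<le> \<eta> * (\<integral>t. (g t)\<^sup>2 \<partial>\<L>) + (y - x) / \<eta>"
proof -
  note gi = L2_integrable[OF g] L2_integrable_power2[OF g]
  have "primitive g y - primitive g x = (\<integral>t. indicator {-1..y} t * g t - indicator {-1..x} t * g t \<partial>\<L>)"
    unfolding primitive_def by (intro Bochner_Integration.integral_diff[symmetric] integrable_indicator_mult gi) auto
  also have "\<dots> = (\<integral>t. indicator {x<..y} t * g t \<partial>\<L>)"
    using xy by (intro Bochner_Integration.integral_cong) (auto simp: indicator_def)
  also have "\<bar>\<dots>\<bar> \<le> (\<integral>t. \<bar>indicator {x<..y} t * g t\<bar> \<partial>\<L>)"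
    by (rule integral_abs_bound)
  also have "\<dots> \<le> (\<integral>t. \<eta> * (g t)\<^sup>2 + indicator {x<..y} t * (1 / \<eta>) \<partial>\<L>)"
  proof (rule integral_mono)
    show "integrable \<L> (\<lambda>t. \<bar>indicator {x<..y} t * g t\<bar>)"
      by (intro integrable_abs integrable_indicator_mult gi) auto
    show "integrable \<L> (\<lambda>t. \<eta> * (g t)\<^sup>2 + indicator {x<..y} t * (1 / \<eta>))"
      by (intro Bochner_Integration.integrable_add integrable_indicator_mult integrable_mult_right gi) auto
    fix t :: real
    have "\<bar>g t\<bar> \<le> \<eta> * (g t)\<^sup>2 + 1 / \<eta>"
    proof -
      have "2 * (\<eta> * \<bar>g t\<bar>) * 1 \<le> (\<eta> * \<bar>g t\<bar>)\<^sup>2 + 1\<^sup>2" by (rule sum_squares_bound)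
      moreover have "\<eta> * \<bar>g t\<bar> \<ge> 0" using \<eta> by simp
      moreover have "\<eta> * (\<eta> * (g t)\<^sup>2 + 1 / \<eta>) = (\<eta> * \<bar>g t\<bar>)\<^sup>2 + 1\<^sup>2"
        using \<eta> by (simp add: power2_eq_square distrib_left)
      ultimately have "\<eta> * \<bar>g t\<bar> \<le> \<eta> * (\<eta> * (g t)\<^sup>2 + 1 / \<eta>)"
        by linarith
      then show ?thesis using \<eta> by simp
    qed
    then show "\<bar>indicator {x<..y} t * g t\<bar> \<le> \<eta> * (g t)\<^sup>2 + indicator {x<..y} t * (1 / \<eta>)"
      using \<eta> by (auto simp: indicator_def)
  qed
  also have "\<dots> = \<eta> * (\<integral>t. (g t)\<^sup>2 \<partial>\<L>) + (\<integral>t. indicator {x<..y} t * (1 / \<eta>) \<partial>\<L>)"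
  proof -
    have "integrable \<L> (\<lambda>t. indicator {x<..y} t * (1 / \<eta>))" by (intro integrable_indicator_mult) auto
    then show ?thesis using gi by (subst Bochner_Integration.integral_add) simp_all
  qed
  also have "(\<integral>t. indicator {x<..y} t * (1 / \<eta>) \<partial>\<L>) = (y - x) / \<eta>"
  proof -
    have "measure \<L> {x<..y} = measure lborel {x<..y}"
      by (rule measure_restrict_space) (use xy in auto)
    moreover have "{x<..y} \<inter> {-1..1} = {x<..y}" using xy by auto
    ultimately show ?thesis using xy by simp
  qed
  finally show ?thesis .
qed

lemma primitive_equicontinuous:
  assumes "e > 0"
  shows "\<exists>d>0. \<forall>g x y. L2 g \<longrightarrow> (\<integral>t. (g t)\<^sup>2 \<partial>\<L>) \<le> K \<longrightarrow> x \<in> {-1..1} \<longrightarrow> y \<in> {-1..1} \<longrightarrow>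
    \<bar>x - y\<bar> < d \<longrightarrow> \<bar>primitive g x - primitive g y\<bar> < e"
proof -
  \<comment> \<open>The energy term is then at most e/2, and (y - x)/\<eta> falls below e/2 on a
    window of width \<eta> e/2. The summand 1 keeps the denominator positive when K = 0.\<close>
  define \<eta> where "\<eta> = e / (2 * (\<bar>K\<bar> + 1))"
  have \<eta>: "\<eta> > 0" using assms by (simp add: \<eta>_def)
  have *: "\<bar>primitive g y - primitive g x\<bar> < e" if "L2 g" "(\<integral>t. (g t)\<^sup>2 \<partial>\<L>) \<le> K"
    "-1 \<le> x" "x \<le> y" "y \<le> 1" "y - x < \<eta> * e / 2" for g x y
  proof -
    have "\<bar>primitive g y - primitive g x\<bar> \<le> \<eta> * (\<integral>t. (g t)\<^sup>2 \<partial>\<L>) + (y - x) / \<eta>"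
      using primitive_increment_le that(1,3-5) \<eta> by blast
    also have "\<eta> * (\<integral>t. (g t)\<^sup>2 \<partial>\<L>) \<le> \<eta> * (\<bar>K\<bar> + 1)" using that \<eta> by (intro mult_left_mono) auto
    also have "\<dots> = e / 2"
    proof -
      have "\<bar>K\<bar> + 1 \<noteq> 0" by linarith
      then show ?thesis unfolding \<eta>_def by (simp add: divide_simps)
    qed
    also have "(y - x) / \<eta> < e / 2" using that \<eta> by (simp add: field_simps)
    finally show ?thesis by simp
  qed
  show ?thesis
  proof (intro exI[of _ "\<eta> * e / 2"] conjI allI impI)
    show "\<eta> * e / 2 > 0" using \<eta> assms by simp
    fix g x y assume "L2 g" "(\<integral>t. (g t)\<^sup>2 \<partial>\<L>) \<le> K" "x \<in> {-1..1}" "y \<in> {-1..1}" "\<bar>x - y\<bar> < \<eta> * e / 2"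
    then show "\<bar>primitive g x - primitive g y\<bar> < e"
      using *[of g x y] *[of g y x] by (cases "x \<le> y") (auto simp: abs_minus_commute)
  qed
qed

lemma continuous_on_primitive:
  assumes "L2 g" shows "continuous_on {-1..1} (primitive g)"
  unfolding continuous_on_iff
proof (intro ballI allI impI)
  fix x e :: real assume "x \<in> {-1..1}" "e > 0"
  then show "\<exists>d>0. \<forall>y\<in>{-1..1}. dist y x < d \<longrightarrow> dist (primitive g y) (primitive g x) < e"
    using primitive_equicontinuous[of e "\<integral>t. (g t)\<^sup>2 \<partial>\<L>"] assms by (fastforce simp: dist_real_def)
qed

lemma primitive_has_derivative:
  assumes f: "continuous_on {-1..1} f" and x: "x \<in> {-1..1}"
  shows "(primitive f has_real_derivative f x) (at x within {-1..1})"
proof -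
  have eq: "integral {-1..y} f = primitive f y" if y: "y \<in> {-1..1}" for y
  proof -
    have "set_integrable lborel {-1..y} f"
      using y by (intro borel_integrable_atLeastAtMost' continuous_on_subset[OF f]) auto
    then have "integral {-1..y} f = (LBINT t:{-1..y}. f t)"
      by (simp add: set_borel_integral_eq_integral)
    also have "\<dots> = primitive f y"
      using y unfolding primitive_def set_lebesgue_integral_def
      by (subst integral_restrict_space) (auto intro!: Bochner_Integration.integral_cong simp: indicator_def)
    finally show ?thesis .
  qed
  have "((\<lambda>y. integral {-1..y} f) has_real_derivative f x) (at x within {-1..1})"
    using integral_has_vector_derivative[OF f x] by (simp add: has_real_derivative_iff_has_vector_derivative)
  then show ?thesis
    by (rule has_field_derivative_transform_within[where d=1]) (use x eq in auto)
qed

text \<open>Fubini for f(y) g(t) over the triangle t <= y: integrating in t first gives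
  \<open>primitive g y\<close>, integrating in y first gives the integral of \<open>f\<close> above
  t.\<close>

lemma integration_by_parts:
  assumes f: "integrable \<L> f" and g: "integrable \<L> g"
  shows "(\<integral>y. primitive g y * f y \<partial>\<L>) = (\<integral>t. g t * (primitive f 1 - primitive f t) \<partial>\<L>)"
proof -
  have [measurable]: "f \<in> borel_measurable \<L>" "g \<in> borel_measurable \<L>"
    using f g by auto
  define H where "H p = (if snd p \<le> fst p then f (fst p) * g (snd p) else 0)" for p :: "real \<times> real"
  have id: "(\<lambda>x. x) \<in> borel_measurable \<L>" by (rule measurable_restrict_space1) simp
  have [measurable]: "fst \<in> borel_measurable (\<L> \<Otimes>\<^sub>M \<L>)" "snd \<in> borel_measurable (\<L> \<Otimes>\<^sub>M \<L>)"
    using measurable_compose[OF measurable_fst id] measurable_compose[OF measurable_snd id] by auto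
  have [measurable]: "(\<lambda>p. f (fst p)) \<in> borel_measurable (\<L> \<Otimes>\<^sub>M \<L>)"
    "(\<lambda>p. g (snd p)) \<in> borel_measurable (\<L> \<Otimes>\<^sub>M \<L>)"
    by (rule measurable_compose[OF measurable_fst] measurable_compose[OF measurable_snd]; measurable)+
  have H1: "integrable (\<L> \<Otimes>\<^sub>M \<L>) (\<lambda>p. f (fst p) * g (snd p))"
  proof (rule LL.Fubini_integrable)
    show "integrable \<L> (\<lambda>x. \<integral>y. norm (f (fst (x, y)) * g (snd (x, y))) \<partial>\<L>)"
      using f by (simp add: abs_mult)
    show "AE x in \<L>. integrable \<L> (\<lambda>y. f (fst (x, y)) * g (snd (x, y)))"
      using g by simp
  qed measurable
  have H: "integrable (\<L> \<Otimes>\<^sub>M \<L>) H"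
  proof (rule Bochner_Integration.integrable_bound[OF H1])
    show "H \<in> borel_measurable (\<L> \<Otimes>\<^sub>M \<L>)" unfolding H_def by measurable
  qed (auto simp: H_def)
  have "(\<integral>y. primitive g y * f y \<partial>\<L>) = (\<integral>y. \<integral>t. H (y, t) \<partial>\<L> \<partial>\<L>)"
  proof (rule Bochner_Integration.integral_cong[OF refl])
    fix y
    have "(\<integral>t. H (y, t) \<partial>\<L>) = (\<integral>t. f y * (indicator {-1..y} t * g t) \<partial>\<L>)"
      by (rule Bochner_Integration.integral_cong) (auto simp: H_def indicator_def)
    then show "primitive g y * f y = (\<integral>t. H (y, t) \<partial>\<L>)"
      by (simp add: primitive_def)
  qed
  also have "\<dots> = (\<integral>t. \<integral>y. H (y, t) \<partial>\<L> \<partial>\<L>)"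
    using LL.Fubini_integral[of "\<lambda>x y. H (x, y)"] H by simp
  also have "\<dots> = (\<integral>t. g t * (primitive f 1 - primitive f t) \<partial>\<L>)"
  proof (rule Bochner_Integration.integral_cong[OF refl])
    fix t assume t: "t \<in> space \<L>"
    have "(\<integral>y. H (y, t) \<partial>\<L>) = (\<integral>y. g t * (f y - indicator {-1..t} y * f y) \<partial>\<L>)"
    proof (rule integral_cong_AE)
      \<comment> \<open>The diagonal y = t belongs to the triangle but not to the complement of
        \<open>{-1..t}\<close>, so the integrands agree only almost everywhere.\<close>
      have "AE y in \<L>. y \<noteq> t \<and> y \<in> space \<L>" using AE_L_neq AE_space by eventually_elim auto
      then show "AE y in \<L>. H (y, t) = g t * (f y - indicator {-1..t} y * f y)"
        by (rule eventually_mono) (use t in \<open>auto simp: H_def indicator_def algebra_simps\<close>)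
      have [measurable]: "t \<in> space \<L>" by fact
      show "(\<lambda>y. H (y, t)) \<in> borel_measurable \<L>"
        by (rule measurable_compose[OF measurable_Pair2']) (use H t in auto)
      show "(\<lambda>y. g t * (f y - indicator {-1..t} y * f y)) \<in> borel_measurable \<L>"
        by (intro borel_measurable_times borel_measurable_diff borel_measurable_indicator_L) auto
    qed
    also have "\<dots> = g t * (primitive f 1 - primitive f t)"
      unfolding primitive_1 unfolding primitive_def using f by (simp add: integrable_indicator_mult)
    finally show "(\<integral>y. H (y, t) \<partial>\<L>) = g t * (primitive f 1 - primitive f t)" .
  qed
  finally show ?thesis .
qed

section \<open>Weak derivatives\<close>

lemma primitive_eq_increment:
  assumes f: "continuous_on {-1..1} f"
    and F: "\<And>x. x \<in> {-1..1} \<Longrightarrow> (F has_real_derivative f x) (at x within {-1..1})"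
    and y: "y \<in> {-1..1}"
  shows "primitive f y = F y - F (-1)"
proof -
  have "((\<lambda>x. primitive f x - F x) has_real_derivative 0) (at x within {-1..1})" if "x \<in> {-1..1}" for x
    using DERIV_diff[OF primitive_has_derivative[OF f that] F[OF that]] by simp
  then obtain c where "\<And>x. x \<in> {-1..1} \<Longrightarrow> primitive f x - F x = c"
    using has_field_derivative_zero_constant[of "{-1..1}" "\<lambda>x. primitive f x - F x"] by auto
  from this[OF y] this[of "-1"] show ?thesis by (simp add: primitive_minus_1)
qed

lemma test_function_props:
  assumes "test_function \<phi>"
  shows "(\<phi> has_real_derivative deriv \<phi> x) (at x)" "continuous_on S (deriv \<phi>)" "\<phi> (-1) = 0" "\<phi> 1 = 0"
proof -
  have diff: "(deriv ^^ n) \<phi> differentiable (at x)" for n x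
    using assms by (simp add: test_function_def)
  show "(\<phi> has_real_derivative deriv \<phi> x) (at x)"
    using diff[of 0 x] unfolding DERIV_deriv_iff_real_differentiable by simp
  have "isCont (deriv \<phi>) x" for x
    using diff[of 1 x] by (intro differentiable_imp_continuous_within) simp
  then show "continuous_on S (deriv \<phi>)"
    by (intro continuous_at_imp_continuous_on ballI)
  have "closure {x. \<phi> x \<noteq> 0} \<subseteq> {-1<..<1}" using assms by (simp add: test_function_def)
  then have "{x. \<phi> x \<noteq> 0} \<subseteq> {-1<..<1}" by (rule subset_trans[OF closure_subset])
  then have "-1 \<notin> {x. \<phi> x \<noteq> 0}" "1 \<notin> {x. \<phi> x \<noteq> 0}" by (meson greaterThanLessThan_iff less_irrefl subsetD)+
  then show "\<phi> (-1) = 0" "\<phi> 1 = 0" by simp_all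
qed

text \<open>Integration by parts against \<open>deriv \<phi>\<close>, whose primitive is
  \<open>\<phi>\<close>; \<phi>(1) = 0 removes both the additive constant and the boundary
  term.\<close>

lemma has_weak_derivative_primitive:
  assumes g: "L2 g" and u: "\<And>y. y \<in> {-1..1} \<Longrightarrow> u y = c + primitive g y"
  shows "has_weak_derivative u g"
  unfolding has_weak_derivative_def set_integral_eq_L
proof (intro allI impI)
  fix \<phi> assume \<phi>: "test_function \<phi>"
  note p = test_function_props[OF \<phi>]
  have prim: "primitive (deriv \<phi>) y = \<phi> y" if "y \<in> {-1..1}" for y
    by (subst primitive_eq_increment[OF p(2) _ that, of \<phi>]) (auto intro: has_field_derivative_at_within p(1) simp: p(3))
  have d: "L2 (deriv \<phi>)" by (intro L2_continuous p)
  have "(\<integral>y. u y * deriv \<phi> y \<partial>\<L>) = (\<integral>y. c * deriv \<phi> y + primitive g y * deriv \<phi> y \<partial>\<L>)"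
    by (rule Bochner_Integration.integral_cong) (auto simp: u distrib_right)
  also have "\<dots> = c * primitive (deriv \<phi>) 1 + (\<integral>y. primitive g y * deriv \<phi> y \<partial>\<L>)"
    using L2_integrable[OF d] L2_integrable_mult[OF L2_continuous[OF continuous_on_primitive[OF g]] d]
    by (simp add: primitive_1)
  also have "\<dots> = (\<integral>t. g t * (primitive (deriv \<phi>) 1 - primitive (deriv \<phi>) t) \<partial>\<L>)"
    using p(4) by (simp add: prim integration_by_parts[OF L2_integrable[OF d] L2_integrable[OF g]])
  also have "\<dots> = (\<integral>t. - (g t * \<phi> t) \<partial>\<L>)"
    by (rule Bochner_Integration.integral_cong) (auto simp: prim p(4))
  finally show "(\<integral>y. u y * deriv \<phi> y \<partial>\<L>) = - (\<integral>y. g y * \<phi> y \<partial>\<L>)" by simp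
qed

text \<open>Du Bois-Reymond's lemma for continuous functions. If h(a) < m < h(b), take a test
  function whose derivative is a bump at a minus an equal bump at b: then m - h times this
  derivative is nonnegative with integral zero, yet positive at a.\<close>

lemma constant_if_orthogonal_to_derivatives:
  assumes h: "continuous_on {-1..1} h"
    and orth: "\<And>\<phi>. test_function \<phi> \<Longrightarrow> (\<integral>y. h y * deriv \<phi> y \<partial>\<L>) = 0"
    and y: "y \<in> {-1..1}"
  shows "h y = h 0"
proof -
  have False if ab: "a \<in> {-1<..<1}" "b \<in> {-1<..<1}" and less: "h a < h b" for a b
  proof -
    define m where "m = (h a + h b) / 2"
    have m: "h a < m" "m < h b" using less by (auto simp: m_def)
    have cont: "isCont h a" "isCont h b"
      using ab h by (auto intro: continuous_on_interior)
    obtain d1 where d1: "d1 > 0" "\<And>x. \<bar>x - a\<bar> < d1 \<Longrightarrow> \<bar>h x - h a\<bar> < m - h a"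
      using cont(1) m(1) unfolding continuous_at_eps_delta dist_real_def by (metis diff_gt_0_iff_gt)
    obtain d2 where d2: "d2 > 0" "\<And>x. \<bar>x - b\<bar> < d2 \<Longrightarrow> \<bar>h x - h b\<bar> < h b - m"
      using cont(2) m(2) unfolding continuous_at_eps_delta dist_real_def by (metis diff_gt_0_iff_gt)
    define e where "e = Min {d1, d2, 1 - \<bar>a\<bar>, 1 - \<bar>b\<bar>}"
    define d where "d = e / 2"
    have "e > 0" using d1(1) d2(1) ab by (auto simp: e_def)
    moreover have "e \<le> d1" "e \<le> d2" "e \<le> 1 - \<bar>a\<bar>" "e \<le> 1 - \<bar>b\<bar>"
      unfolding e_def by (intro Min_le; simp)+
    ultimately have d: "d > 0" "d < d1" "d < d2" "d < 1 - \<bar>a\<bar>" "d < 1 - \<bar>b\<bar>"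
      unfolding d_def by linarith+
    define k where "k x = bump d (x - a) - bump d (x - b)" for x
    have inside: "- 1 < a - d" "a + d < 1" "- 1 < b - d" "b + d < 1" using d by linarith+
    obtain \<phi> where \<phi>: "test_function \<phi>" "\<And>x. (\<phi> has_real_derivative k x) (at x)"
    proof (rule test_function_bump_difference[OF d(1) inside], goal_cases)
      case (1 \<psi>)
      then show ?case by (intro 1(1)[of \<psi>]) (simp_all add: k_def)
    qed
    have kd: "deriv \<phi> = k" using \<phi>(2) by (auto intro!: DERIV_imp_deriv)
    note p = test_function_props[OF \<phi>(1), unfolded kd]
    define q where "q x = (m - h x) * k x" for x
    have "(\<integral>y. m * k y - h y * k y \<partial>\<L>) = m * primitive k 1"
      using orth[OF \<phi>(1)] L2_integrable_mult[OF L2_continuous[OF h] L2_continuous[OF p(2)]]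
        L2_integrable[OF L2_continuous[OF p(2)]] by (simp add: kd primitive_1)
    also have "primitive k 1 = 0"
      using primitive_eq_increment[OF p(2), of \<phi> 1] p by (auto intro: has_field_derivative_at_within)
    finally have "(LBINT y:{-1..1}. q y) = 0"
      by (simp add: set_integral_eq_L q_def left_diff_distrib)
    moreover have contq: "continuous_on {-1..1} q"
      unfolding q_def by (intro continuous_intros h p)
    ultimately have "integral {-1..1} q = 0"
      using set_borel_integral_eq_integral(2)[OF borel_integrable_atLeastAtMost'[OF contq]] by simp
    moreover have "q x \<ge> 0" for x
    proof -
      \<comment> \<open>Closeness to a forces h < m and closeness to b forces h > m, so the bumps do
        not overlap and each meets the sign of m - h that makes \<open>q\<close>
        nonnegative.\<close>
      consider "\<bar>x - a\<bar> < d" | "\<bar>x - b\<bar> < d" | "\<bar>x - a\<bar> \<ge> d" "\<bar>x - b\<bar> \<ge> d" by linarith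
      then show ?thesis
      proof cases
        case 1
        then have "h x < m" using d1(2)[of x] d by linarith
        then have "bump d (x - b) = 0" using d2(2)[of x] d bump_eq_0[of d "x - b"] by linarith
        then show ?thesis using \<open>h x < m\<close> by (simp add: q_def k_def bump_nonneg)
      next
        case 2
        then have "h x > m" using d2(2)[of x] d by linarith
        then have "bump d (x - a) = 0" using d1(2)[of x] d bump_eq_0[of d "x - a"] by linarith
        then show ?thesis using \<open>h x > m\<close> by (simp add: q_def k_def bump_nonneg mult_nonpos_nonneg)
      qed (simp add: q_def k_def bump_eq_0)
    qed
    ultimately have "\<forall>x\<in>{-1..1}. q x = 0"
      using integral_eq_0_iff[OF contq] by simp
    then have "q a = 0" using ab by simp
    moreover have "\<bar>a - b\<bar> \<ge> d"
      using d2(2)[of a] m d by linarith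
    then have "bump d (a - b) = 0" by (rule bump_eq_0)
    moreover have "bump d 0 > 0" using bump_pos d by simp
    ultimately show False
      using m by (simp add: q_def k_def)
  qed
  note no = this
  have const: "h x = h 0" if "x \<in> {-1<..<1}" for x
  proof (rule ccontr)
    assume "h x \<noteq> h 0"
    then have "h x < h 0 \<or> h 0 < h x" by linarith
    moreover have "(0::real) \<in> {-1<..<1}" by simp
    ultimately show False using no that by blast
  qed
  show ?thesis
  proof (rule continuous_constant_on_closure[of "{-1<..<1}" h "h 0" y])
    show "continuous_on (closure {-1<..<1}) h" "y \<in> closure {-1<..<1}" using h y by simp_all
  qed (rule const)
qed

text \<open>\<open>u\<close> and \<open>primitive g\<close> have the same weak derivative, so their
  difference is orthogonal to all derivatives of test functions and hence constant.\<close>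

lemma W12_eq_primitive:
  assumes u: "continuous_on {-1..1} u" and g: "L2 g" and w: "has_weak_derivative u g"
    and y: "y \<in> {-1..1}"
  shows "u y = u (-1) + primitive g y"
proof -
  have "u x - primitive g x = u 0 - primitive g 0" if x: "x \<in> {-1..1}" for x
  proof (rule constant_if_orthogonal_to_derivatives[of "\<lambda>x. u x - primitive g x", OF _ _ x])
    show "continuous_on {-1..1} (\<lambda>x. u x - primitive g x)"
      by (intro continuous_intros u continuous_on_primitive g)
    fix \<phi> assume \<phi>: "test_function \<phi>"
    note p = test_function_props[OF \<phi>]
    have "has_weak_derivative (primitive g) g"
      by (rule has_weak_derivative_primitive[OF g, of _ 0]) simp
    with w \<phi> have "(\<integral>y. u y * deriv \<phi> y \<partial>\<L>) = (\<integral>y. primitive g y * deriv \<phi> y \<partial>\<L>)"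
      unfolding has_weak_derivative_def set_integral_eq_L by simp
    then show "(\<integral>y. (u y - primitive g y) * deriv \<phi> y \<partial>\<L>) = 0"
      using L2_integrable_mult[OF L2_continuous L2_continuous, OF u p(2)]
        L2_integrable_mult[OF L2_continuous L2_continuous, OF continuous_on_primitive[OF g] p(2)]
      by (simp add: left_diff_distrib)
  qed
  from this[OF y] this[of "-1"] have "u y - primitive g y = u (-1) - primitive g (-1)" by simp
  then show ?thesis unfolding primitive_minus_1 by simp
qed

text \<open>The signed measure with density \<open>d\<close> vanishes on half-lines, an
  intersection-stable generator of the Borel sets; hence it vanishes on all Borel sets, and its
  density is zero almost everywhere.\<close>

lemma primitive_eq_0_imp_AE:
  assumes d: "integrable \<L> d" and 0: "\<And>y. y \<in> {-1..1} \<Longrightarrow> primitive d y = 0"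
  shows "AE t in \<L>. d t = 0"
proof -
  define f where "f t = indicator {-1..1} t * d t" for t :: real
  have f: "integrable lborel f"
    using d by (simp add: f_def [abs_def] integrable_restrict_space)
  have half: "(LBINT t:{..a}. f t) = 0" for a
  proof -
    define y where "y = max (-1) (min 1 a)"
    \<comment> \<open>For a < -1 the clamped interval is the point -1 instead of the empty set, so
      this point has to be excluded.\<close>
    have "AE t in lborel. t \<noteq> -1" by (rule AE_lborel_singleton)
    then have "AE t in lborel. indicator {..a} t *\<^sub>R f t = indicator {-1..1} t *\<^sub>R (indicator {-1..y} t * d t)"
      by (rule eventually_mono) (auto simp: f_def y_def indicator_def)
    moreover have "(\<lambda>t. indicator {-1..1} t *\<^sub>R (indicator {-1..y} t * d t)) \<in> borel_measurable lborel"
      using integrable_indicator_mult[OF d, of "{-1..y}"] by (simp add: integrable_restrict_space)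
    ultimately have "(LBINT t:{..a}. f t) = (\<integral>t. indicator {-1..1} t *\<^sub>R (indicator {-1..y} t * d t) \<partial>lborel)"
      using f unfolding set_lebesgue_integral_def by (intro integral_cong_AE) auto
    also have "\<dots> = primitive d y"
      unfolding primitive_def by (subst integral_restrict_space) auto
    finally show ?thesis using 0[of y] by (simp add: y_def)
  qed
  have "(LBINT t:A. f t) = 0" if "A \<in> sets borel" for A
  proof -
    have gen: "sets (borel :: real measure) = sigma_sets UNIV (range atMost)"
      by (subst borel_eq_atMost) simp
    have si: "set_integrable lborel B f" if "B \<in> sets borel" for B
      using f that unfolding set_integrable_def by (intro integrable_mult_indicator) auto
    have "Int_stable (range (atMost :: real \<Rightarrow> _))" by (auto simp: Int_stable_def)
    moreover have "range atMost \<subseteq> Pow (UNIV :: real set)" by simp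
    moreover have "A \<in> sigma_sets UNIV (range atMost)" using that gen by simp
    ultimately show ?thesis
    proof (induction rule: sigma_sets_induct_disjoint)
      case (basic A) then show ?case using half by auto
    next
      case (compl A)
      then have A: "A \<in> sets borel" using gen by simp
      \<comment> \<open>Half-lines exhaust the line, so the total integral vanishes and a complement
        inherits zero from its set.\<close>
      have all: "(\<Union>k::nat. {..real k}) = UNIV" by (auto intro: real_arch_simple)
      have "(\<lambda>k::nat. LBINT t:{..real k}. f t) \<longlonglongrightarrow> (LBINT t:UNIV. f t)"
        using set_integral_cont_up[of "\<lambda>k::nat. {..real k}" lborel f] f
        by (simp add: incseq_def all si)
      then have "(LBINT t:UNIV. f t) = 0" by (simp add: half LIMSEQ_const_iff)
      moreover have "(LBINT t:A \<union> (UNIV - A). f t) = (LBINT t:A. f t) + (LBINT t:UNIV - A. f t)"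
        using A by (intro set_integral_Un si) auto
      moreover have "A \<union> (UNIV - A) = UNIV" by auto
      ultimately show ?case using compl by simp
    next
      case (union A)
      then have A: "A i \<in> sets borel" for i using gen by auto
      have "(LBINT t:(\<Union>i. A i). f t) = (\<Sum>i. LBINT t:A i. f t)"
        using union A by (intro lebesgue_integral_countable_add si) (auto simp: disjoint_family_on_def)
      then show ?case using union by simp
    qed (simp add: set_lebesgue_integral_def)
  qed
  then have "AE t in lborel. f t = 0"
    using f by (intro density_unique_real) (auto simp: set_lebesgue_integral_def)
  then show ?thesis
    by (auto simp: AE_restrict_space_iff f_def elim!: eventually_mono)
qed

lemma W12_primitive:
  assumes g: "L2 g" and u: "\<And>y. y \<in> {-1..1} \<Longrightarrow> u y = c + primitive g y"
  shows "u \<in> W12"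
proof -
  have "continuous_on {-1..1} u"
    by (rule continuous_on_eq[of _ "\<lambda>y. c + primitive g y"])
      (simp_all add: u continuous_on_add continuous_on_primitive g)
  moreover have "has_weak_derivative u g" using g u by (rule has_weak_derivative_primitive)
  ultimately show ?thesis using g by (auto simp: W12_def)
qed

lemma weak_deriv_props:
  assumes "u \<in> W12"
  shows "L2 (weak_deriv u)" "\<And>y. y \<in> {-1..1} \<Longrightarrow> u y = u (-1) + primitive (weak_deriv u) y"
proof -
  have u: "continuous_on {-1..1} u" "\<exists>g. L2 g \<and> has_weak_derivative u g" using assms by (auto simp: W12_def)
  from someI_ex[OF u(2)] have "L2 (weak_deriv u)" "has_weak_derivative u (weak_deriv u)"
    by (auto simp: weak_deriv_def)
  then show "L2 (weak_deriv u)" "\<And>y. y \<in> {-1..1} \<Longrightarrow> u y = u (-1) + primitive (weak_deriv u) y"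
    using W12_eq_primitive[OF u(1)] by blast+
qed

text \<open>\<open>weak_deriv\<close> is an arbitrary choice; pinning it down up to null sets lets
  \<open>F_LG\<close> be computed from any known derivative.\<close>

lemma weak_deriv_primitive_AE:
  assumes g: "L2 g" and u: "\<And>y. y \<in> {-1..1} \<Longrightarrow> u y = c + primitive g y"
  shows "AE t in \<L>. weak_deriv u t = g t"
proof -
  have "u \<in> W12" using g u by (rule W12_primitive)
  note w = weak_deriv_props[OF this]
  have "primitive (\<lambda>t. weak_deriv u t - g t) y = 0" if "y \<in> {-1..1}" for y
    using w(2)[OF that] u[OF that] u[of "-1"] primitive_diff[OF L2_integrable[OF w(1)] L2_integrable[OF g]]
    by (simp add: primitive_minus_1)
  then have "AE t in \<L>. weak_deriv u t - g t = 0"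
    using w(1) g by (intro primitive_eq_0_imp_AE L2_integrable L2_diff) auto
  then show ?thesis by simp
qed

section \<open>Completeness of the space of square integrable functions\<close>

lemma L2_abs_integral_le:
  assumes f: "L2 f" and \<eta>: "\<eta> > 0"
  shows "(\<integral>t. \<bar>f t\<bar> \<partial>\<L>) \<le> \<eta> * (\<integral>t. (f t)\<^sup>2 \<partial>\<L>) + 2 / \<eta>"
proof -
  have "(\<integral>t. \<bar>f t\<bar> \<partial>\<L>) \<le> (\<integral>t. \<eta> * (f t)\<^sup>2 + 1 / \<eta> \<partial>\<L>)"
  proof (rule integral_mono)
    show "integrable \<L> (\<lambda>t. \<bar>f t\<bar>)" using L2_integrable[OF f] by simp
    show "integrable \<L> (\<lambda>t. \<eta> * (f t)\<^sup>2 + 1 / \<eta>)" using L2_integrable_power2[OF f] by simp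
    fix t
    have "2 * (\<eta> * \<bar>f t\<bar>) * 1 \<le> (\<eta> * \<bar>f t\<bar>)\<^sup>2 + 1\<^sup>2" by (rule sum_squares_bound)
    moreover have "\<eta> * \<bar>f t\<bar> \<ge> 0" using \<eta> by simp
    moreover have "\<eta> * (\<eta> * (f t)\<^sup>2 + 1 / \<eta>) = (\<eta> * \<bar>f t\<bar>)\<^sup>2 + 1\<^sup>2"
      using \<eta> by (simp add: power2_eq_square distrib_left)
    ultimately have "\<eta> * \<bar>f t\<bar> \<le> \<eta> * (\<eta> * (f t)\<^sup>2 + 1 / \<eta>)" by linarith
    then show "\<bar>f t\<bar> \<le> \<eta> * (f t)\<^sup>2 + 1 / \<eta>" using \<eta> by simp
  qed
  also have "\<dots> = \<eta> * (\<integral>t. (f t)\<^sup>2 \<partial>\<L>) + 2 / \<eta>"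
    using L2_integrable_power2[OF f] by (simp add: measure_L)
  finally show ?thesis .
qed

lemma L2_convergence_imp_L1:
  assumes f: "\<And>n. L2 (f n)" and lim: "(\<lambda>n. \<integral>t. (f n t)\<^sup>2 \<partial>\<L>) \<longlonglongrightarrow> 0"
  shows "(\<lambda>n. \<integral>t. \<bar>f n t\<bar> \<partial>\<L>) \<longlonglongrightarrow> 0"
proof (rule LIMSEQ_I)
  fix e :: real assume e: "e > 0"
  obtain N where N: "\<And>n. n \<ge> N \<Longrightarrow> norm ((\<integral>t. (f n t)\<^sup>2 \<partial>\<L>) - 0) < e\<^sup>2 / 8"
    using LIMSEQ_D[OF lim, of "e\<^sup>2 / 8"] e by auto
  have "(\<integral>t. \<bar>f n t\<bar> \<partial>\<L>) < e" if "n \<ge> N" for n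
  proof -
    \<comment> \<open>With weight 4/e the constant term equals e/2, and a squared error below e^2/8
      contributes less than e/2.\<close>
    have "(\<integral>t. \<bar>f n t\<bar> \<partial>\<L>) \<le> (4 / e) * (\<integral>t. (f n t)\<^sup>2 \<partial>\<L>) + 2 / (4 / e)"
      using e by (intro L2_abs_integral_le f) simp
    also have "\<dots> < (4 / e) * (e\<^sup>2 / 8) + 2 / (4 / e)"
      using N[OF that] e by (intro add_strict_right_mono mult_strict_left_mono) auto
    also have "\<dots> = e" using e by (simp add: power2_eq_square)
    finally show ?thesis .
  qed
  then show "\<exists>N. \<forall>n\<ge>N. norm ((\<integral>t. \<bar>f n t\<bar> \<partial>\<L>) - 0) < e" by (intro exI[of _ N]) auto
qed

text \<open>On a finite measure, Cauchy in L2 implies Cauchy in L1, which yields a subsequence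
  converging almost everywhere. Fatou's lemma, applied to the squares of
  \<open>f n - f (r i)\<close> for fixed n, turns this into L2 convergence of the whole
  sequence.\<close>

lemma L2_complete:
  assumes f: "\<And>n. L2 (f n)"
    and cauchy: "\<And>e. e > 0 \<Longrightarrow> \<exists>N. \<forall>i\<ge>N. \<forall>j\<ge>N. (\<integral>t. (f i t - f j t)\<^sup>2 \<partial>\<L>) < e"
  obtains g where "L2 g" "(\<lambda>n. \<integral>t. (f n t - g t)\<^sup>2 \<partial>\<L>) \<longlonglongrightarrow> 0"
proof -
  have L1: "\<exists>N. \<forall>i\<ge>N. \<forall>j\<ge>N. (\<integral>t. norm (f i t - f j t) \<partial>\<L>) < e" if e: "e > 0" for e :: real
  proof -
    obtain N where N: "\<And>i j. i \<ge> N \<Longrightarrow> j \<ge> N \<Longrightarrow> (\<integral>t. (f i t - f j t)\<^sup>2 \<partial>\<L>) < e\<^sup>2 / 8"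
      using cauchy[of "e\<^sup>2 / 8"] e by auto
    have "(\<integral>t. norm (f i t - f j t) \<partial>\<L>) < e" if "i \<ge> N" "j \<ge> N" for i j
    proof -
      have "(\<integral>t. norm (f i t - f j t) \<partial>\<L>) \<le> (4 / e) * (\<integral>t. (f i t - f j t)\<^sup>2 \<partial>\<L>) + 2 / (4 / e)"
        unfolding real_norm_def using e by (intro L2_abs_integral_le L2_diff f) simp
      also have "\<dots> < (4 / e) * (e\<^sup>2 / 8) + 2 / (4 / e)"
        using N[OF that] e by (intro add_strict_right_mono mult_strict_left_mono) auto
      also have "\<dots> = e" using e by (simp add: power2_eq_square)
      finally show ?thesis .
    qed
    then show ?thesis by blast
  qed
  obtain r where r: "strict_mono r" "AE x in \<L>. Cauchy (\<lambda>i. f (r i) x)"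
    using cauchy_L1_AE_cauchy_subseq[of \<L> f, OF L2_integrable[OF f] L1] by blast
  define g where "g x = lim (\<lambda>i. f (r i) x)" for x
  have [measurable]: "f n \<in> borel_measurable \<L>" for n by (rule L2_measurable[OF f])
  have [measurable]: "g \<in> borel_measurable \<L>" unfolding g_def by (rule borel_measurable_lim_metric) simp
  have lim: "AE x in \<L>. (\<lambda>i. f (r i) x) \<longlonglongrightarrow> g x"
    using r(2) by (rule eventually_mono) (auto simp: g_def Cauchy_convergent_iff convergent_LIMSEQ_iff)
  have bound: "(\<integral>\<^sup>+t. ennreal ((f n t - g t)\<^sup>2) \<partial>\<L>) \<le> ennreal e"
    if e: "e > 0" and N: "\<And>i j. i \<ge> N \<Longrightarrow> j \<ge> N \<Longrightarrow> (\<integral>t. (f i t - f j t)\<^sup>2 \<partial>\<L>) < e" and n: "n \<ge> N" for e N n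
  proof -
    have "(\<integral>\<^sup>+t. ennreal ((f n t - g t)\<^sup>2) \<partial>\<L>) = (\<integral>\<^sup>+t. liminf (\<lambda>i. ennreal ((f n t - f (r i) t)\<^sup>2)) \<partial>\<L>)"
    proof (rule nn_integral_cong_AE, use lim in eventually_elim)
      case (elim t)
      then have "(\<lambda>i. ennreal ((f n t - f (r i) t)\<^sup>2)) \<longlonglongrightarrow> ennreal ((f n t - g t)\<^sup>2)"
        by (intro tendsto_intros)
      then show ?case by (intro lim_imp_Liminf[symmetric]) auto
    qed
    also have "\<dots> \<le> liminf (\<lambda>i. \<integral>\<^sup>+t. ennreal ((f n t - f (r i) t)\<^sup>2) \<partial>\<L>)"
      by (rule nn_integral_liminf) measurable
    also have "\<dots> \<le> limsup (\<lambda>i. \<integral>\<^sup>+t. ennreal ((f n t - f (r i) t)\<^sup>2) \<partial>\<L>)"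
      by (rule Liminf_le_Limsup) simp
    also have "\<dots> \<le> ennreal e"
    proof (rule Limsup_bounded, rule eventually_sequentiallyI[of N])
      fix i assume "i \<ge> N"
      then have "r i \<ge> N" using seq_suble[OF r(1), of i] by linarith
      have "(\<integral>\<^sup>+t. ennreal ((f n t - f (r i) t)\<^sup>2) \<partial>\<L>) = ennreal (\<integral>t. (f n t - f (r i) t)\<^sup>2 \<partial>\<L>)"
        by (rule nn_integral_eq_integral) (auto intro!: L2_integrable_power2 L2_diff f)
      then show "(\<integral>\<^sup>+t. ennreal ((f n t - f (r i) t)\<^sup>2) \<partial>\<L>) \<le> ennreal e"
        using N[OF n \<open>r i \<ge> N\<close>] by (simp add: ennreal_leI)
    qed
    finally show ?thesis .
  qed
  have L2d: "L2 (\<lambda>t. f n t - g t)" if "e > 0" "\<And>i j. i \<ge> N \<Longrightarrow> j \<ge> N \<Longrightarrow> (\<integral>t. (f i t - f j t)\<^sup>2 \<partial>\<L>) < e" "n \<ge> N" for e N n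
    unfolding L2_iff
  proof
    have "(\<integral>\<^sup>+t. ennreal ((f n t - g t)\<^sup>2) \<partial>\<L>) < \<infinity>"
      using le_less_trans[OF bound[OF that] ennreal_less_top] by simp
    then show "integrable \<L> (\<lambda>t. (f n t - g t)\<^sup>2)"
      by (intro integrableI_nonneg) auto
  qed simp
  obtain N1 where N1: "\<And>i j. i \<ge> N1 \<Longrightarrow> j \<ge> N1 \<Longrightarrow> (\<integral>t. (f i t - f j t)\<^sup>2 \<partial>\<L>) < 1"
    using cauchy[of 1] by auto
  \<comment> \<open>Fatou controls only differences; the limit is square integrable as f N1 - (f N1
    - g).\<close>
  have "L2 (\<lambda>t. f N1 t - g t)" using N1 by (intro L2d[of 1 N1]) auto
  from L2_diff[OF f[of N1] this] have g: "L2 g" by simp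
  have "(\<lambda>n. \<integral>t. (f n t - g t)\<^sup>2 \<partial>\<L>) \<longlonglongrightarrow> 0"
  proof (rule LIMSEQ_I)
    fix e :: real assume e: "e > 0"
    obtain N where N: "\<And>i j. i \<ge> N \<Longrightarrow> j \<ge> N \<Longrightarrow> (\<integral>t. (f i t - f j t)\<^sup>2 \<partial>\<L>) < e / 2"
      using cauchy[of "e / 2"] e by auto
    have "(\<integral>t. (f n t - g t)\<^sup>2 \<partial>\<L>) \<le> e / 2" if n: "n \<ge> N" for n
    proof -
      have "ennreal (\<integral>t. (f n t - g t)\<^sup>2 \<partial>\<L>) = (\<integral>\<^sup>+t. ennreal ((f n t - g t)\<^sup>2) \<partial>\<L>)"
        by (rule nn_integral_eq_integral[symmetric]) (auto intro!: L2_integrable_power2 L2_diff f g)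
      also have "\<dots> \<le> ennreal (e / 2)" using e by (intro bound[OF _ N n]) auto
      finally show ?thesis using e by (simp add: ennreal_le_iff)
    qed
    then show "\<exists>N. \<forall>n\<ge>N. norm ((\<integral>t. (f n t - g t)\<^sup>2 \<partial>\<L>) - 0) < e"
      using e by (intro exI[of _ N]) fastforce
  qed
  with g show ?thesis by (rule that)
qed

lemma primitive_tendsto:
  assumes f: "\<And>n. L2 (f n)" and g: "L2 g" and lim: "(\<lambda>n. \<integral>t. (f n t - g t)\<^sup>2 \<partial>\<L>) \<longlonglongrightarrow> 0"
  shows "(\<lambda>n. primitive (f n) y) \<longlonglongrightarrow> primitive g y"
proof -
  have "(\<lambda>n. \<integral>t. \<bar>f n t - g t\<bar> \<partial>\<L>) \<longlonglongrightarrow> 0"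
    using lim by (intro L2_convergence_imp_L1 L2_diff f g)
  then have "(\<lambda>n. primitive (f n) y - primitive g y) \<longlonglongrightarrow> 0"
  proof (rule Lim_null_comparison[rotated], intro always_eventually allI)
    fix n
    have i: "integrable \<L> (\<lambda>t. f n t - g t)" by (intro L2_integrable L2_diff f g)
    have "primitive (f n) y - primitive g y = primitive (\<lambda>t. f n t - g t) y"
      by (simp add: primitive_diff L2_integrable f g)
    also have "norm \<dots> \<le> (\<integral>t. \<bar>indicator {-1..y} t * (f n t - g t)\<bar> \<partial>\<L>)"
      unfolding primitive_def real_norm_def by (rule integral_abs_bound)
    also have "\<dots> \<le> (\<integral>t. \<bar>f n t - g t\<bar> \<partial>\<L>)"
      using i by (intro integral_mono integrable_abs integrable_indicator_mult) (auto simp: indicator_def)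
    finally show "norm (primitive (f n) y - primitive g y) \<le> (\<integral>t. \<bar>f n t - g t\<bar> \<partial>\<L>)" .
  qed
  then show ?thesis by (simp add: LIM_zero_iff)
qed

lemma square_diff_le:
  fixes a d \<eta> :: real
  assumes "\<eta> > 0"
  shows "(a - d)\<^sup>2 \<le> (1 + \<eta>) * a\<^sup>2 + (1 + 1 / \<eta>) * d\<^sup>2"
proof -
  have "0 \<le> (\<eta> * a + d)\<^sup>2 / \<eta>" using assms by simp
  also have "\<dots> = \<eta> * a\<^sup>2 + 2 * a * d + d\<^sup>2 / \<eta>"
    using assms by (simp add: power2_eq_square field_simps)
  finally show ?thesis by (simp add: power2_diff distrib_right)
qed

text \<open>Replaces the triangle inequality of the L2 norm without square roots: letting f tend to
  g at fixed \<open>\<eta>\<close> and then \<open>\<eta>\<close> to 0 compares the norm of the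
  limit with the limit of the norms.\<close>

lemma L2_norm_perturbation:
  assumes f: "L2 f" and g: "L2 g" and \<eta>: "\<eta> > 0"
  shows "(\<integral>t. (g t)\<^sup>2 \<partial>\<L>) \<le> (1 + \<eta>) * (\<integral>t. (f t)\<^sup>2 \<partial>\<L>) + (1 + 1 / \<eta>) * (\<integral>t. (f t - g t)\<^sup>2 \<partial>\<L>)"
proof -
  note i = L2_integrable_power2[OF f] L2_integrable_power2[OF g] L2_integrable_power2[OF L2_diff[OF f g]]
  have "(\<integral>t. (g t)\<^sup>2 \<partial>\<L>) \<le> (\<integral>t. (1 + \<eta>) * (f t)\<^sup>2 + (1 + 1 / \<eta>) * (f t - g t)\<^sup>2 \<partial>\<L>)"
  proof (rule integral_mono)
    fix t
    show "(g t)\<^sup>2 \<le> (1 + \<eta>) * (f t)\<^sup>2 + (1 + 1 / \<eta>) * (f t - g t)\<^sup>2"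
      using square_diff_le[OF \<eta>, of "f t" "f t - g t"] by simp
  qed (use i in auto)
  also have "\<dots> = (1 + \<eta>) * (\<integral>t. (f t)\<^sup>2 \<partial>\<L>) + (1 + 1 / \<eta>) * (\<integral>t. (f t - g t)\<^sup>2 \<partial>\<L>)"
    using i by simp
  finally show ?thesis .
qed

section \<open>Existence of minimizers\<close>

definition kinetic :: "(real \<Rightarrow> real) \<Rightarrow> (real \<Rightarrow> real) \<Rightarrow> real" where
  "kinetic g1 g2 = (\<integral>t. (g1 t)\<^sup>2 \<partial>\<L>) + (\<integral>t. (g2 t)\<^sup>2 \<partial>\<L>)"

definition potential :: "(real \<Rightarrow> real \<Rightarrow> real) \<Rightarrow> (real \<Rightarrow> real) \<Rightarrow> (real \<Rightarrow> real) \<Rightarrow> real" where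
  "potential W u1 u2 = (\<integral>t. W (u1 t) (u2 t) \<partial>\<L>)"

text \<open>The arguments are derivatives. With the left end values fixed as \<open>c1\<close> and
  \<open>c2\<close>, the conditions at 1 become linear constraints on integrals, so the admissible
  set is affine.\<close>

definition energy :: "(real \<Rightarrow> real \<Rightarrow> real) \<Rightarrow> real \<Rightarrow> real \<Rightarrow> (real \<Rightarrow> real) \<Rightarrow> (real \<Rightarrow> real) \<Rightarrow> real" where
  "energy W c1 c2 g1 g2 =
     kinetic g1 g2 + potential W (\<lambda>t. c1 + primitive g1 t) (\<lambda>t. c2 + primitive g2 t)"

lemma continuous_on_potential:
  assumes "continuous_on UNIV (case_prod W)" "continuous_on S u1" "continuous_on S u2"
  shows "continuous_on S (\<lambda>t. W (u1 t) (u2 t) :: real)"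
  using continuous_on_compose2[OF assms(1) continuous_on_Pair[OF assms(2,3)]] by simp

lemma integrable_potential:
  fixes W :: "real \<Rightarrow> real \<Rightarrow> real"
  assumes "continuous_on UNIV (case_prod W)" "continuous_on {-1..1} u1" "continuous_on {-1..1} u2"
  shows "integrable \<L> (\<lambda>t. W (u1 t) (u2 t))"
  by (rule L2_integrable[OF L2_continuous[OF continuous_on_potential[OF assms]]])

lemma potential_continuous:
  assumes W: "continuous_on UNIV (case_prod W)"
    and v: "continuous_on {-1..1} v1" "continuous_on {-1..1} v2" and e: "e > 0"
  shows "\<exists>d>0. \<forall>w1 w2. continuous_on {-1..1} w1 \<longrightarrow> continuous_on {-1..1} w2 \<longrightarrow>
    (\<forall>t\<in>{-1..1}. \<bar>w1 t - v1 t\<bar> < d \<and> \<bar>w2 t - v2 t\<bar> < d) \<longrightarrow>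
    \<bar>potential W w1 w2 - potential W v1 v2\<bar> < e"
proof -
  have "bounded (v1 ` {-1..1})" "bounded (v2 ` {-1..1})"
    using v by (auto intro!: compact_imp_bounded compact_continuous_image)
  then obtain R1 R2 where R: "\<And>t. t \<in> {-1..1} \<Longrightarrow> \<bar>v1 t\<bar> \<le> R1" "\<And>t. t \<in> {-1..1} \<Longrightarrow> \<bar>v2 t\<bar> \<le> R2"
    by (fastforce simp: bounded_iff)
  \<comment> \<open>The box exceeds the range of v by one unit; because d <= 1 it also contains the
    values of all functions considered near v.\<close>
  define C where "C = {-R1-1..R1+1} \<times> {-R2-1..R2+1}"
  have "uniformly_continuous_on C (case_prod W)"
    unfolding C_def
    by (intro compact_uniformly_continuous continuous_on_subset[OF W] compact_Times) auto
  then obtain d0 where d0: "d0 > 0" "\<And>p q. p \<in> C \<Longrightarrow> q \<in> C \<Longrightarrow> dist q p < d0 \<Longrightarrow> dist (case_prod W q) (case_prod W p) < e / 4"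
    using e unfolding uniformly_continuous_on_def by (metis zero_less_divide_iff zero_less_numeral)
  define d where "d = min (d0 / 2) 1"
  show ?thesis
  proof (intro exI[of _ d] conjI allI impI)
    show "d > 0" using d0 by (simp add: d_def)
    fix w1 w2 assume w: "continuous_on {-1..1} w1" "continuous_on {-1..1} w2"
      and close: "\<forall>t\<in>{-1..1}. \<bar>w1 t - v1 t\<bar> < d \<and> \<bar>w2 t - v2 t\<bar> < d"
    have near: "\<bar>W (w1 t) (w2 t) - W (v1 t) (v2 t)\<bar> \<le> e / 4" if t: "t \<in> {-1..1}" for t
    proof -
      have c: "\<bar>w1 t - v1 t\<bar> < d" "\<bar>w2 t - v2 t\<bar> < d" using close t by auto
      have "(v1 t, v2 t) \<in> C" using R[OF t] by (auto simp: C_def)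
      moreover have "(w1 t, w2 t) \<in> C"
        using R[OF t] c by (auto simp: C_def d_def)
      moreover have "dist (w1 t, w2 t) (v1 t, v2 t) < d0"
      proof -
        have "dist (w1 t, w2 t) (v1 t, v2 t) \<le> \<bar>w1 t - v1 t\<bar> + \<bar>w2 t - v2 t\<bar>"
          using norm_Pair_le[of "w1 t - v1 t" "w2 t - v2 t"] by (simp add: dist_norm)
        then show ?thesis using c by (auto simp: d_def)
      qed
      ultimately show ?thesis using d0(2)[of "(v1 t, v2 t)" "(w1 t, w2 t)"] by (simp add: dist_real_def)
    qed
    note i = integrable_potential[OF W w] integrable_potential[OF W v]
    have "\<bar>potential W w1 w2 - potential W v1 v2\<bar> = \<bar>\<integral>t. W (w1 t) (w2 t) - W (v1 t) (v2 t) \<partial>\<L>\<bar>"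
      using i by (simp add: potential_def)
    also have "\<dots> \<le> (\<integral>t. \<bar>W (w1 t) (w2 t) - W (v1 t) (v2 t)\<bar> \<partial>\<L>)" by (rule integral_abs_bound)
    also have "\<dots> \<le> (\<integral>t. e / 4 \<partial>\<L>)"
      using i near by (intro integral_mono) auto
    also have "\<dots> < e" using e by (simp add: measure_L)
    finally show "\<bar>potential W w1 w2 - potential W v1 v2\<bar> < e" .
  qed
qed

lemma potential_ge:
  assumes "continuous_on UNIV (case_prod W)" "continuous_on {-1..1} u1" "continuous_on {-1..1} u2"
    and B: "\<And>x y. W x y \<ge> - B"
  shows "potential W u1 u2 \<ge> - (2 * B)"
proof -
  have "(\<integral>t. - B \<partial>\<L>) \<le> potential W u1 u2"
    unfolding potential_def by (intro integral_mono integrable_potential assms) (auto simp: B)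
  then show ?thesis by (simp add: measure_L)
qed

lemma kinetic_nonneg: "kinetic g1 g2 \<ge> 0"
  by (simp add: kinetic_def)

lemma L2_parallelogram:
  assumes f: "L2 f" and g: "L2 g"
  shows "(\<integral>t. (f t - g t)\<^sup>2 \<partial>\<L>) = 2 * (\<integral>t. (f t)\<^sup>2 \<partial>\<L>) + 2 * (\<integral>t. (g t)\<^sup>2 \<partial>\<L>)
    - 4 * (\<integral>t. ((1/2) * (f t + g t))\<^sup>2 \<partial>\<L>)"
proof -
  note i = L2_integrable_power2[OF f] L2_integrable_power2[OF g]
    L2_integrable_power2[OF L2_cmult[OF L2_add[OF f g], of "1/2"]]
  have "(\<integral>t. (f t - g t)\<^sup>2 \<partial>\<L>) = (\<integral>t. 2 * (f t)\<^sup>2 + 2 * (g t)\<^sup>2 - 4 * ((1/2) * (f t + g t))\<^sup>2 \<partial>\<L>)"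
    by (rule Bochner_Integration.integral_cong) (auto simp: power2_eq_square field_simps)
  also have "\<dots> = 2 * (\<integral>t. (f t)\<^sup>2 \<partial>\<L>) + 2 * (\<integral>t. (g t)\<^sup>2 \<partial>\<L>) - 4 * (\<integral>t. ((1/2) * (f t + g t))\<^sup>2 \<partial>\<L>)"
    by (subst Bochner_Integration.integral_diff Bochner_Integration.integral_add
      | (intro Bochner_Integration.integrable_add integrable_mult_right i))+ simp
  finally show ?thesis .
qed

text \<open>No convexity is assumed, since the Landau potential is a double well. The instances are
  the two-component problem, the same with components exchanged, and the scalar problem, where
  \<open>W\<close> depends on its first argument alone.\<close>

locale variational =
  fixes W :: "real \<Rightarrow> real \<Rightarrow> real" and B c1 c2 m1 m2 :: real
  assumes W: "continuous_on UNIV (case_prod W)" and B: "\<And>x y. W x y \<ge> - B"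
begin

definition adm :: "(real \<Rightarrow> real) \<Rightarrow> (real \<Rightarrow> real) \<Rightarrow> bool" where
  "adm g1 g2 \<longleftrightarrow> L2 g1 \<and> L2 g2 \<and> primitive g1 1 = m1 \<and> primitive g2 1 = m2"

lemma continuous_on_u: "L2 g \<Longrightarrow> continuous_on {-1..1} (\<lambda>t. c + primitive g t)"
  by (intro continuous_intros continuous_on_primitive)

definition infimum :: real where
  "infimum = Inf {energy W c1 c2 g1 g2 |g1 g2. adm g1 g2}"

lemma energy_ge: "adm g1 g2 \<Longrightarrow> energy W c1 c2 g1 g2 \<ge> kinetic g1 g2 - 2 * B"
  using potential_ge[OF W continuous_on_u continuous_on_u B, of g1 g2 c1 c2]
  by (simp add: adm_def energy_def)

lemma infimum_le: "adm g1 g2 \<Longrightarrow> infimum \<le> energy W c1 c2 g1 g2"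
  unfolding infimum_def
proof (rule cInf_lower)
  show "bdd_below {energy W c1 c2 g1 g2 |g1 g2. adm g1 g2}"
  proof (rule bdd_belowI[of _ "- (2 * B)"])
    fix x assume "x \<in> {energy W c1 c2 g1 g2 |g1 g2. adm g1 g2}"
    then obtain g1 g2 where "adm g1 g2" "x = energy W c1 c2 g1 g2" by blast
    then show "- (2 * B) \<le> x" using energy_ge[of g1 g2] kinetic_nonneg[of g1 g2] by linarith
  qed
qed blast

lemma minimizing_sequence:
  obtains f1 f2 where "\<And>n. adm (f1 n) (f2 n)"
    "\<And>n. energy W c1 c2 (f1 n) (f2 n) < infimum + 1 / real (Suc n)"
proof -
  have "\<exists>g1 g2. adm g1 g2 \<and> energy W c1 c2 g1 g2 < infimum + 1 / real (Suc n)" for n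
  proof -
    \<comment> \<open>Constant derivatives reach the prescribed increments over length 2, so the
      admissible set is nonempty.\<close>
    have "adm (\<lambda>_. m1 / 2) (\<lambda>_. m2 / 2)" by (simp add: adm_def L2_const primitive_const)
    then have "{energy W c1 c2 g1 g2 |g1 g2. adm g1 g2} \<noteq> {}" by blast
    moreover have "Inf {energy W c1 c2 g1 g2 |g1 g2. adm g1 g2} < infimum + 1 / real (Suc n)"
      by (simp add: infimum_def)
    ultimately have "\<exists>x\<in>{energy W c1 c2 g1 g2 |g1 g2. adm g1 g2}. x < infimum + 1 / real (Suc n)"
      by (rule cInf_lessD)
    then show ?thesis by blast
  qed
  then show ?thesis using that by metis
qed

lemma adm_midpoint:
  assumes f: "adm f1 f2" and g: "adm g1 g2"
  shows "adm (\<lambda>t. (1/2) * (f1 t + g1 t)) (\<lambda>t. (1/2) * (f2 t + g2 t))"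
proof -
  have "primitive (\<lambda>t. (1/2) * (f t + g t)) 1 = m" if "L2 f" "L2 g" "primitive f 1 = m" "primitive g 1 = m" for f g m
    using that by (simp only: primitive_cmult primitive_add[OF L2_integrable L2_integrable]) simp
  then show ?thesis using f g unfolding adm_def by (intro conjI L2_cmult L2_add) auto
qed

text \<open>The parallelogram identity, with the midpoint's energy bounded below by
  \<open>infimum\<close>. Writing kinetic as total minus potential energy makes the totals cancel
  against \<open>infimum\<close> along a minimizing sequence; only differences of potentials
  remain.\<close>

lemma kinetic_diff_le:
  assumes f: "adm f1 f2" and g: "adm g1 g2"
  shows "kinetic (\<lambda>t. f1 t - g1 t) (\<lambda>t. f2 t - g2 t) \<le>
    2 * (energy W c1 c2 f1 f2 - potential W (\<lambda>t. c1 + primitive f1 t) (\<lambda>t. c2 + primitive f2 t))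
    + 2 * (energy W c1 c2 g1 g2 - potential W (\<lambda>t. c1 + primitive g1 t) (\<lambda>t. c2 + primitive g2 t))
    - 4 * (infimum - potential W (\<lambda>t. ((c1 + primitive f1 t) + (c1 + primitive g1 t)) / 2)
        (\<lambda>t. ((c2 + primitive f2 t) + (c2 + primitive g2 t)) / 2))"
proof -
  let ?h1 = "\<lambda>t. (1/2) * (f1 t + g1 t)" and ?h2 = "\<lambda>t. (1/2) * (f2 t + g2 t)"
  have L: "L2 f1" "L2 f2" "L2 g1" "L2 g2" using f g by (auto simp: adm_def)
  have half: "c + primitive (\<lambda>t. (1/2) * (p t + q t)) t = ((c + primitive p t) + (c + primitive q t)) / 2"
    if "L2 p" "L2 q" for p q c t
    using that by (simp only: primitive_cmult primitive_add[OF L2_integrable L2_integrable]) (simp add: field_simps)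
  have "kinetic (\<lambda>t. f1 t - g1 t) (\<lambda>t. f2 t - g2 t) = 2 * kinetic f1 f2 + 2 * kinetic g1 g2 - 4 * kinetic ?h1 ?h2"
    unfolding kinetic_def L2_parallelogram[OF L(1,3)] L2_parallelogram[OF L(2,4)] by simp
  moreover have "infimum \<le> energy W c1 c2 ?h1 ?h2"
    by (rule infimum_le[OF adm_midpoint[OF f g]])
  moreover have "k \<le> 2 * (a + x - x) + 2 * (b + y - y) - 4 * (i - z)"
    if "k = 2 * a + 2 * b - 4 * c" "i \<le> c + z" for a b c i k x y z :: real
    using that by simp
  ultimately show ?thesis
    unfolding energy_def half[OF L(1,3)] half[OF L(2,4)] by blast
qed

theorem minimizer_exists:
  obtains g1 g2 where "adm g1 g2" "\<And>h1 h2. adm h1 h2 \<Longrightarrow> energy W c1 c2 g1 g2 \<le> energy W c1 c2 h1 h2"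
proof -
  obtain f1 f2 where f: "\<And>n. adm (f1 n) (f2 n)"
    "\<And>n. energy W c1 c2 (f1 n) (f2 n) < infimum + 1 / real (Suc n)"
    by (rule minimizing_sequence) blast
  have Lf: "L2 (f1 n)" "L2 (f2 n)" for n using f(1)[of n] by (auto simp: adm_def)
  define K where "K = infimum + 1 + 2 * B"
  have K: "kinetic (f1 n) (f2 n) \<le> K" for n
  proof -
    have "1 / real (Suc n) \<le> 1" by simp
    then show ?thesis using energy_ge[OF f(1), of n] f(2)[of n] unfolding K_def by linarith
  qed
  have K12: "(\<integral>t. (f1 n t)\<^sup>2 \<partial>\<L>) \<le> K" "(\<integral>t. (f2 n t)\<^sup>2 \<partial>\<L>) \<le> K" for n
  proof -
    have "(\<integral>t. (f1 n t)\<^sup>2 \<partial>\<L>) \<ge> 0" "(\<integral>t. (f2 n t)\<^sup>2 \<partial>\<L>) \<ge> 0" by simp_all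
    then show "(\<integral>t. (f1 n t)\<^sup>2 \<partial>\<L>) \<le> K" "(\<integral>t. (f2 n t)\<^sup>2 \<partial>\<L>) \<le> K"
      using K[of n] unfolding kinetic_def by linarith+
  qed
  \<comment> \<open>Young's inequality with weight 1, together with x + 1 <= 2, gives the uniform
    bound for the Arzela-Ascoli theorem.\<close>
  have bd: "\<bar>primitive h x\<bar> \<le> K + 2" if "L2 h" "(\<integral>t. (h t)\<^sup>2 \<partial>\<L>) \<le> K" "x \<in> {-1..1}" for h x
    using primitive_increment_le[OF that(1), of "-1" x 1] that by (simp add: primitive_minus_1)
  define F where "F n x = (c1 + primitive (f1 n) x, c2 + primitive (f2 n) x)" for n x
  obtain v k where v: "continuous_on {-1..1} v" and k: "strict_mono (k :: nat \<Rightarrow> nat)"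
    and unif: "\<And>e. 0 < e \<Longrightarrow> \<exists>N. \<forall>n x. n \<ge> N \<and> x \<in> {-1..1} \<longrightarrow> norm (F (k n) x - v x) < e"
  proof (rule Arzela_Ascoli[of "{-1..1::real}" F "\<bar>c1\<bar> + \<bar>c2\<bar> + 2 * (K + 2)"])
    fix n and x :: real assume x: "x \<in> {-1..1}"
    have "norm (F n x) \<le> \<bar>c1 + primitive (f1 n) x\<bar> + \<bar>c2 + primitive (f2 n) x\<bar>"
      unfolding F_def using norm_Pair_le[of "c1 + primitive (f1 n) x" "c2 + primitive (f2 n) x"] by simp
    then show "norm (F n x) \<le> \<bar>c1\<bar> + \<bar>c2\<bar> + 2 * (K + 2)"
      using bd[OF Lf(1) K12(1) x, of n] bd[OF Lf(2) K12(2) x, of n]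
        abs_triangle_ineq[of c1 "primitive (f1 n) x"] abs_triangle_ineq[of c2 "primitive (f2 n) x"] by argo
  next
    fix x e :: real assume x: "x \<in> {-1..1}" and e: "0 < e"
    obtain d where d: "d > 0" "\<And>g x y. L2 g \<Longrightarrow> (\<integral>t. (g t)\<^sup>2 \<partial>\<L>) \<le> K \<Longrightarrow> x \<in> {-1..1} \<Longrightarrow> y \<in> {-1..1} \<Longrightarrow>
      \<bar>x - y\<bar> < d \<Longrightarrow> \<bar>primitive g x - primitive g y\<bar> < e / 2"
      using primitive_equicontinuous[of "e / 2" K] e by (metis half_gt_zero)
    have "norm (F n x - F n y) < e" if "y \<in> {-1..1}" "norm (x - y) < d" for n y
    proof -
      have "norm (F n x - F n y) \<le> \<bar>primitive (f1 n) x - primitive (f1 n) y\<bar> + \<bar>primitive (f2 n) x - primitive (f2 n) y\<bar>"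
        using norm_Pair_le[of "primitive (f1 n) x - primitive (f1 n) y" "primitive (f2 n) x - primitive (f2 n) y"]
        by (simp add: F_def)
      then show ?thesis
        using d(2)[OF Lf(1) K12(1) x that(1), of n] d(2)[OF Lf(2) K12(2) x that(1), of n] that(2) by simp
    qed
    then show "\<exists>d. 0 < d \<and> (\<forall>n y. y \<in> {-1..1} \<and> norm (x - y) < d \<longrightarrow> norm (F n x - F n y) < e)"
      using d(1) by blast
  qed (auto)
  define v1 v2 where "v1 = (\<lambda>t. fst (v t))" and "v2 = (\<lambda>t. snd (v t))"
  have cv: "continuous_on {-1..1} v1" "continuous_on {-1..1} v2"
    unfolding v1_def v2_def by (intro continuous_intros v)+
  define p1 p2 where "p1 n = f1 (k n)" and "p2 n = f2 (k n)" for n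
  define u1 u2 where "u1 n t = c1 + primitive (p1 n) t" and "u2 n t = c2 + primitive (p2 n) t" for n t
  have Lp: "L2 (p1 n)" "L2 (p2 n)" for n by (auto simp: p1_def p2_def Lf)
  have ap: "adm (p1 n) (p2 n)" for n by (simp add: p1_def p2_def f)
  have cu: "continuous_on {-1..1} (u1 n)" "continuous_on {-1..1} (u2 n)" for n
    unfolding u1_def u2_def by (intro continuous_on_u Lp)+
  have Ep: "energy W c1 c2 (p1 n) (p2 n) < infimum + 1 / real (Suc n)" for n
  proof -
    have "n \<le> k n" by (rule seq_suble[OF k])
    then have "1 / real (Suc (k n)) \<le> 1 / real (Suc n)" by (simp add: frac_le)
    then show ?thesis using f(2)[of "k n"] by (simp add: p1_def p2_def)
  qed
  have unif12: "\<exists>N. \<forall>n\<ge>N. \<forall>t\<in>{-1..1}. \<bar>u1 n t - v1 t\<bar> < e \<and> \<bar>u2 n t - v2 t\<bar> < e" if e: "e > 0" for e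
  proof -
    obtain N where N: "\<And>n x. n \<ge> N \<Longrightarrow> x \<in> {-1..1} \<Longrightarrow> norm (F (k n) x - v x) < e" using unif[OF e] by blast
    have "\<bar>u1 n t - v1 t\<bar> < e \<and> \<bar>u2 n t - v2 t\<bar> < e" if "n \<ge> N" "t \<in> {-1..1}" for n t
    proof -
      have "F (k n) t - v t = (u1 n t - v1 t, u2 n t - v2 t)"
        by (simp add: F_def u1_def u2_def v1_def v2_def p1_def p2_def prod_eq_iff)
      with N[OF that] have "norm (u1 n t - v1 t, u2 n t - v2 t) < e" by simp
      moreover have "norm (u1 n t - v1 t) \<le> norm (u1 n t - v1 t, u2 n t - v2 t)"
        "norm (u2 n t - v2 t) \<le> norm (u1 n t - v1 t, u2 n t - v2 t)"
        using norm_fst_le norm_snd_le by blast+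
      ultimately show ?thesis by simp
    qed
    then show ?thesis by blast
  qed
  define V where "V = potential W v1 v2"
  \<comment> \<open>Midpoints of two late terms are uniformly close to v as well. The diagonal i = j
    gives \<open>Vlim\<close>, general pairs give the Cauchy estimate.\<close>
  have mid: "\<exists>N. \<forall>i\<ge>N. \<forall>j\<ge>N. \<bar>potential W (\<lambda>t. (u1 i t + u1 j t) / 2) (\<lambda>t. (u2 i t + u2 j t) / 2) - V\<bar> < e"
    if e: "e > 0" for e
  proof -
    obtain d where d: "d > 0" "\<And>w1 w2. continuous_on {-1..1} w1 \<Longrightarrow> continuous_on {-1..1} w2 \<Longrightarrow>
      (\<And>t. t \<in> {-1..1} \<Longrightarrow> \<bar>w1 t - v1 t\<bar> < d \<and> \<bar>w2 t - v2 t\<bar> < d) \<Longrightarrow> \<bar>potential W w1 w2 - V\<bar> < e"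
      using potential_continuous[OF W cv e] unfolding V_def by metis
    obtain N where N: "\<And>n t. n \<ge> N \<Longrightarrow> t \<in> {-1..1} \<Longrightarrow> \<bar>u1 n t - v1 t\<bar> < d \<and> \<bar>u2 n t - v2 t\<bar> < d"
      using unif12[OF d(1)] by metis
    have "\<bar>potential W (\<lambda>t. (u1 i t + u1 j t) / 2) (\<lambda>t. (u2 i t + u2 j t) / 2) - V\<bar> < e"
      if ij: "i \<ge> N" "j \<ge> N" for i j
    proof (rule d(2))
      fix t :: real assume t: "t \<in> {-1..1}"
      have "(u1 i t + u1 j t) / 2 - v1 t = (u1 i t - v1 t) / 2 + (u1 j t - v1 t) / 2"
        "(u2 i t + u2 j t) / 2 - v2 t = (u2 i t - v2 t) / 2 + (u2 j t - v2 t) / 2" by (simp_all add: field_simps)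
      then show "\<bar>(u1 i t + u1 j t) / 2 - v1 t\<bar> < d \<and> \<bar>(u2 i t + u2 j t) / 2 - v2 t\<bar> < d"
        using N[OF ij(1) t] N[OF ij(2) t] by argo
    qed (intro continuous_intros cu; simp)+
    then show ?thesis by blast
  qed
  have Vlim: "(\<lambda>n. potential W (u1 n) (u2 n)) \<longlonglongrightarrow> V"
  proof (rule LIMSEQ_I)
    fix e :: real assume "e > 0"
    from mid[OF this] obtain N where "\<forall>i\<ge>N. \<forall>j\<ge>N. \<bar>potential W (\<lambda>t. (u1 i t + u1 j t) / 2) (\<lambda>t. (u2 i t + u2 j t) / 2) - V\<bar> < e"
      by blast
    then have "\<forall>i\<ge>N. \<bar>potential W (\<lambda>t. (u1 i t + u1 i t) / 2) (\<lambda>t. (u2 i t + u2 i t) / 2) - V\<bar> < e" by blast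
    then show "\<exists>N. \<forall>n\<ge>N. norm (potential W (u1 n) (u2 n) - V) < e" by (intro exI[of _ N]) simp
  qed
  have cauchy: "\<exists>N. \<forall>i\<ge>N. \<forall>j\<ge>N. kinetic (\<lambda>t. p1 i t - p1 j t) (\<lambda>t. p2 i t - p2 j t) < e" if e: "e > 0" for e
  proof -
    obtain N where N: "\<And>i j. i \<ge> N \<Longrightarrow> j \<ge> N \<Longrightarrow>
        \<bar>potential W (\<lambda>t. (u1 i t + u1 j t) / 2) (\<lambda>t. (u2 i t + u2 j t) / 2) - V\<bar> < e / 16"
      using mid[of "e / 16"] e by auto
    have N': "\<bar>potential W (u1 i) (u2 i) - V\<bar> < e / 16" if "i \<ge> N" for i
      using N[OF that that] by simp
    obtain N1 where N1: "1 / real (Suc N1) < e / 16" using nat_approx_posE[of "e / 16"] e by auto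
    have inv: "1 / real (Suc i) < e / 16" if "i \<ge> N1" for i
    proof -
      have "1 / real (Suc i) \<le> 1 / real (Suc N1)" using that by (simp add: frac_le)
      then show ?thesis using N1 by linarith
    qed
    have "kinetic (\<lambda>t. p1 i t - p1 j t) (\<lambda>t. p2 i t - p2 j t) < e" if "i \<ge> max N N1" "j \<ge> max N N1" for i j
    proof -
      have ij: "i \<ge> N" "j \<ge> N" "i \<ge> N1" "j \<ge> N1" using that by auto
      have "kinetic (\<lambda>t. p1 i t - p1 j t) (\<lambda>t. p2 i t - p2 j t) \<le>
        2 * (energy W c1 c2 (p1 i) (p2 i) - potential W (u1 i) (u2 i)) +
        2 * (energy W c1 c2 (p1 j) (p2 j) - potential W (u1 j) (u2 j)) -
        4 * (infimum - potential W (\<lambda>t. (u1 i t + u1 j t) / 2) (\<lambda>t. (u2 i t + u2 j t) / 2))"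
        using kinetic_diff_le[OF ap ap, of i j] unfolding u1_def u2_def .
      \<comment> \<open>\<open>infimum\<close> and \<open>V\<close> cancel, and the errors stay
        below 12/16 of e: 2 + 2 parts from the energies, 2 + 2 from the potentials, 4 from the
        midpoint.\<close>
      moreover have "k < e" if "k \<le> 2 * (a - x) + 2 * (b - y) - 4 * (infimum - z)"
        "a < infimum + p" "b < infimum + q" "p < e / 16" "q < e / 16"
        "\<bar>x - V\<bar> < e / 16" "\<bar>y - V\<bar> < e / 16" "\<bar>z - V\<bar> < e / 16" for k a b x y z p q
        using that e by argo
      ultimately show ?thesis
        using Ep[of i] Ep[of j] inv[OF ij(3)] inv[OF ij(4)] N'[OF ij(1)] N'[OF ij(2)] N[OF ij(1,2)] by blast
    qed
    then show ?thesis by blast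
  qed
  have le_kin: "(\<integral>t. (h1 t)\<^sup>2 \<partial>\<L>) \<le> kinetic h1 h2" "(\<integral>t. (h2 t)\<^sup>2 \<partial>\<L>) \<le> kinetic h1 h2" for h1 h2
    by (simp_all add: kinetic_def)
  have cauchy1: "\<exists>N. \<forall>i\<ge>N. \<forall>j\<ge>N. (\<integral>t. (p1 i t - p1 j t)\<^sup>2 \<partial>\<L>) < e"
    and cauchy2: "\<exists>N. \<forall>i\<ge>N. \<forall>j\<ge>N. (\<integral>t. (p2 i t - p2 j t)\<^sup>2 \<partial>\<L>) < e" if e: "e > 0" for e
  proof -
    obtain N where N: "\<And>i j. i \<ge> N \<Longrightarrow> j \<ge> N \<Longrightarrow> kinetic (\<lambda>t. p1 i t - p1 j t) (\<lambda>t. p2 i t - p2 j t) < e"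
      using cauchy[OF e] by blast
    show "\<exists>N. \<forall>i\<ge>N. \<forall>j\<ge>N. (\<integral>t. (p1 i t - p1 j t)\<^sup>2 \<partial>\<L>) < e"
      by (intro exI[of _ N] allI impI) (rule order_le_less_trans[OF le_kin(1) N])
    show "\<exists>N. \<forall>i\<ge>N. \<forall>j\<ge>N. (\<integral>t. (p2 i t - p2 j t)\<^sup>2 \<partial>\<L>) < e"
      by (intro exI[of _ N] allI impI) (rule order_le_less_trans[OF le_kin(2) N])
  qed
  obtain g1 where g1: "L2 g1" "(\<lambda>n. \<integral>t. (p1 n t - g1 t)\<^sup>2 \<partial>\<L>) \<longlonglongrightarrow> 0"
    using L2_complete[of p1, OF Lp(1) cauchy1] by blast
  obtain g2 where g2: "L2 g2" "(\<lambda>n. \<integral>t. (p2 n t - g2 t)\<^sup>2 \<partial>\<L>) \<longlonglongrightarrow> 0"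
    using L2_complete[of p2, OF Lp(2) cauchy2] by blast
  have prim: "(\<lambda>n. primitive (p1 n) t) \<longlonglongrightarrow> primitive g1 t" "(\<lambda>n. primitive (p2 n) t) \<longlonglongrightarrow> primitive g2 t" for t
    using primitive_tendsto[OF Lp(1) g1] primitive_tendsto[OF Lp(2) g2] by auto
  have adm: "adm g1 g2"
  proof -
    have "(\<lambda>n::nat. m1) \<longlonglongrightarrow> primitive g1 1" "(\<lambda>n::nat. m2) \<longlonglongrightarrow> primitive g2 1"
      using prim[of 1] ap by (simp_all add: adm_def)
    then show ?thesis unfolding adm_def by (simp add: g1 g2 LIMSEQ_const_iff)
  qed
  \<comment> \<open>Uniqueness of pointwise limits ties the uniform limit from compactness to the L2
    limit of the derivatives.\<close>
  have eq: "v1 t = c1 + primitive g1 t" "v2 t = c2 + primitive g2 t" if t: "t \<in> {-1..1}" for t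
  proof -
    have "(\<lambda>n. u1 n t) \<longlonglongrightarrow> v1 t" "(\<lambda>n. u2 n t) \<longlonglongrightarrow> v2 t"
      using unif12 t unfolding LIMSEQ_def dist_real_def by meson+
    moreover have "(\<lambda>n. u1 n t) \<longlonglongrightarrow> c1 + primitive g1 t" "(\<lambda>n. u2 n t) \<longlonglongrightarrow> c2 + primitive g2 t"
      unfolding u1_def u2_def by (intro tendsto_intros prim)+
    ultimately show "v1 t = c1 + primitive g1 t" "v2 t = c2 + primitive g2 t"
      using LIMSEQ_unique by blast+
  qed
  have V: "potential W (\<lambda>t. c1 + primitive g1 t) (\<lambda>t. c2 + primitive g2 t) = V"
    unfolding V_def potential_def by (rule Bochner_Integration.integral_cong) (auto simp: eq)
  \<comment> \<open>The sequence index goes to infinity at fixed \<open>\<eta>\<close>; only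
    afterwards does \<open>\<eta>\<close> go to 0 through 1/(n + 1).\<close>
  have kin: "kinetic g1 g2 \<le> (1 + \<eta>) * (infimum - V)" if \<eta>: "\<eta> > 0" for \<eta>
  proof -
    have le: "kinetic g1 g2 \<le> (1 + \<eta>) * (infimum + 1 / real (Suc n) - potential W (u1 n) (u2 n)) +
      (1 + 1 / \<eta>) * ((\<integral>t. (p1 n t - g1 t)\<^sup>2 \<partial>\<L>) + (\<integral>t. (p2 n t - g2 t)\<^sup>2 \<partial>\<L>))" for n
    proof -
      have "kinetic g1 g2 \<le> (1 + \<eta>) * kinetic (p1 n) (p2 n) +
        (1 + 1 / \<eta>) * ((\<integral>t. (p1 n t - g1 t)\<^sup>2 \<partial>\<L>) + (\<integral>t. (p2 n t - g2 t)\<^sup>2 \<partial>\<L>))"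
        using L2_norm_perturbation[OF Lp(1) g1(1) \<eta>, of n] L2_norm_perturbation[OF Lp(2) g2(1) \<eta>, of n]
        unfolding kinetic_def distrib_left by linarith
      also have "(1 + \<eta>) * kinetic (p1 n) (p2 n) \<le> (1 + \<eta>) * (infimum + 1 / real (Suc n) - potential W (u1 n) (u2 n))"
        using Ep[of n] \<eta> unfolding energy_def u1_def u2_def by (intro mult_left_mono) auto
      finally show ?thesis by simp
    qed
    have "(\<lambda>n. (1 + \<eta>) * (infimum + 1 / real (Suc n) - potential W (u1 n) (u2 n)) +
      (1 + 1 / \<eta>) * ((\<integral>t. (p1 n t - g1 t)\<^sup>2 \<partial>\<L>) + (\<integral>t. (p2 n t - g2 t)\<^sup>2 \<partial>\<L>)))
      \<longlonglongrightarrow> (1 + \<eta>) * (infimum + 0 - V) + (1 + 1 / \<eta>) * (0 + 0)"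
      by (intro tendsto_intros Vlim g1 g2 lim_1_over_n[THEN LIMSEQ_Suc])
    from LIMSEQ_le_const[OF this] le show ?thesis by simp
  qed
  have "(\<lambda>n. (1 + 1 / real (Suc n)) * (infimum - V)) \<longlonglongrightarrow> (1 + 0) * (infimum - V)"
    by (intro tendsto_intros lim_1_over_n[THEN LIMSEQ_Suc])
  then have "kinetic g1 g2 \<le> (1 + 0) * (infimum - V)"
    by (rule LIMSEQ_le_const) (auto intro!: kin)
  then have "energy W c1 c2 g1 g2 \<le> infimum" by (simp add: energy_def V)
  then show ?thesis using that[OF adm] infimum_le order_trans by blast
qed

end

section \<open>The Euler-Lagrange equation\<close>

text \<open>The linear term dominates for small s: if A > 0, choosing s with s D <= A gives -2 s A +
  s^2 D <= -s A < 0.\<close>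

lemma nonpos_if_quadratic_perturbation:
  fixes A D \<tau> :: real
  assumes \<tau>: "\<tau> > 0" and le: "\<And>s. 0 < s \<Longrightarrow> s \<le> \<tau> \<Longrightarrow> 0 \<le> - 2 * s * A + s\<^sup>2 * D"
  shows "A \<le> 0"
proof (rule ccontr)
  assume "\<not> A \<le> 0"
  then have A: "A > 0" by simp
  define s where "s = min \<tau> (A / (\<bar>D\<bar> + 1))"
  have s: "0 < s" "s \<le> \<tau>" using \<tau> A by (auto simp: s_def)
  have "s * D \<le> s * (\<bar>D\<bar> + 1)" using s by (intro mult_left_mono) auto
  also have "\<dots> \<le> A"
  proof -
    have "s \<le> A / (\<bar>D\<bar> + 1)" by (simp add: s_def)
    moreover have "\<bar>D\<bar> + 1 > 0" by linarith
    ultimately show ?thesis by (simp add: pos_le_divide_eq)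
  qed
  finally have "s * (s * D) \<le> s * A" using s by (intro mult_left_mono) auto
  moreover have "s * A > 0" using s A by simp
  ultimately show False using le[OF s] by (simp add: power2_eq_square mult.assoc)
qed

context variational
begin

text \<open>Moving from u by -s \<open>\<phi>\<close> changes the energy by at most -2 s A + s^2 D,
  where A turns out to be the integral of \<open>\<psi>\<close> squared. Minimality forces A <= 0,
  so positive s and an upper bound on the potential suffice.\<close>

lemma euler_lagrange_AE:
  assumes min: "adm g1 g2" "\<And>h1 h2. adm h1 h2 \<Longrightarrow> energy W c1 c2 g1 g2 \<le> energy W c1 c2 h1 h2"
    and W1: "continuous_on UNIV (case_prod W1)"
    and rem: "\<And>R. \<exists>C. \<forall>x y h. \<bar>x\<bar> \<le> R \<longrightarrow> \<bar>y\<bar> \<le> R \<longrightarrow> \<bar>h\<bar> \<le> 1 \<longrightarrow>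
      W (x + h) y \<le> W x y + W1 x y * h + C * h\<^sup>2"
  shows "\<exists>d. AE t in \<L>. g1 t = d + primitive (\<lambda>t. W1 (c1 + primitive g1 t) (c2 + primitive g2 t) / 2) t"
proof -
  have L: "L2 g1" "L2 g2" using min(1) by (auto simp: adm_def)
  define u1 u2 where "u1 t = c1 + primitive g1 t" and "u2 t = c2 + primitive g2 t" for t
  have cu: "continuous_on {-1..1} u1" "continuous_on {-1..1} u2"
    unfolding u1_def u2_def by (intro continuous_on_u L)+
  define f where "f t = W1 (u1 t) (u2 t) / 2" for t
  have cf: "continuous_on {-1..1} f"
    unfolding f_def using continuous_on_potential[OF W1 cu] by (intro continuous_intros) auto
  have Lf: "L2 f" by (rule L2_continuous[OF cf])
  define G where "G = primitive f"
  have LG: "L2 G" unfolding G_def by (intro L2_continuous continuous_on_primitive Lf)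
  \<comment> \<open>Half the excess, since the interval has length 2: \<open>\<psi>\<close> then has
    integral zero and the perturbation is admissible.\<close>
  define d where "d = (primitive g1 1 - primitive G 1) / 2"
  define \<psi> where "\<psi> t = g1 t - G t - d" for t
  have L\<psi>: "L2 \<psi>" unfolding \<psi>_def by (intro L2_diff L LG L2_const)
  have \<psi>1: "primitive \<psi> 1 = 0"
    unfolding \<psi>_def using L2_integrable[OF L(1)] L2_integrable[OF LG]
    by (simp add: primitive_diff primitive_const d_def)
  define \<phi> where "\<phi> = primitive \<psi>"
  have c\<phi>: "continuous_on {-1..1} \<phi>" unfolding \<phi>_def by (rule continuous_on_primitive[OF L\<psi>])
  have "bounded (u1 ` {-1..1})" "bounded (u2 ` {-1..1})" "bounded (\<phi> ` {-1..1})"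
    using cu c\<phi> by (auto intro!: compact_imp_bounded compact_continuous_image)
  then obtain R1 R2 R3 where R: "\<And>t. t \<in> {-1..1} \<Longrightarrow> \<bar>u1 t\<bar> \<le> R1" "\<And>t. t \<in> {-1..1} \<Longrightarrow> \<bar>u2 t\<bar> \<le> R2"
    "\<And>t. t \<in> {-1..1} \<Longrightarrow> \<bar>\<phi> t\<bar> \<le> R3"
    by (fastforce simp: bounded_iff)
  obtain C where C: "\<And>x y h. \<bar>x\<bar> \<le> max R1 R2 \<Longrightarrow> \<bar>y\<bar> \<le> max R1 R2 \<Longrightarrow> \<bar>h\<bar> \<le> 1 \<Longrightarrow>
      W (x + h) y \<le> W x y + W1 x y * h + C * h\<^sup>2"
    using rem[of "max R1 R2"] by blast
  define A where "A = (\<integral>t. g1 t * \<psi> t \<partial>\<L>) + (\<integral>t. \<phi> t * f t \<partial>\<L>)"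
  define D where "D = (\<integral>t. (\<psi> t)\<^sup>2 \<partial>\<L>) + C * (\<integral>t. (\<phi> t)\<^sup>2 \<partial>\<L>)"
  have L\<phi>: "L2 \<phi>" by (rule L2_continuous[OF c\<phi>])
  note ints = L2_integrable_power2[OF L(1)] L2_integrable_power2[OF L\<psi>] L2_integrable_power2[OF L\<phi>]
    L2_integrable_mult[OF L(1) L\<psi>] L2_integrable_mult[OF L\<phi> Lf] integrable_potential[OF W cu]
  \<comment> \<open>The restriction on s keeps |s \<phi>| <= 1, the range in which
    \<open>rem\<close> applies.\<close>
  have step: "0 \<le> - 2 * s * A + s\<^sup>2 * D" if s: "0 < s" "s \<le> 1 / (\<bar>R3\<bar> + 1)" for s
  proof -
    define h where "h t = g1 t + (- s) * \<psi> t" for t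
    have Lh: "L2 h" unfolding h_def by (intro L2_add L2_cmult L L\<psi>)
    have ph: "primitive h t = primitive g1 t - s * \<phi> t" for t
      unfolding h_def \<phi>_def
      by (subst primitive_add[OF L2_integrable[OF L(1)] L2_integrable[OF L2_cmult[OF L\<psi>]]], subst primitive_cmult) simp
    have "adm h g2" using min(1) Lh \<psi>1 by (simp add: adm_def ph \<phi>_def)
    from min(2)[OF this] have le: "energy W c1 c2 g1 g2 \<le> energy W c1 c2 h g2" .
    have kin: "(\<integral>t. (h t)\<^sup>2 \<partial>\<L>) = (\<integral>t. (g1 t)\<^sup>2 \<partial>\<L>) - 2 * s * (\<integral>t. g1 t * \<psi> t \<partial>\<L>) + s\<^sup>2 * (\<integral>t. (\<psi> t)\<^sup>2 \<partial>\<L>)"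
    proof -
      have "(\<integral>t. (h t)\<^sup>2 \<partial>\<L>) = (\<integral>t. (g1 t)\<^sup>2 - (2 * s) * (g1 t * \<psi> t) + s\<^sup>2 * (\<psi> t)\<^sup>2 \<partial>\<L>)"
        by (rule Bochner_Integration.integral_cong) (auto simp: h_def power2_eq_square algebra_simps)
      then show ?thesis using ints by simp
    qed
    have ch: "continuous_on {-1..1} (\<lambda>t. u1 t - s * \<phi> t)" by (intro continuous_intros cu c\<phi>)
    have "potential W (\<lambda>t. c1 + primitive h t) u2 = (\<integral>t. W (u1 t - s * \<phi> t) (u2 t) \<partial>\<L>)"
      by (simp add: potential_def ph u1_def algebra_simps)
    also have "\<dots> \<le> (\<integral>t. W (u1 t) (u2 t) - (2 * s) * (\<phi> t * f t) + (C * s\<^sup>2) * (\<phi> t)\<^sup>2 \<partial>\<L>)"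
    proof (rule integral_mono)
      show "integrable \<L> (\<lambda>t. W (u1 t - s * \<phi> t) (u2 t))" by (rule integrable_potential[OF W ch cu(2)])
      show "integrable \<L> (\<lambda>t. W (u1 t) (u2 t) - (2 * s) * (\<phi> t * f t) + (C * s\<^sup>2) * (\<phi> t)\<^sup>2)"
        using ints by simp
      fix t assume "t \<in> space \<L>"
      then have t: "t \<in> {-1..1}" by simp
      have "\<bar>- (s * \<phi> t)\<bar> \<le> 1"
      proof -
        have "\<bar>\<phi> t\<bar> \<le> \<bar>R3\<bar> + 1" using R(3)[OF t] by linarith
        then have "s * \<bar>\<phi> t\<bar> \<le> (1 / (\<bar>R3\<bar> + 1)) * (\<bar>R3\<bar> + 1)" using s by (intro mult_mono) auto
        moreover have "\<bar>R3\<bar> + 1 \<noteq> 0" by linarith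
        ultimately show ?thesis using s by (simp add: abs_mult)
      qed
      with C[of "u1 t" "u2 t" "- (s * \<phi> t)"] R(1)[OF t] R(2)[OF t]
      have "W (u1 t + - (s * \<phi> t)) (u2 t) \<le> W (u1 t) (u2 t) + W1 (u1 t) (u2 t) * (- (s * \<phi> t)) + C * (- (s * \<phi> t))\<^sup>2"
        by auto
      then show "W (u1 t - s * \<phi> t) (u2 t) \<le> W (u1 t) (u2 t) - (2 * s) * (\<phi> t * f t) + (C * s\<^sup>2) * (\<phi> t)\<^sup>2"
        by (simp add: f_def power_mult_distrib mult_ac)
    qed
    also have "\<dots> = potential W u1 u2 - 2 * s * (\<integral>t. \<phi> t * f t \<partial>\<L>) + (C * s\<^sup>2) * (\<integral>t. (\<phi> t)\<^sup>2 \<partial>\<L>)"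
      using ints by (simp add: potential_def)
    finally have pot: "potential W (\<lambda>t. c1 + primitive h t) u2 \<le> \<dots>" .
    have uu: "(\<lambda>t. c1 + primitive g1 t) = u1" "(\<lambda>t. c2 + primitive g2 t) = u2"
      by (auto simp: u1_def u2_def)
    show ?thesis
      using le kin pot unfolding energy_def kinetic_def uu A_def D_def
      by (simp add: algebra_simps)
  qed
  have "A \<le> 0" by (rule nonpos_if_quadratic_perturbation[OF _ step]) (auto simp: add_nonneg_pos)
  \<comment> \<open>Integration by parts replaces the integral of \<phi> f by minus that of \<psi>
    G. Since g1 - G = \<psi> + d and \<open>\<psi>\<close> has integral zero, only the square
    remains.\<close>
  moreover have "A = (\<integral>t. (\<psi> t)\<^sup>2 \<partial>\<L>)"
  proof -
    have "(\<integral>t. \<phi> t * f t \<partial>\<L>) = (\<integral>t. \<psi> t * (G 1 - G t) \<partial>\<L>)"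
      unfolding \<phi>_def G_def by (rule integration_by_parts[OF L2_integrable[OF Lf] L2_integrable[OF L\<psi>]])
    also have "\<dots> = (\<integral>t. G 1 * \<psi> t - \<psi> t * G t \<partial>\<L>)" by (simp add: algebra_simps)
    also have "\<dots> = - (\<integral>t. \<psi> t * G t \<partial>\<L>)"
      using L2_integrable[OF L\<psi>] L2_integrable_mult[OF L\<psi> LG] \<psi>1 by (simp add: primitive_1)
    finally have "A = (\<integral>t. g1 t * \<psi> t - \<psi> t * G t \<partial>\<L>)"
      using L2_integrable_mult[OF L\<psi> LG] ints by (simp add: A_def)
    also have "\<dots> = (\<integral>t. (\<psi> t)\<^sup>2 + d * \<psi> t \<partial>\<L>)"
      by (rule Bochner_Integration.integral_cong) (auto simp: \<psi>_def power2_eq_square algebra_simps)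
    also have "\<dots> = (\<integral>t. (\<psi> t)\<^sup>2 \<partial>\<L>)"
      using L2_integrable[OF L\<psi>] ints \<psi>1 by (simp add: primitive_1)
    finally show ?thesis .
  qed
  ultimately have "(\<integral>t. (\<psi> t)\<^sup>2 \<partial>\<L>) = 0" by (simp add: order_antisym)
  then have "AE t in \<L>. (\<psi> t)\<^sup>2 = 0"
    using integral_nonneg_eq_0_iff_AE[OF ints(2)] by simp
  then have "AE t in \<L>. g1 t = d + primitive f t"
    by (rule eventually_mono) (simp add: \<psi>_def G_def)
  then show ?thesis unfolding f_def [abs_def] u1_def u2_def by blast
qed

text \<open>Primitives do not see null sets, so equality almost everywhere of the derivative with a
  continuously differentiable function already makes u twice differentiable, with one-sided
  derivatives at the end points.\<close>

lemma euler_lagrange: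
  assumes "adm g1 g2" "\<And>h1 h2. adm h1 h2 \<Longrightarrow> energy W c1 c2 g1 g2 \<le> energy W c1 c2 h1 h2"
    and W1: "continuous_on UNIV (case_prod W1)"
    and "\<And>R. \<exists>C. \<forall>x y h. \<bar>x\<bar> \<le> R \<longrightarrow> \<bar>y\<bar> \<le> R \<longrightarrow> \<bar>h\<bar> \<le> 1 \<longrightarrow>
      W (x + h) y \<le> W x y + W1 x y * h + C * h\<^sup>2"
  shows "has_second_derivative (\<lambda>t. c1 + primitive g1 t)
    (\<lambda>t. W1 (c1 + primitive g1 t) (c2 + primitive g2 t) / 2)"
proof -
  define f where "f = (\<lambda>t. W1 (c1 + primitive g1 t) (c2 + primitive g2 t) / 2)"
  have L: "L2 g1" "L2 g2" using assms(1) by (auto simp: adm_def)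
  have cf: "continuous_on {-1..1} f"
    unfolding f_def using continuous_on_potential[OF W1 continuous_on_u continuous_on_u, OF L]
    by (intro continuous_intros) auto
  obtain d where d: "AE t in \<L>. g1 t = d + primitive f t"
    using euler_lagrange_AE[OF assms] unfolding f_def by blast
  have cG: "continuous_on {-1..1} (\<lambda>t. d + primitive f t)"
    by (intro continuous_on_u L2_continuous cf)
  have eq: "primitive g1 t = primitive (\<lambda>t. d + primitive f t) t" for t
    using d by (rule primitive_cong_AE) (intro L2_measurable L L2_continuous cG)+
  have "has_second_derivative (\<lambda>t. c1 + primitive g1 t) f"
    unfolding has_second_derivative_def
  proof (rule exI[of _ "\<lambda>t. d + primitive f t"], intro ballI conjI)
    fix y :: real assume y: "y \<in> {-1..1}"
    show "((\<lambda>t. c1 + primitive g1 t) has_real_derivative d + primitive f y) (at y within {-1..1})"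
      unfolding eq using primitive_has_derivative[OF cG y] by (auto intro!: derivative_eq_intros)
    show "((\<lambda>t. d + primitive f t) has_real_derivative f y) (at y within {-1..1})"
      using primitive_has_derivative[OF cf y] by (auto intro!: derivative_eq_intros)
  qed
  then show ?thesis unfolding f_def .
qed

end

section \<open>The Landau energy as an instance of the variational problem\<close>

definition landau_potential :: "real \<Rightarrow> real \<Rightarrow> real \<Rightarrow> real" where
  "landau_potential \<epsilon> x y = \<epsilon> * (x\<^sup>2 + y\<^sup>2) * (2 * (x\<^sup>2 + y\<^sup>2) - 1)"

lemma landau_potential_ge: "\<epsilon> \<ge> 0 \<Longrightarrow> landau_potential \<epsilon> x y \<ge> - (\<epsilon> / 8)"
proof -
  assume \<epsilon>: "\<epsilon> \<ge> 0"
  define r where "r = x\<^sup>2 + y\<^sup>2"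
  have "r * (2 * r - 1) = 2 * (r - 1/4)\<^sup>2 - 1/8" by (simp add: power2_eq_square algebra_simps)
  then have "r * (2 * r - 1) \<ge> - (1/8)" by simp
  from mult_left_mono[OF this \<epsilon>] show ?thesis by (simp add: landau_potential_def r_def mult.assoc)
qed

lemma landau_potential_continuous:
  "continuous_on UNIV (case_prod (landau_potential \<epsilon>))"
  "continuous_on UNIV (\<lambda>(x, y). 2 * \<epsilon> * x * (4 * (x\<^sup>2 + y\<^sup>2) - 1))"
  unfolding landau_potential_def case_prod_beta by (intro continuous_intros)+

lemma landau_potential_remainder:
  assumes \<epsilon>: "\<epsilon> \<ge> 0"
  shows "\<exists>C. \<forall>x y h. \<bar>x\<bar> \<le> R \<longrightarrow> \<bar>y\<bar> \<le> R \<longrightarrow> \<bar>h\<bar> \<le> 1 \<longrightarrow>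
      landau_potential \<epsilon> (x + h) y \<le> landau_potential \<epsilon> x y + (2 * \<epsilon> * x * (4 * (x\<^sup>2 + y\<^sup>2) - 1)) * h + C * h\<^sup>2"
proof (intro exI allI impI)
  fix x y h :: real assume x: "\<bar>x\<bar> \<le> R" and y: "\<bar>y\<bar> \<le> R" and h: "\<bar>h\<bar> \<le> 1"
  define r where "r = x\<^sup>2 + y\<^sup>2"
  \<comment> \<open>The potential is quadratic in r, which grows by \<delta> = 2 x h + h^2. The
    change is exactly \<epsilon> ((4 r - 1) \<delta> + 2 \<delta>^2), from which the part linear in
    h is split off.\<close>
  have eq: "landau_potential \<epsilon> (x + h) y = landau_potential \<epsilon> x y + (2 * \<epsilon> * x * (4 * r - 1)) * h
    + \<epsilon> * ((4 * r - 1) + 2 * (2 * x + h)\<^sup>2) * h\<^sup>2"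
    by (simp add: landau_potential_def r_def power2_eq_square algebra_simps)
  have "x\<^sup>2 \<le> R\<^sup>2" "y\<^sup>2 \<le> R\<^sup>2" using x y by (simp_all add: abs_le_square_iff[symmetric])
  then have "4 * r - 1 \<le> 8 * R\<^sup>2" by (simp add: r_def)
  moreover have "(2 * x + h)\<^sup>2 \<le> (2 * R + 1)\<^sup>2"
    using x h by (intro iffD1[OF abs_le_square_iff]) linarith
  ultimately have "(4 * r - 1) + 2 * (2 * x + h)\<^sup>2 \<le> 8 * R\<^sup>2 + 2 * (2 * R + 1)\<^sup>2" by linarith
  then have "\<epsilon> * ((4 * r - 1) + 2 * (2 * x + h)\<^sup>2) * h\<^sup>2 \<le> \<epsilon> * (8 * R\<^sup>2 + 2 * (2 * R + 1)\<^sup>2) * h\<^sup>2"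
    using \<epsilon> by (intro mult_right_mono mult_left_mono) auto
  then show "landau_potential \<epsilon> (x + h) y \<le> landau_potential \<epsilon> x y + (2 * \<epsilon> * x * (4 * (x\<^sup>2 + y\<^sup>2) - 1)) * h
    + (\<epsilon> * (8 * R\<^sup>2 + 2 * (2 * R + 1)\<^sup>2)) * h\<^sup>2"
    unfolding eq by (simp add: r_def)
qed

text \<open>The Euler-Lagrange equation is available for the first component only. By symmetry of
  the potential the exchanged pair minimizes the exchanged problem, which gives the second
  equation.\<close>

lemma landau_minimizer:
  assumes \<epsilon>: "\<epsilon> \<ge> 0"
  obtains g1 g2 where "L2 g1" "L2 g2" "primitive g1 1 = m1" "primitive g2 1 = m2"
    "\<And>h1 h2. L2 h1 \<Longrightarrow> L2 h2 \<Longrightarrow> primitive h1 1 = m1 \<Longrightarrow> primitive h2 1 = m2 \<Longrightarrow>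
      energy (landau_potential \<epsilon>) c1 c2 g1 g2 \<le> energy (landau_potential \<epsilon>) c1 c2 h1 h2"
    "solves_system \<epsilon> (\<lambda>t. c1 + primitive g1 t) (\<lambda>t. c2 + primitive g2 t)"
proof -
  let ?W = "landau_potential \<epsilon>"
  have sym: "?W x y = ?W y x" for x y by (simp add: landau_potential_def add.commute)
  interpret A: variational ?W "\<epsilon> / 8" c1 c2 m1 m2
    by standard (use \<epsilon> landau_potential_continuous landau_potential_ge in auto)
  interpret S: variational ?W "\<epsilon> / 8" c2 c1 m2 m1
    by standard (use \<epsilon> landau_potential_continuous landau_potential_ge in auto)
  obtain g1 g2 where g: "A.adm g1 g2" "\<And>h1 h2. A.adm h1 h2 \<Longrightarrow> energy ?W c1 c2 g1 g2 \<le> energy ?W c1 c2 h1 h2"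
    by (rule A.minimizer_exists) blast
  have swap: "energy ?W c2 c1 h2 h1 = energy ?W c1 c2 h1 h2" for h1 h2
    by (simp add: energy_def kinetic_def potential_def sym[of "c2 + _"] add.commute)
  have gS: "S.adm g2 g1" "\<And>h2 h1. S.adm h2 h1 \<Longrightarrow> energy ?W c2 c1 g2 g1 \<le> energy ?W c2 c1 h2 h1"
    using g by (auto simp: A.adm_def S.adm_def swap)
  have "solves_system \<epsilon> (\<lambda>t. c1 + primitive g1 t) (\<lambda>t. c2 + primitive g2 t)"
    using A.euler_lagrange[OF g landau_potential_continuous(2) landau_potential_remainder[OF \<epsilon>]]
      S.euler_lagrange[OF gS landau_potential_continuous(2) landau_potential_remainder[OF \<epsilon>]]
    by (simp add: solves_system_def add.commute mult.assoc)
  then show ?thesis using that[of g1 g2] g by (simp add: A.adm_def)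
qed

text \<open>The energy is minimized on a line through 0: the potential sees the first component, and
  the second has zero boundary data. The resulting equation is the system restricted to such a
  line.\<close>

lemma scalar_solution_exists:
  assumes \<epsilon>: "\<epsilon> \<ge> 0"
  obtains u where "u \<in> W12" "u (-1) = a" "u 1 = b"
    "has_second_derivative u (\<lambda>t. \<epsilon> * u t * (4 * (u t)\<^sup>2 - 1))"
proof -
  let ?W = "\<lambda>x y :: real. landau_potential \<epsilon> x 0"
  interpret variational ?W "\<epsilon> / 8" a 0 "b - a" 0
  proof
    show "continuous_on UNIV (\<lambda>(x, y). ?W x y)"
      unfolding landau_potential_def case_prod_beta by (intro continuous_intros)
  qed (use \<epsilon> landau_potential_ge in auto)
  obtain g1 g2 where g: "adm g1 g2" "\<And>h1 h2. adm h1 h2 \<Longrightarrow> energy ?W a 0 g1 g2 \<le> energy ?W a 0 h1 h2"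
    by (rule minimizer_exists) blast
  have c: "continuous_on UNIV (\<lambda>(x, y :: real). 2 * \<epsilon> * x * (4 * x\<^sup>2 - 1))"
    unfolding case_prod_beta by (intro continuous_intros)
  have "\<exists>C. \<forall>x y h. \<bar>x\<bar> \<le> R \<longrightarrow> \<bar>y\<bar> \<le> R \<longrightarrow> \<bar>h\<bar> \<le> 1 \<longrightarrow>
      ?W (x + h) y \<le> ?W x y + (2 * \<epsilon> * x * (4 * x\<^sup>2 - 1)) * h + C * h\<^sup>2" for R
  proof -
    obtain C where C: "\<And>x y h. \<bar>x\<bar> \<le> R \<Longrightarrow> \<bar>y\<bar> \<le> R \<Longrightarrow> \<bar>h\<bar> \<le> 1 \<Longrightarrow>
      landau_potential \<epsilon> (x + h) y \<le> landau_potential \<epsilon> x y + (2 * \<epsilon> * x * (4 * (x\<^sup>2 + y\<^sup>2) - 1)) * h + C * h\<^sup>2"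
      using landau_potential_remainder[OF \<epsilon>, of R] by blast
    have "?W (x + h) y \<le> ?W x y + (2 * \<epsilon> * x * (4 * x\<^sup>2 - 1)) * h + C * h\<^sup>2"
      if "\<bar>x\<bar> \<le> R" "\<bar>h\<bar> \<le> 1" for x y h :: real
      using C[of x 0 h] that by auto
    then show ?thesis by blast
  qed
  from euler_lagrange[OF g c this]
  have "has_second_derivative (\<lambda>t. a + primitive g1 t) (\<lambda>t. \<epsilon> * (a + primitive g1 t) * (4 * (a + primitive g1 t)\<^sup>2 - 1))"
    by (simp add: mult.assoc)
  moreover have "(\<lambda>t. a + primitive g1 t) \<in> W12"
    using g(1) by (intro W12_primitive[of g1 _ a]) (auto simp: adm_def)
  ultimately show ?thesis
    using that[of "\<lambda>t. a + primitive g1 t"] g(1) by (simp add: adm_def primitive_minus_1)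
qed

lemma F_LG_eq_energy:
  assumes g: "L2 g1" "L2 g2"
    and u: "\<And>y. y \<in> {-1..1} \<Longrightarrow> u1 y = c1 + primitive g1 y" "\<And>y. y \<in> {-1..1} \<Longrightarrow> u2 y = c2 + primitive g2 y"
  shows "F_LG \<epsilon> u1 u2 = energy (landau_potential \<epsilon>) c1 c2 g1 g2"
proof -
  have W12: "u1 \<in> W12" "u2 \<in> W12" using W12_primitive[OF g(1) u(1)] W12_primitive[OF g(2) u(2)] by auto
  have Lw: "L2 (weak_deriv u1)" "L2 (weak_deriv u2)" using W12 weak_deriv_props by auto
  have AE: "AE t in \<L>. weak_deriv u1 t = g1 t" "AE t in \<L>. weak_deriv u2 t = g2 t"
    using weak_deriv_primitive_AE[OF g(1) u(1)] weak_deriv_primitive_AE[OF g(2) u(2)] by auto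
  have sq: "(\<integral>t. (a t)\<^sup>2 \<partial>\<L>) = (\<integral>t. (b t)\<^sup>2 \<partial>\<L>)"
    if "AE t in \<L>. a t = b t" "L2 a" "L2 b" for a b
    by (rule integral_cong_AE) (use that in \<open>auto dest!: L2_measurable elim!: eventually_mono\<close>)
  have cu: "continuous_on {-1..1} u1" "continuous_on {-1..1} u2" using W12 by (auto simp: W12_def)
  have "F_LG \<epsilon> u1 u2 = (\<integral>t. (weak_deriv u1 t)\<^sup>2 + (weak_deriv u2 t)\<^sup>2 + landau_potential \<epsilon> (u1 t) (u2 t) \<partial>\<L>)"
    by (simp add: F_LG_def set_integral_eq_L landau_potential_def)
  also have "\<dots> = kinetic g1 g2 + potential (landau_potential \<epsilon>) u1 u2"
    using L2_integrable_power2[OF Lw(1)] L2_integrable_power2[OF Lw(2)] integrable_potential[OF landau_potential_continuous(1) cu]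
    by (simp add: sq[OF AE(1) Lw(1) g(1)] sq[OF AE(2) Lw(2) g(2)] kinetic_def potential_def)
  also have "potential (landau_potential \<epsilon>) u1 u2 = potential (landau_potential \<epsilon>) (\<lambda>t. c1 + primitive g1 t) (\<lambda>t. c2 + primitive g2 t)"
    unfolding potential_def by (rule Bochner_Integration.integral_cong) (auto simp: u)
  finally show ?thesis by (simp add: energy_def)
qed

lemma minimizer_and_solution_exist:
  assumes \<epsilon>: "\<epsilon> \<ge> 0"
  obtains Q11 Q12 where "is_minimizer \<epsilon> \<omega> Q11 Q12" "solves_system \<epsilon> Q11 Q12"
proof -
  define c s where "c = cos (2 * \<omega> * pi) / 2" and "s = sin (2 * \<omega> * pi) / 2"
  obtain g1 g2 where g: "L2 g1" "L2 g2" "primitive g1 1 = 0" "primitive g2 1 = 2 * s"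
    and min: "\<And>h1 h2. L2 h1 \<Longrightarrow> L2 h2 \<Longrightarrow> primitive h1 1 = 0 \<Longrightarrow> primitive h2 1 = 2 * s \<Longrightarrow>
      energy (landau_potential \<epsilon>) c (- s) g1 g2 \<le> energy (landau_potential \<epsilon>) c (- s) h1 h2"
    and sol: "solves_system \<epsilon> (\<lambda>t. c + primitive g1 t) (\<lambda>t. - s + primitive g2 t)"
    by (rule landau_minimizer[OF \<epsilon>, of 0 "2 * s" c "- s"]) blast
  let ?Q1 = "\<lambda>t. c + primitive g1 t" and ?Q2 = "\<lambda>t. - s + primitive g2 t"
  have "(?Q1, ?Q2) \<in> admissible \<omega>"
    using W12_primitive[OF g(1), of ?Q1 c] W12_primitive[OF g(2), of ?Q2 "- s"] g(3,4)
    by (simp add: admissible_def primitive_minus_1) (simp add: c_def s_def)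
  moreover have "F_LG \<epsilon> ?Q1 ?Q2 \<le> F_LG \<epsilon> R1 R2" if R: "(R1, R2) \<in> admissible \<omega>" for R1 R2
  proof -
    have W: "R1 \<in> W12" "R2 \<in> W12" and bc: "R1 (-1) = c" "R1 1 = c" "R2 (-1) = - s" "R2 1 = s"
      using R by (auto simp: admissible_def c_def s_def)
    note p1 = weak_deriv_props[OF W(1), unfolded bc] and p2 = weak_deriv_props[OF W(2), unfolded bc]
    have "primitive (weak_deriv R1) 1 = 0" "primitive (weak_deriv R2) 1 = 2 * s"
      using p1(2)[of 1] p2(2)[of 1] bc by auto
    moreover have "F_LG \<epsilon> R1 R2 = energy (landau_potential \<epsilon>) c (- s) (weak_deriv R1) (weak_deriv R2)"
      by (rule F_LG_eq_energy[OF p1(1) p2(1)]) (rule p1(2) p2(2), assumption)+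
    ultimately show ?thesis
      using min[OF p1(1) p2(1)] F_LG_eq_energy[OF g(1,2), of ?Q1 c ?Q2 "- s" \<epsilon>] by simp
  qed
  ultimately have "is_minimizer \<epsilon> \<omega> ?Q1 ?Q2" by (simp add: is_minimizer_def)
  then show ?thesis using sol by (rule that)
qed

section \<open>Uniqueness for the initial value problem\<close>

lemma DERIV_within_nonneg_imp_le:
  fixes f :: "real \<Rightarrow> real"
  assumes "a \<le> b" and f: "\<And>y. y \<in> {a..b} \<Longrightarrow> (f has_real_derivative f' y) (at y within {a..b})"
    and nonneg: "\<And>y. y \<in> {a..b} \<Longrightarrow> f' y \<ge> 0"
  shows "f a \<le> f b"
using assms(1)
proof (rule DERIV_nonneg_imp_increasing_open)
  fix y assume y: "a < y" "y < b"
  then have "(f has_real_derivative f' y) (at y)"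
    using f[of y] by (simp add: at_within_Icc_at)
  then show "\<exists>D. (f has_real_derivative D) (at y) \<and> D \<ge> 0"
    using nonneg[of y] y by auto
next
  show "continuous_on {a..b} f" using f by (rule DERIV_continuous_on)
qed

text \<open>To the right of \<open>x0\<close> the function E exp(-C y) is nonincreasing, to the left
  E exp(C y) is nondecreasing, and both vanish at \<open>x0\<close>. In the proof \<open>s\<close>
  is the sign in the exponent and \<open>\<sigma>\<close> turns a decrease into an increase.\<close>

lemma gronwall_zero:
  fixes E :: "real \<Rightarrow> real"
  assumes T: "x0 \<in> {a..b}" and E0: "E x0 = 0" and nonneg: "\<And>y. E y \<ge> 0"
    and deriv: "\<And>y. y \<in> {a..b} \<Longrightarrow> (E has_real_derivative E' y) (at y within {a..b})"
    and bound: "\<And>y. y \<in> {a..b} \<Longrightarrow> \<bar>E' y\<bar> \<le> C * E y"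
    and y: "y \<in> {a..b}"
  shows "E y = 0"
proof -
  have D: "((\<lambda>y. \<sigma> * (E y * exp (s * C * y))) has_real_derivative \<sigma> * ((E' y + s * C * E y) * exp (s * C * y))) (at y within {l..r})"
    if "y \<in> {l..r}" "l \<in> {a..b}" "r \<in> {a..b}" for y l r s \<sigma>
  proof (rule DERIV_subset)
    show "((\<lambda>y. \<sigma> * (E y * exp (s * C * y))) has_real_derivative \<sigma> * ((E' y + s * C * E y) * exp (s * C * y))) (at y within {a..b})"
      using deriv[of y] that by (auto intro!: derivative_eq_intros simp: algebra_simps)
  qed (use that in auto)
  have "\<exists>s. E y * exp (s * C * y) \<le> 0"
  proof (cases "x0 \<le> y")
    case True
    have "(-1) * (E x0 * exp ((-1) * C * x0)) \<le> (-1) * (E y * exp ((-1) * C * y))"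
    proof (rule DERIV_within_nonneg_imp_le[OF True D])
      fix x assume "x \<in> {x0..y}"
      then have "E' x + (-1) * C * E x \<le> 0" using bound[of x] T y by auto
      then show "0 \<le> (-1) * ((E' x + (-1) * C * E x) * exp ((-1) * C * x))"
        by (simp add: mult_nonpos_nonneg)
    qed (use T y in auto)
    then show ?thesis using E0 by (intro exI[of _ "-1"]) simp
  next
    case False
    then have le: "y \<le> x0" by simp
    have "1 * (E y * exp (1 * C * y)) \<le> 1 * (E x0 * exp (1 * C * x0))"
    proof (rule DERIV_within_nonneg_imp_le[OF le D])
      fix x assume "x \<in> {y..x0}"
      then have "\<bar>E' x\<bar> \<le> C * E x" using bound[of x] T y by auto
      then have "E' x + 1 * C * E x \<ge> 0" by simp
      then show "0 \<le> 1 * ((E' x + 1 * C * E x) * exp (1 * C * x))"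
        by simp
    qed (use T y in auto)
    then show ?thesis using E0 by (intro exI[of _ 1]) simp
  qed
  then show ?thesis using nonneg[of y] by (auto simp: mult_le_0_iff order_antisym)
qed

text \<open>The sum of the squares of the functions and of their first derivatives satisfies a linear
  differential inequality.\<close>

lemma second_order_zero:
  fixes f g :: "real \<Rightarrow> real"
  assumes T: "x0 \<in> {a..b}" and init: "f x0 = 0" "f' x0 = 0" "g x0 = 0" "g' x0 = 0"
    and f: "\<And>y. y \<in> {a..b} \<Longrightarrow> (f has_real_derivative f' y) (at y within {a..b})"
      "\<And>y. y \<in> {a..b} \<Longrightarrow> (f' has_real_derivative f'' y) (at y within {a..b})"
    and g: "\<And>y. y \<in> {a..b} \<Longrightarrow> (g has_real_derivative g' y) (at y within {a..b})"
      "\<And>y. y \<in> {a..b} \<Longrightarrow> (g' has_real_derivative g'' y) (at y within {a..b})"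
    and bound: "\<And>y. y \<in> {a..b} \<Longrightarrow> \<bar>f'' y\<bar> \<le> K * (\<bar>f y\<bar> + \<bar>g y\<bar>)"
      "\<And>y. y \<in> {a..b} \<Longrightarrow> \<bar>g'' y\<bar> \<le> K * (\<bar>f y\<bar> + \<bar>g y\<bar>)"
    and y: "y \<in> {a..b}"
  shows "f y = 0 \<and> g y = 0"
proof -
  define E where "E y = (f y)\<^sup>2 + (f' y)\<^sup>2 + (g y)\<^sup>2 + (g' y)\<^sup>2" for y
  define E' where "E' y = 2 * f y * f' y + 2 * f' y * f'' y + 2 * g y * g' y + 2 * g' y * g'' y" for y
  have "E y = 0"
  proof (rule gronwall_zero[OF T _ _ _ _ y])
    show "E x0 = 0" by (simp add: E_def init)
    show "E y \<ge> 0" for y by (simp add: E_def)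
  next
    fix y assume y: "y \<in> {a..b}"
    show "(E has_real_derivative E' y) (at y within {a..b})"
      unfolding E_def [abs_def] E'_def using f[OF y] g[OF y]
      by (auto intro!: derivative_eq_intros simp: power2_eq_square)
    have two: "\<bar>2 * p * q\<bar> \<le> p\<^sup>2 + q\<^sup>2" for p q :: real
      using sum_squares_bound[of "\<bar>p\<bar>" "\<bar>q\<bar>"] by (simp add: abs_mult)
    have sq: "r\<^sup>2 \<le> 2 * K\<^sup>2 * ((f y)\<^sup>2 + (g y)\<^sup>2)" if "\<bar>r\<bar> \<le> K * (\<bar>f y\<bar> + \<bar>g y\<bar>)" for r
    proof -
      have "r\<^sup>2 \<le> (K * (\<bar>f y\<bar> + \<bar>g y\<bar>))\<^sup>2" using that by (simp add: abs_le_square_iff[symmetric])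
      also have "\<dots> = K\<^sup>2 * (\<bar>f y\<bar> + \<bar>g y\<bar>)\<^sup>2" by (simp add: power_mult_distrib)
      also have "\<dots> \<le> K\<^sup>2 * (2 * ((f y)\<^sup>2 + (g y)\<^sup>2))"
        using sum_squares_bound[of "\<bar>f y\<bar>" "\<bar>g y\<bar>"] by (intro mult_left_mono) (auto simp: power2_sum)
      finally show ?thesis by (simp only: mult_ac)
    qed
    have "\<bar>E' y\<bar> \<le> \<bar>2 * f y * f' y\<bar> + \<bar>2 * f' y * f'' y\<bar> + \<bar>2 * g y * g' y\<bar> + \<bar>2 * g' y * g'' y\<bar>"
      unfolding E'_def by linarith
    also have "\<dots> \<le> (f y)\<^sup>2 + 2 * (f' y)\<^sup>2 + (g y)\<^sup>2 + 2 * (g' y)\<^sup>2 + ((f'' y)\<^sup>2 + (g'' y)\<^sup>2)"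
      using two[of "f y" "f' y"] two[of "f' y" "f'' y"] two[of "g y" "g' y"] two[of "g' y" "g'' y"] by linarith
    also have "(f'' y)\<^sup>2 + (g'' y)\<^sup>2 \<le> 4 * K\<^sup>2 * ((f y)\<^sup>2 + (g y)\<^sup>2)"
      using sq[OF bound(1)[OF y]] sq[OF bound(2)[OF y]] by linarith
    also have "(f y)\<^sup>2 + 2 * (f' y)\<^sup>2 + (g y)\<^sup>2 + 2 * (g' y)\<^sup>2 + 4 * K\<^sup>2 * ((f y)\<^sup>2 + (g y)\<^sup>2) \<le> (2 + 4 * K\<^sup>2) * E y"
    proof -
      have "0 \<le> (f y)\<^sup>2" "0 \<le> (g y)\<^sup>2" "0 \<le> 4 * K\<^sup>2 * ((f' y)\<^sup>2 + (g' y)\<^sup>2)" by simp_all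
      moreover have "(2 + 4 * K\<^sup>2) * E y = 2 * ((f y)\<^sup>2 + (f' y)\<^sup>2 + (g y)\<^sup>2 + (g' y)\<^sup>2)
        + 4 * K\<^sup>2 * ((f y)\<^sup>2 + (g y)\<^sup>2) + 4 * K\<^sup>2 * ((f' y)\<^sup>2 + (g' y)\<^sup>2)"
        unfolding E_def by (simp add: algebra_simps)
      ultimately show ?thesis by argo
    qed
    finally show "\<bar>E' y\<bar> \<le> (2 + 4 * K\<^sup>2) * E y" by simp
  qed
  moreover have "(f y)\<^sup>2 \<le> E y" "(g y)\<^sup>2 \<le> E y" by (simp_all add: E_def)
  ultimately show ?thesis by simp
qed

lemma nonlinearity_lipschitz:
  fixes \<epsilon> B :: real
  assumes \<epsilon>: "\<epsilon> \<ge> 0" and B: "\<bar>a\<bar> \<le> B" "\<bar>b\<bar> \<le> B" "\<bar>p\<bar> \<le> B" "\<bar>q\<bar> \<le> B"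
  shows "\<bar>\<epsilon> * a * (4 * (a\<^sup>2 + b\<^sup>2) - 1) - \<epsilon> * p * (4 * (p\<^sup>2 + q\<^sup>2) - 1)\<bar> \<le> \<epsilon> * (16 * B\<^sup>2 + 1) * (\<bar>a - p\<bar> + \<bar>b - q\<bar>)"
proof -
  have "a\<^sup>2 \<le> B\<^sup>2" "b\<^sup>2 \<le> B\<^sup>2" using B by (simp_all add: abs_le_square_iff[symmetric])
  then have r: "\<bar>a\<^sup>2 + b\<^sup>2\<bar> \<le> 2 * B\<^sup>2" by simp
  have s: "\<bar>p * (a + p)\<bar> \<le> B * (2 * B)" "\<bar>p * (b + q)\<bar> \<le> B * (2 * B)"
    unfolding abs_mult using B by (intro mult_mono; linarith)+
  \<comment> \<open>A telescoped difference of cubics: every cubic term carries a - p or b - q with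
    a coefficient of size at most 2 B^2. This gives 16 B^2 for a - p and 8 B^2 for b - q.\<close>
  have eq: "\<epsilon> * a * (4 * (a\<^sup>2 + b\<^sup>2) - 1) - \<epsilon> * p * (4 * (p\<^sup>2 + q\<^sup>2) - 1)
    = \<epsilon> * (4 * ((a\<^sup>2 + b\<^sup>2) * (a - p)) + 4 * ((p * (a + p)) * (a - p)) + 4 * ((p * (b + q)) * (b - q)) - (a - p))"
    by (simp add: power2_eq_square algebra_simps)
  have 1: "\<bar>(a\<^sup>2 + b\<^sup>2) * (a - p)\<bar> \<le> 2 * B\<^sup>2 * \<bar>a - p\<bar>"
    unfolding abs_mult using r by (intro mult_right_mono) auto
  have 2: "\<bar>(p * (a + p)) * (a - p)\<bar> \<le> 2 * B\<^sup>2 * \<bar>a - p\<bar>"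
    unfolding abs_mult[of "p * (a + p)"] using s by (intro mult_right_mono) (auto simp: power2_eq_square)
  have 3: "\<bar>(p * (b + q)) * (b - q)\<bar> \<le> 2 * B\<^sup>2 * \<bar>b - q\<bar>"
    unfolding abs_mult[of "p * (b + q)"] using s by (intro mult_right_mono) (auto simp: power2_eq_square)
  have "0 \<le> B\<^sup>2 * \<bar>b - q\<bar>" by simp
  have "\<bar>4 * ((a\<^sup>2 + b\<^sup>2) * (a - p)) + 4 * ((p * (a + p)) * (a - p)) + 4 * ((p * (b + q)) * (b - q)) - (a - p)\<bar>
    \<le> 16 * (B\<^sup>2 * \<bar>a - p\<bar>) + 8 * (B\<^sup>2 * \<bar>b - q\<bar>) + \<bar>a - p\<bar>"
    using 1 2 3 by linarith
  also have "\<dots> \<le> 16 * (B\<^sup>2 * \<bar>a - p\<bar>) + 16 * (B\<^sup>2 * \<bar>b - q\<bar>) + \<bar>a - p\<bar> + \<bar>b - q\<bar>"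
    using \<open>0 \<le> B\<^sup>2 * \<bar>b - q\<bar>\<close> by linarith
  also have "\<dots> = (16 * B\<^sup>2 + 1) * (\<bar>a - p\<bar> + \<bar>b - q\<bar>)" by (simp add: algebra_simps)
  finally have "\<epsilon> * \<bar>4 * ((a\<^sup>2 + b\<^sup>2) * (a - p)) + 4 * ((p * (a + p)) * (a - p)) + 4 * ((p * (b + q)) * (b - q)) - (a - p)\<bar>
    \<le> \<epsilon> * ((16 * B\<^sup>2 + 1) * (\<bar>a - p\<bar> + \<bar>b - q\<bar>))"
    using \<epsilon> by (rule mult_left_mono)
  then show ?thesis unfolding eq abs_mult[of \<epsilon>] using \<epsilon> by (simp add: mult.assoc)
qed

lemma DERIV_imp_bounded_on_Icc:
  fixes f :: "real \<Rightarrow> real"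
  assumes "\<And>y. y \<in> {a..b} \<Longrightarrow> (f has_real_derivative f' y) (at y within {a..b})"
  obtains B where "\<And>y. y \<in> {a..b} \<Longrightarrow> \<bar>f y\<bar> \<le> B"
proof -
  have "continuous_on {a..b} f" using assms by (rule DERIV_continuous_on)
  then have "bounded (f ` {a..b})" by (intro compact_imp_bounded compact_continuous_image) auto
  then obtain B where "\<forall>y\<in>{a..b}. \<bar>f y\<bar> \<le> B" by (auto simp: bounded_iff)
  then show ?thesis using that by blast
qed

text \<open>Exchanging the arguments of \<open>N\<close> in the second equation lets one Lipschitz
  estimate serve both. The interval is general because solutions will be compared with power series
  on small intervals.\<close>

lemma solution_unique:
  fixes \<epsilon> :: real
  defines "N \<equiv> \<lambda>x y. \<epsilon> * x * (4 * (x\<^sup>2 + y\<^sup>2) - 1)"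
  assumes \<epsilon>: "\<epsilon> \<ge> 0" and T: "x0 \<in> {a..b}"
    and u: "\<And>y. y \<in> {a..b} \<Longrightarrow> (u has_real_derivative u' y) (at y within {a..b})"
      "\<And>y. y \<in> {a..b} \<Longrightarrow> (u' has_real_derivative N (u y) (v y)) (at y within {a..b})"
    and v: "\<And>y. y \<in> {a..b} \<Longrightarrow> (v has_real_derivative v' y) (at y within {a..b})"
      "\<And>y. y \<in> {a..b} \<Longrightarrow> (v' has_real_derivative N (v y) (u y)) (at y within {a..b})"
    and p: "\<And>y. y \<in> {a..b} \<Longrightarrow> (p has_real_derivative p' y) (at y within {a..b})"
      "\<And>y. y \<in> {a..b} \<Longrightarrow> (p' has_real_derivative N (p y) (q y)) (at y within {a..b})"
    and q: "\<And>y. y \<in> {a..b} \<Longrightarrow> (q has_real_derivative q' y) (at y within {a..b})"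
      "\<And>y. y \<in> {a..b} \<Longrightarrow> (q' has_real_derivative N (q y) (p y)) (at y within {a..b})"
    and init: "u x0 = p x0" "u' x0 = p' x0" "v x0 = q x0" "v' x0 = q' x0"
    and y: "y \<in> {a..b}"
  shows "u y = p y \<and> v y = q y"
proof -
  obtain B1 where B1: "\<And>y. y \<in> {a..b} \<Longrightarrow> \<bar>u y\<bar> \<le> B1" using DERIV_imp_bounded_on_Icc[OF u(1)] by blast
  obtain B2 where B2: "\<And>y. y \<in> {a..b} \<Longrightarrow> \<bar>v y\<bar> \<le> B2" using DERIV_imp_bounded_on_Icc[OF v(1)] by blast
  obtain B3 where B3: "\<And>y. y \<in> {a..b} \<Longrightarrow> \<bar>p y\<bar> \<le> B3" using DERIV_imp_bounded_on_Icc[OF p(1)] by blast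
  obtain B4 where B4: "\<And>y. y \<in> {a..b} \<Longrightarrow> \<bar>q y\<bar> \<le> B4" using DERIV_imp_bounded_on_Icc[OF q(1)] by blast
  define B where "B = \<bar>B1\<bar> + \<bar>B2\<bar> + \<bar>B3\<bar> + \<bar>B4\<bar>"
  have B: "\<bar>u y\<bar> \<le> B" "\<bar>v y\<bar> \<le> B" "\<bar>p y\<bar> \<le> B" "\<bar>q y\<bar> \<le> B" if "y \<in> {a..b}" for y
    using B1[OF that] B2[OF that] B3[OF that] B4[OF that] unfolding B_def by linarith+
  have "u y - p y = 0 \<and> v y - q y = 0"
  proof (rule second_order_zero[where f = "\<lambda>y. u y - p y" and f' = "\<lambda>y. u' y - p' y"
        and f'' = "\<lambda>y. N (u y) (v y) - N (p y) (q y)"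
        and g = "\<lambda>y. v y - q y" and g' = "\<lambda>y. v' y - q' y" and g'' = "\<lambda>y. N (v y) (u y) - N (q y) (p y)"
        and K = "\<epsilon> * (16 * B\<^sup>2 + 1)", OF T _ _ _ _ _ _ _ _ _ _ y])
    fix y assume y: "y \<in> {a..b}"
    show "((\<lambda>y. u y - p y) has_real_derivative u' y - p' y) (at y within {a..b})"
      "((\<lambda>y. u' y - p' y) has_real_derivative N (u y) (v y) - N (p y) (q y)) (at y within {a..b})"
      "((\<lambda>y. v y - q y) has_real_derivative v' y - q' y) (at y within {a..b})"
      "((\<lambda>y. v' y - q' y) has_real_derivative N (v y) (u y) - N (q y) (p y)) (at y within {a..b})"
      by (intro DERIV_diff u v p q y)+
    show "\<bar>N (u y) (v y) - N (p y) (q y)\<bar> \<le> \<epsilon> * (16 * B\<^sup>2 + 1) * (\<bar>u y - p y\<bar> + \<bar>v y - q y\<bar>)"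
      unfolding N_def by (rule nonlinearity_lipschitz[OF \<epsilon>]) (use B[OF y] in auto)
    show "\<bar>N (v y) (u y) - N (q y) (p y)\<bar> \<le> \<epsilon> * (16 * B\<^sup>2 + 1) * (\<bar>u y - p y\<bar> + \<bar>v y - q y\<bar>)"
      using nonlinearity_lipschitz[OF \<epsilon> B(2)[OF y] B(1)[OF y] B(4)[OF y] B(3)[OF y]] unfolding N_def by (simp add: add.commute)
  qed (simp_all add: init)
  then show ?thesis by simp
qed

section \<open>Analyticity of solutions\<close>

definition conv :: "(nat \<Rightarrow> real) \<Rightarrow> (nat \<Rightarrow> real) \<Rightarrow> nat \<Rightarrow> real" where
  "conv a b n = (\<Sum>i\<le>n. a i * b (n - i))"

lemma conv_sums:
  assumes a: "\<And>t. \<bar>t\<bar> < r \<Longrightarrow> summable (\<lambda>n. a n * t ^ n)"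
    and b: "\<And>t. \<bar>t\<bar> < r \<Longrightarrow> summable (\<lambda>n. b n * t ^ n)"
    and t: "\<bar>t\<bar> < r"
  shows "(\<lambda>n. conv a b n * t ^ n) sums ((\<Sum>n. a n * t ^ n) * (\<Sum>n. b n * t ^ n))"
proof -
  obtain s where s: "\<bar>t\<bar> < s" "s < r" using dense[OF t] by blast
  then have "\<bar>s\<bar> < r" by linarith
  have abs: "summable (\<lambda>n. norm (c n * t ^ n))" if "\<And>t. \<bar>t\<bar> < r \<Longrightarrow> summable (\<lambda>n. c n * t ^ n)" for c :: "nat \<Rightarrow> real"
    by (rule powser_insidea[OF that[OF \<open>\<bar>s\<bar> < r\<close>]]) (use s in auto)
  have "(\<lambda>n. \<Sum>i\<le>n. (a i * t ^ i) * (b (n - i) * t ^ (n - i))) sums ((\<Sum>n. a n * t ^ n) * (\<Sum>n. b n * t ^ n))"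
    by (rule Cauchy_product_sums[OF abs[OF a] abs[OF b]])
  moreover have "(\<Sum>i\<le>n. (a i * t ^ i) * (b (n - i) * t ^ (n - i))) = conv a b n * t ^ n" for n
    unfolding conv_def sum_distrib_right
  proof (rule sum.cong[OF refl])
    fix i assume "i \<in> {..n}"
    then have "t ^ n = t ^ i * t ^ (n - i)" by (simp flip: power_add)
    then show "a i * t ^ i * (b (n - i) * t ^ (n - i)) = a i * b (n - i) * t ^ n" by simp
  qed
  ultimately show ?thesis by simp
qed

context
  notes sum.cong [fundef_cong]
begin

text \<open>Comparison of coefficients in the system; pairs are used because the two recursions are
  coupled. The congruence rule for sums tells the termination proof that the indices inside the sums
  are bounded by n.\<close>

fun taylor_coeffs :: "real \<Rightarrow> real \<times> real \<Rightarrow> real \<times> real \<Rightarrow> nat \<Rightarrow> real \<times> real" where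
  "taylor_coeffs e p q 0 = p"
| "taylor_coeffs e p q (Suc 0) = q"
| "taylor_coeffs e p q (Suc (Suc n)) =
    (e * (4 * (\<Sum>i\<le>n. (\<Sum>j\<le>i. fst (taylor_coeffs e p q j) * fst (taylor_coeffs e p q (i - j))
      + snd (taylor_coeffs e p q j) * snd (taylor_coeffs e p q (i - j))) * fst (taylor_coeffs e p q (n - i)))
      - fst (taylor_coeffs e p q n)) / (real (Suc n) * real (Suc (Suc n))),
     e * (4 * (\<Sum>i\<le>n. (\<Sum>j\<le>i. fst (taylor_coeffs e p q j) * fst (taylor_coeffs e p q (i - j))
      + snd (taylor_coeffs e p q j) * snd (taylor_coeffs e p q (i - j))) * snd (taylor_coeffs e p q (n - i)))
      - snd (taylor_coeffs e p q n)) / (real (Suc n) * real (Suc (Suc n))))"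

end

lemma taylor_coeffs_exist:
  fixes \<epsilon> :: real
  obtains a b :: "nat \<Rightarrow> real" where "a 0 = a0" "a 1 = a1" "b 0 = b0" "b 1 = b1"
    "\<And>n. real (Suc n) * real (Suc (Suc n)) * a (Suc (Suc n)) = \<epsilon> * (4 * conv (\<lambda>i. conv a a i + conv b b i) a n - a n)"
    "\<And>n. real (Suc n) * real (Suc (Suc n)) * b (Suc (Suc n)) = \<epsilon> * (4 * conv (\<lambda>i. conv a a i + conv b b i) b n - b n)"
proof -
  define a b where "a n = fst (taylor_coeffs \<epsilon> (a0, b0) (a1, b1) n)" and "b n = snd (taylor_coeffs \<epsilon> (a0, b0) (a1, b1) n)" for n
  show ?thesis
  proof (rule that[of a b])
    show "a 0 = a0" "a 1 = a1" "b 0 = b0" "b 1 = b1" by (simp_all add: a_def b_def)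
    fix n
    have pos: "real (Suc n) * real (Suc (Suc n)) \<noteq> 0" by simp
    have "a (Suc (Suc n)) = \<epsilon> * (4 * conv (\<lambda>i. conv a a i + conv b b i) a n - a n) / (real (Suc n) * real (Suc (Suc n)))"
      by (simp only: a_def b_def conv_def taylor_coeffs.simps fst_conv sum.distrib)
    then show "real (Suc n) * real (Suc (Suc n)) * a (Suc (Suc n)) = \<epsilon> * (4 * conv (\<lambda>i. conv a a i + conv b b i) a n - a n)"
      using pos by (metis nonzero_mult_div_cancel_left times_divide_eq_right)
    have "b (Suc (Suc n)) = \<epsilon> * (4 * conv (\<lambda>i. conv a a i + conv b b i) b n - b n) / (real (Suc n) * real (Suc (Suc n)))"
      by (simp only: a_def b_def conv_def taylor_coeffs.simps snd_conv sum.distrib)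
    then show "real (Suc n) * real (Suc (Suc n)) * b (Suc (Suc n)) = \<epsilon> * (4 * conv (\<lambda>i. conv a a i + conv b b i) b n - b n)"
      using pos by (metis nonzero_mult_div_cancel_left times_divide_eq_right)
  qed
qed

text \<open>A double convolution of geometrically bounded sequences gains a factor of order \<open>n\<^sup>2\<close>,
  which is exactly what the factor \<open>(n + 1) (n + 2)\<close> of the second derivative absorbs.\<close>

lemma cubic_conv_bound:
  fixes M R :: real
  assumes a: "\<And>i. i \<le> n \<Longrightarrow> \<bar>a i\<bar> \<le> M * R ^ i" and b: "\<And>i. i \<le> n \<Longrightarrow> \<bar>b i\<bar> \<le> M * R ^ i"
    and c: "\<And>i. i \<le> n \<Longrightarrow> \<bar>c i\<bar> \<le> M * R ^ i" and M: "M \<ge> 0" and R: "R \<ge> 0"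
  shows "\<bar>conv (\<lambda>i. conv a a i + conv b b i) c n\<bar> \<le> M ^ 3 * R ^ n * (real (Suc n) * real (Suc (Suc n)))"
proof -
  have sq: "\<bar>conv d d i\<bar> \<le> M\<^sup>2 * R ^ i * real (Suc i)" if i: "i \<le> n" and d: "\<And>i. i \<le> n \<Longrightarrow> \<bar>d i\<bar> \<le> M * R ^ i" for d i
  proof -
    have "\<bar>conv d d i\<bar> \<le> (\<Sum>j\<le>i. \<bar>d j * d (i - j)\<bar>)" unfolding conv_def by (rule sum_abs)
    also have "\<dots> \<le> (\<Sum>j\<le>i. M\<^sup>2 * R ^ i)"
    proof (rule sum_mono)
      fix j assume "j \<in> {..i}"
      then have j: "j \<le> i" by simp
      have "\<bar>d j * d (i - j)\<bar> \<le> (M * R ^ j) * (M * R ^ (i - j))"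
        unfolding abs_mult using d[of j] d[of "i - j"] i j M R by (intro mult_mono) auto
      also have "\<dots> = M\<^sup>2 * (R ^ j * R ^ (i - j))" by (simp add: power2_eq_square)
      also have "R ^ j * R ^ (i - j) = R ^ i" using j by (simp flip: power_add)
      finally show "\<bar>d j * d (i - j)\<bar> \<le> M\<^sup>2 * R ^ i" .
    qed
    finally show ?thesis by (simp add: mult_ac)
  qed
  have "\<bar>conv (\<lambda>i. conv a a i + conv b b i) c n\<bar> \<le> (\<Sum>i\<le>n. \<bar>(conv a a i + conv b b i) * c (n - i)\<bar>)"
    unfolding conv_def[of _ c] by (rule sum_abs)
  also have "\<dots> \<le> (\<Sum>i\<le>n. M ^ 3 * R ^ n * (2 * real (Suc i)))"
  proof (rule sum_mono)
    fix i assume "i \<in> {..n}"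
    then have i: "i \<le> n" by simp
    have "\<bar>conv a a i + conv b b i\<bar> \<le> 2 * (M\<^sup>2 * R ^ i * real (Suc i))"
      using sq[OF i a] sq[OF i b] by linarith
    then have "\<bar>(conv a a i + conv b b i) * c (n - i)\<bar> \<le> (2 * (M\<^sup>2 * R ^ i * real (Suc i))) * (M * R ^ (n - i))"
      unfolding abs_mult using c[of "n - i"] M R by (intro mult_mono) auto
    also have "\<dots> = M ^ 3 * (R ^ i * R ^ (n - i)) * (2 * real (Suc i))" by (simp add: power2_eq_square power3_eq_cube)
    also have "R ^ i * R ^ (n - i) = R ^ n" using i by (simp flip: power_add)
    finally show "\<bar>(conv a a i + conv b b i) * c (n - i)\<bar> \<le> M ^ 3 * R ^ n * (2 * real (Suc i))" .
  qed
  also have "\<dots> = M ^ 3 * R ^ n * (\<Sum>i\<le>n. 2 * real (Suc i))" by (simp add: sum_distrib_left)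
  also have "(\<Sum>i\<le>n. 2 * real (Suc i)) = real (Suc n) * real (Suc (Suc n))"
    by (induction n) (auto simp: algebra_simps)
  finally show ?thesis .
qed

text \<open>Once the factor (n + 1) (n + 2) has cancelled, passing from n to n + 2 costs \<epsilon>
  (4 M^2 + 1) <= R, while two powers of R >= 1 are available.\<close>

lemma taylor_coeffs_bound:
  fixes \<epsilon> M R :: real
  assumes \<epsilon>: "\<epsilon> \<ge> 0" and M: "M \<ge> 0" and R: "R \<ge> 1" "\<epsilon> * (4 * M\<^sup>2 + 1) \<le> R"
    and init: "\<bar>a 0\<bar> \<le> M" "\<bar>a 1\<bar> \<le> M" "\<bar>b 0\<bar> \<le> M" "\<bar>b 1\<bar> \<le> M"
    and rec: "\<And>n. real (Suc n) * real (Suc (Suc n)) * a (Suc (Suc n)) = \<epsilon> * (4 * conv (\<lambda>i. conv a a i + conv b b i) a n - a n)"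
    "\<And>n. real (Suc n) * real (Suc (Suc n)) * b (Suc (Suc n)) = \<epsilon> * (4 * conv (\<lambda>i. conv a a i + conv b b i) b n - b n)"
  shows "\<bar>a n\<bar> \<le> M * R ^ n \<and> \<bar>b n\<bar> \<le> M * R ^ n"
proof (induction n rule: less_induct)
  case (less n)
  consider "n = 0" | "n = 1" | m where "n = Suc (Suc m)" by (metis One_nat_def not0_implies_Suc)
  then show ?case
  proof cases
    case 2
    have "M * 1 \<le> M * R" using M R by (intro mult_left_mono) auto
    then show ?thesis using 2 init by simp
  next
    case 3
    have step: "\<bar>x\<bar> \<le> M * R ^ n"
      if x: "real (Suc m) * real (Suc (Suc m)) * x = \<epsilon> * (4 * conv (\<lambda>i. conv a a i + conv b b i) c m - c m)"
        and c: "\<And>i. i \<le> m \<Longrightarrow> \<bar>c i\<bar> \<le> M * R ^ i" for x c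
    proof -
      let ?k = "real (Suc m) * real (Suc (Suc m))"
      have k: "?k \<ge> 1" by (simp add: mult_ge1_I)
      have "?k * \<bar>x\<bar> = \<bar>?k * x\<bar>" by (simp add: abs_mult)
      also have "\<dots> = \<epsilon> * \<bar>4 * conv (\<lambda>i. conv a a i + conv b b i) c m - c m\<bar>"
        unfolding x abs_mult[of \<epsilon>] using \<epsilon> by simp
      also have "\<dots> \<le> \<epsilon> * (4 * (M ^ 3 * R ^ m * ?k) + M * R ^ m * ?k)"
      proof (rule mult_left_mono[OF _ \<epsilon>])
        have "\<bar>conv (\<lambda>i. conv a a i + conv b b i) c m\<bar> \<le> M ^ 3 * R ^ m * ?k"
          using less.IH 3 c M R by (intro cubic_conv_bound) auto
        moreover have "\<bar>c m\<bar> \<le> M * R ^ m * ?k"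
        proof -
          have "\<bar>c m\<bar> \<le> M * R ^ m * 1" using c[of m] by simp
          also have "\<dots> \<le> M * R ^ m * ?k" using k M R by (intro mult_left_mono) auto
          finally show ?thesis .
        qed
        ultimately show "\<bar>4 * conv (\<lambda>i. conv a a i + conv b b i) c m - c m\<bar> \<le> 4 * (M ^ 3 * R ^ m * ?k) + M * R ^ m * ?k"
          by linarith
      qed
      also have "\<dots> = ?k * (M * R ^ m * (\<epsilon> * (4 * M\<^sup>2 + 1)))"
        by (simp add: power2_eq_square power3_eq_cube algebra_simps)
      finally have "\<bar>x\<bar> \<le> M * R ^ m * (\<epsilon> * (4 * M\<^sup>2 + 1))" using k by (simp add: mult_le_cancel_left_pos)
      also have "\<dots> \<le> M * R ^ m * (R * R)"
      proof (rule mult_left_mono)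
        have "R * 1 \<le> R * R" using R by (intro mult_left_mono) auto
        then show "\<epsilon> * (4 * M\<^sup>2 + 1) \<le> R * R" using R by linarith
      qed (use M R in auto)
      finally show ?thesis using 3 by (simp add: mult_ac)
    qed
    show ?thesis
      using step[of "a n" a] step[of "b n" b] rec[of m] less.IH 3 by auto
  qed (use init in auto)
qed

lemma local_analytic_solution:
  fixes \<epsilon> :: real
  assumes \<epsilon>: "\<epsilon> \<ge> 0"
  obtains r and a b :: "nat \<Rightarrow> real" and P P' Q Q' :: "real \<Rightarrow> real" where "r > 0"
    "P 0 = a0" "P' 0 = a1" "Q 0 = b0" "Q' 0 = b1"
    "\<And>t. \<bar>t\<bar> < r \<Longrightarrow> (\<lambda>n. a n * t ^ n) sums P t" "\<And>t. \<bar>t\<bar> < r \<Longrightarrow> (\<lambda>n. b n * t ^ n) sums Q t"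
    "\<And>t. \<bar>t\<bar> < r \<Longrightarrow> (P has_real_derivative P' t) (at t)"
    "\<And>t. \<bar>t\<bar> < r \<Longrightarrow> (P' has_real_derivative \<epsilon> * P t * (4 * ((P t)\<^sup>2 + (Q t)\<^sup>2) - 1)) (at t)"
    "\<And>t. \<bar>t\<bar> < r \<Longrightarrow> (Q has_real_derivative Q' t) (at t)"
    "\<And>t. \<bar>t\<bar> < r \<Longrightarrow> (Q' has_real_derivative \<epsilon> * Q t * (4 * ((P t)\<^sup>2 + (Q t)\<^sup>2) - 1)) (at t)"
proof -
  obtain a b where init: "a 0 = a0" "a 1 = a1" "b 0 = b0" "b 1 = b1" and
    rec: "\<And>n. real (Suc n) * real (Suc (Suc n)) * a (Suc (Suc n)) = \<epsilon> * (4 * conv (\<lambda>i. conv a a i + conv b b i) a n - a n)"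
    "\<And>n. real (Suc n) * real (Suc (Suc n)) * b (Suc (Suc n)) = \<epsilon> * (4 * conv (\<lambda>i. conv a a i + conv b b i) b n - b n)"
    using taylor_coeffs_exist[where ?a0.0 = a0 and ?a1.0 = a1 and ?b0.0 = b0 and ?b1.0 = b1 and \<epsilon> = \<epsilon>]
    by blast
  \<comment> \<open>\<open>M\<close> dominates the four initial coefficients and \<open>R\<close>
    satisfies the hypotheses of the coefficient bound; a geometric majorant then gives convergence
    for |t| < 1/R.\<close>
  define M where "M = \<bar>a0\<bar> + \<bar>a1\<bar> + \<bar>b0\<bar> + \<bar>b1\<bar>"
  define R where "R = 1 + \<epsilon> * (4 * M\<^sup>2 + 1)"
  have R: "R \<ge> 1" "\<epsilon> * (4 * M\<^sup>2 + 1) \<le> R" using \<epsilon> by (auto simp: R_def)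
  have bound: "\<bar>a n\<bar> \<le> M * R ^ n \<and> \<bar>b n\<bar> \<le> M * R ^ n" for n
    by (rule taylor_coeffs_bound[OF \<epsilon> _ R _ _ _ _ rec]) (auto simp: M_def init[simplified])
  define r where "r = 1 / R"
  have r: "r > 0" using R by (simp add: r_def)
  have summ: "summable (\<lambda>n. c n * t ^ n)" if c: "\<And>n. \<bar>c n\<bar> \<le> M * R ^ n" and t: "\<bar>t\<bar> < r" for c :: "nat \<Rightarrow> real" and t
  proof (rule summable_comparison_test')
    have "R * \<bar>t\<bar> < 1" using t R by (simp add: r_def field_simps)
    then show "summable (\<lambda>n. M * (R * \<bar>t\<bar>) ^ n)" using R by (intro summable_mult summable_geometric) (simp add: abs_mult)
    fix n :: nat
    have "\<bar>c n\<bar> * \<bar>t\<bar> ^ n \<le> (M * R ^ n) * \<bar>t\<bar> ^ n" using c by (intro mult_right_mono) auto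
    then show "norm (c n * t ^ n) \<le> M * (R * \<bar>t\<bar>) ^ n" by (simp add: abs_mult power_abs power_mult_distrib mult.assoc)
  qed
  have sa: "summable (\<lambda>n. a n * t ^ n)" and sb: "summable (\<lambda>n. b n * t ^ n)" if "\<bar>t\<bar> < r" for t
    using summ[of a t] summ[of b t] bound that by auto
  define P Q P' Q' where "P t = (\<Sum>n. a n * t ^ n)" and "Q t = (\<Sum>n. b n * t ^ n)"
    and "P' t = (\<Sum>n. diffs a n * t ^ n)" and "Q' t = (\<Sum>n. diffs b n * t ^ n)" for t
  have sq: "(\<lambda>n. (conv a a n + conv b b n) * t ^ n) sums ((P t)\<^sup>2 + (Q t)\<^sup>2)" if "\<bar>t\<bar> < r" for t
    using sums_add[OF conv_sums[of r a a t, OF sa sa that] conv_sums[of r b b t, OF sb sb that]]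
    by (simp add: P_def Q_def power2_eq_square distrib_right)
  \<comment> \<open>Stated for any sequence \<open>c\<close> with the common form of the recursion,
    so that it applies to \<open>a\<close> and to \<open>b\<close>: the recursion identifies the
    twice differentiated series with the nonlinearity.\<close>
  have second: "((\<lambda>t. \<Sum>n. diffs c n * t ^ n) has_real_derivative \<epsilon> * (\<Sum>n. c n * t ^ n) * (4 * ((P t)\<^sup>2 + (Q t)\<^sup>2) - 1)) (at t)"
    and first: "((\<lambda>t. \<Sum>n. c n * t ^ n) has_real_derivative (\<Sum>n. diffs c n * t ^ n)) (at t)"
    if c: "\<And>t. \<bar>t\<bar> < r \<Longrightarrow> summable (\<lambda>n. c n * t ^ n)" and t: "\<bar>t\<bar> < r"
      and rec: "\<And>n. real (Suc n) * real (Suc (Suc n)) * c (Suc (Suc n)) = \<epsilon> * (4 * conv (\<lambda>i. conv a a i + conv b b i) c n - c n)"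
    for c :: "nat \<Rightarrow> real" and t
  proof -
    show "((\<lambda>t. \<Sum>n. c n * t ^ n) has_real_derivative (\<Sum>n. diffs c n * t ^ n)) (at t)"
      by (rule termdiffs_strong'[of r]) (use c t in auto)
    have "summable (\<lambda>n. diffs c n * t ^ n)" if "\<bar>t\<bar> < r" for t
      by (rule termdiff_converges[of t r]) (use c that in auto)
    then have D: "((\<lambda>t. \<Sum>n. diffs c n * t ^ n) has_real_derivative (\<Sum>n. diffs (diffs c) n * t ^ n)) (at t)"
      by (intro termdiffs_strong'[of r]) (use t in auto)
    have S: "(\<lambda>n. diffs (diffs c) n * t ^ n) sums (\<epsilon> * (\<Sum>n. c n * t ^ n) * (4 * ((P t)\<^sup>2 + (Q t)\<^sup>2) - 1))"
    proof -
      have "(\<lambda>n. conv (\<lambda>i. conv a a i + conv b b i) c n * t ^ n) sums ((\<Sum>n. (conv a a n + conv b b n) * t ^ n) * (\<Sum>n. c n * t ^ n))"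
        by (rule conv_sums[of r]) (use sq c t in \<open>auto intro: sums_summable\<close>)
      then have "(\<lambda>n. conv (\<lambda>i. conv a a i + conv b b i) c n * t ^ n) sums (((P t)\<^sup>2 + (Q t)\<^sup>2) * (\<Sum>n. c n * t ^ n))"
        using sums_unique[OF sq[OF t]] by simp
      from sums_mult[OF sums_diff[OF sums_mult[OF this, of 4] summable_sums[OF c[OF t]]], of \<epsilon>]
      have "(\<lambda>n. \<epsilon> * (4 * (conv (\<lambda>i. conv a a i + conv b b i) c n * t ^ n) - c n * t ^ n)) sums
        (\<epsilon> * (4 * (((P t)\<^sup>2 + (Q t)\<^sup>2) * (\<Sum>n. c n * t ^ n)) - (\<Sum>n. c n * t ^ n)))" .
      moreover have "\<epsilon> * (4 * (conv (\<lambda>i. conv a a i + conv b b i) c n * t ^ n) - c n * t ^ n) = diffs (diffs c) n * t ^ n" for n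
      proof -
        have "diffs (diffs c) n * t ^ n = (real (Suc n) * real (Suc (Suc n)) * c (Suc (Suc n))) * t ^ n"
          by (simp add: diffs_def)
        then show ?thesis unfolding rec by (simp add: algebra_simps)
      qed
      ultimately show ?thesis by (simp add: algebra_simps)
    qed
    show "((\<lambda>t. \<Sum>n. diffs c n * t ^ n) has_real_derivative \<epsilon> * (\<Sum>n. c n * t ^ n) * (4 * ((P t)\<^sup>2 + (Q t)\<^sup>2) - 1)) (at t)"
      using D unfolding sums_unique[OF S, symmetric] .
  qed
  show ?thesis
  proof (rule that[of r P P' Q Q' a b])
    show "P 0 = a0" "P' 0 = a1" "Q 0 = b0" "Q' 0 = b1"
      using init by (simp_all add: P_def P'_def Q_def Q'_def powser_zero diffs_def)
    fix t assume t: "\<bar>t\<bar> < r"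
    show "(\<lambda>n. a n * t ^ n) sums P t" "(\<lambda>n. b n * t ^ n) sums Q t"
      unfolding P_def Q_def using sa[OF t] sb[OF t] by (auto intro: summable_sums)
    show "(P has_real_derivative P' t) (at t)" "(Q has_real_derivative Q' t) (at t)"
      unfolding P_def [abs_def] P'_def Q_def [abs_def] Q'_def using first[OF sa t rec(1)] first[OF sb t rec(2)] by auto
    show "(P' has_real_derivative \<epsilon> * P t * (4 * ((P t)\<^sup>2 + (Q t)\<^sup>2) - 1)) (at t)"
      using second[OF sa t rec(1)] by (simp only: P_def [symmetric] P'_def [abs_def])
    show "(Q' has_real_derivative \<epsilon> * Q t * (4 * ((P t)\<^sup>2 + (Q t)\<^sup>2) - 1)) (at t)"
      using second[OF sb t rec(2)] by (simp only: Q_def [symmetric] Q'_def [abs_def])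
  qed (rule r)
qed

lemma solution_analytic:
  assumes \<epsilon>: "\<epsilon> \<ge> 0" and sol: "solves_system \<epsilon> u v"
  shows "real_analytic_on u {-1..1}" "real_analytic_on v {-1..1}"
proof -
  define N where "N x y = \<epsilon> * x * (4 * (x\<^sup>2 + y\<^sup>2) - 1)" for x y :: real
  obtain u' v' where
    D: "\<And>y. y \<in> {-1..1} \<Longrightarrow> (u has_real_derivative u' y) (at y within {-1..1})"
      "\<And>y. y \<in> {-1..1} \<Longrightarrow> (u' has_real_derivative N (u y) (v y)) (at y within {-1..1})"
      "\<And>y. y \<in> {-1..1} \<Longrightarrow> (v has_real_derivative v' y) (at y within {-1..1})"
      "\<And>y. y \<in> {-1..1} \<Longrightarrow> (v' has_real_derivative N (v y) (u y)) (at y within {-1..1})"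
    using sol unfolding solves_system_def has_second_derivative_def N_def
    by (metis (no_types, lifting) add.commute)
  have "\<exists>r>0. \<exists>a b. \<forall>y\<in>{-1..1}. \<bar>y - x\<bar> < r \<longrightarrow> (\<lambda>n. a n * (y - x) ^ n) sums u y \<and> (\<lambda>n. b n * (y - x) ^ n) sums v y"
    if x: "x \<in> {-1..1}" for x
  proof -
    obtain r and a b :: "nat \<Rightarrow> real" and P P' Q Q' :: "real \<Rightarrow> real" where r: "r > 0" and
      init: "P 0 = u x" "P' 0 = u' x" "Q 0 = v x" "Q' 0 = v' x"
      and sums: "\<And>t. \<bar>t\<bar> < r \<Longrightarrow> (\<lambda>n. a n * t ^ n) sums P t" "\<And>t. \<bar>t\<bar> < r \<Longrightarrow> (\<lambda>n. b n * t ^ n) sums Q t"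
      and PQ: "\<And>t. \<bar>t\<bar> < r \<Longrightarrow> (P has_real_derivative P' t) (at t)"
      "\<And>t. \<bar>t\<bar> < r \<Longrightarrow> (P' has_real_derivative \<epsilon> * P t * (4 * ((P t)\<^sup>2 + (Q t)\<^sup>2) - 1)) (at t)"
      "\<And>t. \<bar>t\<bar> < r \<Longrightarrow> (Q has_real_derivative Q' t) (at t)"
      "\<And>t. \<bar>t\<bar> < r \<Longrightarrow> (Q' has_real_derivative \<epsilon> * Q t * (4 * ((P t)\<^sup>2 + (Q t)\<^sup>2) - 1)) (at t)"
      by (rule local_analytic_solution[OF \<epsilon>, of "u x" "u' x" "v x" "v' x"]) blast
    \<comment> \<open>Half the radius keeps the closed interval inside the domain of convergence;
      clipping at -1 and 1 treats the end points by one-sided comparison.\<close>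
    define l h where "l = max (-1) (x - r / 2)" and "h = min 1 (x + r / 2)"
    have sub: "y \<in> {-1..1}" "\<bar>y - x\<bar> < r" if "y \<in> {l..h}" for y
      using that r by (auto simp: l_def h_def)
    have xT: "x \<in> {l..h}" using x r by (auto simp: l_def h_def)
    have within: "(f has_real_derivative f') (at y within {l..h})"
      if "(f has_real_derivative f') (at y within {-1..1})" for f f' y
      by (rule DERIV_subset[OF that]) (use sub in auto)
    have shift: "((\<lambda>y. F (y - x)) has_real_derivative F') (at y within {l..h})"
      if "(F has_real_derivative F') (at (y - x))" for F F' y
      by (rule DERIV_cong[OF DERIV_chain'[of "\<lambda>y. y - x" 1 y "{l..h}" F F', OF _ that]]) (auto intro!: derivative_eq_intros)
    have eq: "u y = P (y - x) \<and> v y = Q (y - x)" if y: "y \<in> {l..h}" for y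
    proof (rule solution_unique[where u = u and v = v and u' = u' and v' = v' and p = "\<lambda>y. P (y - x)"
          and q = "\<lambda>y. Q (y - x)" and p' = "\<lambda>y. P' (y - x)" and q' = "\<lambda>y. Q' (y - x)", OF \<epsilon> xT, folded N_def])
      fix y assume y: "y \<in> {l..h}"
      show "(u has_real_derivative u' y) (at y within {l..h})" "(u' has_real_derivative N (u y) (v y)) (at y within {l..h})"
        "(v has_real_derivative v' y) (at y within {l..h})" "(v' has_real_derivative N (v y) (u y)) (at y within {l..h})"
        using D sub[OF y] by (auto intro!: within)
      show "((\<lambda>y. P (y - x)) has_real_derivative P' (y - x)) (at y within {l..h})"
        "((\<lambda>y. P' (y - x)) has_real_derivative N (P (y - x)) (Q (y - x))) (at y within {l..h})"
        "((\<lambda>y. Q (y - x)) has_real_derivative Q' (y - x)) (at y within {l..h})"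
        "((\<lambda>y. Q' (y - x)) has_real_derivative N (Q (y - x)) (P (y - x))) (at y within {l..h})"
        using PQ[OF sub(2)[OF y]] by (auto intro!: shift simp: N_def add.commute)
    qed (use y in \<open>simp_all add: init\<close>)
    have "(\<lambda>n. a n * (y - x) ^ n) sums u y \<and> (\<lambda>n. b n * (y - x) ^ n) sums v y"
      if "y \<in> {-1..1}" "\<bar>y - x\<bar> < r / 2" for y
    proof -
      have "y - x < r / 2" "x - y < r / 2" using that(2) by linarith+
      then have y: "y \<in> {l..h}" using that(1) by (auto simp: l_def h_def)
      show ?thesis using eq[OF y] sums[OF sub(2)[OF y]] by simp
    qed
    then show ?thesis using r by (intro exI[of _ "r / 2"] conjI exI[of _ a] exI[of _ b]) auto
  qed
  then show "real_analytic_on u {-1..1}" "real_analytic_on v {-1..1}"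
    unfolding real_analytic_on_def by meson+
qed

section \<open>Order reconstruction solutions\<close>

lemma scalar_solution_inj:
  fixes \<epsilon> :: real
  assumes \<epsilon>: "\<epsilon> \<ge> 0" and sol: "has_second_derivative u (\<lambda>y. \<epsilon> * u y * (4 * (u y)\<^sup>2 - 1))"
    and left: "(u (-1))\<^sup>2 = 1 / 4" and nonconst: "t \<in> {-1..1}" "u t \<noteq> u (-1)"
  shows "inj_on u {-1..1}"
proof -
  obtain u' where u: "\<And>y. y \<in> {-1..1} \<Longrightarrow> (u has_real_derivative u' y) (at y within {-1..1})"
    "\<And>y. y \<in> {-1..1} \<Longrightarrow> (u' has_real_derivative \<epsilon> * u y * (4 * (u y)\<^sup>2 - 1)) (at y within {-1..1})"
    using sol unfolding has_second_derivative_def by blast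
  \<comment> \<open>Otherwise u starts at rest at an equilibrium: as 4 u(-1)^2 = 1, the nonlinearity
    has the factor u - u(-1), and uniqueness would make u constant.\<close>
  have "u' (-1) \<noteq> 0"
  proof
    assume u'0: "u' (-1) = 0"
    obtain B where B: "\<And>y. y \<in> {-1..1} \<Longrightarrow> \<bar>u y\<bar> \<le> B"
      using DERIV_imp_bounded_on_Icc[OF u(1)] by blast
    define K where "K = \<epsilon> * (4 * (B * (B + B)))"
    have "u t - u (-1) = 0 \<and> (0::real) = 0"
    proof (rule second_order_zero[where ?x0.0 = "-1" and a = "-1" and b = 1 and f' = u' and g' = "\<lambda>_. 0" and g'' = "\<lambda>_. 0"
          and f = "\<lambda>y. u y - u (-1)" and f'' = "\<lambda>y. \<epsilon> * u y * (4 * (u y)\<^sup>2 - 1)" and g = "\<lambda>_. 0" and K = K and y = t])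
      fix y :: real assume y: "y \<in> {-1..1}"
      show "((\<lambda>y. u y - u (-1)) has_real_derivative u' y) (at y within {-1..1})"
        using u(1)[OF y] by (auto intro!: derivative_eq_intros)
      show "(u' has_real_derivative \<epsilon> * u y * (4 * (u y)\<^sup>2 - 1)) (at y within {-1..1})" by (rule u(2)[OF y])
      have "4 * (u y)\<^sup>2 - 1 = 4 * ((u y + u (-1)) * (u y - u (-1)))"
        using left by (simp add: power2_eq_square algebra_simps)
      then have eq: "\<epsilon> * u y * (4 * (u y)\<^sup>2 - 1) = (\<epsilon> * (4 * (u y * (u y + u (-1))))) * (u y - u (-1))" by simp
      have le: "\<bar>\<epsilon> * (4 * (u y * (u y + u (-1))))\<bar> \<le> K"
      proof -
        have "\<bar>u y + u (-1)\<bar> \<le> B + B" using B[OF y] B[of "-1"] by (intro order_trans[OF abs_triangle_ineq]) auto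
        then have "\<bar>u y * (u y + u (-1))\<bar> \<le> B * (B + B)"
          unfolding abs_mult using B[OF y] by (intro mult_mono) auto
        then show ?thesis using \<epsilon> unfolding K_def abs_mult[of \<epsilon>] by (simp add: abs_mult mult_left_mono)
      qed
      show "\<bar>\<epsilon> * u y * (4 * (u y)\<^sup>2 - 1)\<bar> \<le> K * (\<bar>u y - u (-1)\<bar> + \<bar>0\<bar>)"
        unfolding eq abs_mult[of _ "u y - u (-1)"] using mult_right_mono[OF le abs_ge_zero] by simp
      have "K \<ge> 0" using \<epsilon> B[OF y] by (simp add: K_def)
      then show "\<bar>0\<bar> \<le> K * (\<bar>u y - u (-1)\<bar> + \<bar>0\<bar>)" by simp
    qed (use nonconst u'0 in auto)
    then show False using nonconst by simp
  qed
  have first_integral: "(u' y)\<^sup>2 - 2 * \<epsilon> * ((u y)\<^sup>2 - 1 / 4)\<^sup>2 = (u' (-1))\<^sup>2" if y: "y \<in> {-1..1}" for y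
  proof -
    have "((\<lambda>y. (u' y)\<^sup>2 - 2 * \<epsilon> * ((u y)\<^sup>2 - 1 / 4)\<^sup>2) has_real_derivative 0) (at y within {-1..1})" if "y \<in> {-1..1}" for y
      using u[OF that] by (auto intro!: derivative_eq_intros simp: power2_eq_square algebra_simps)
    then obtain c where c: "\<And>y. y \<in> {-1..1} \<Longrightarrow> (u' y)\<^sup>2 - 2 * \<epsilon> * ((u y)\<^sup>2 - 1 / 4)\<^sup>2 = c"
      using has_field_derivative_zero_constant[of "{-1..1}" "\<lambda>y. (u' y)\<^sup>2 - 2 * \<epsilon> * ((u y)\<^sup>2 - 1 / 4)\<^sup>2"] by auto
    show ?thesis using c[OF y] c[of "-1"] left by simp
  qed
  \<comment> \<open>The well term vanishes at -1, so u'(y)^2 >= u'(-1)^2 > 0 everywhere; Rolle's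
    theorem then gives injectivity.\<close>
  have nz: "u' y \<noteq> 0" if y: "y \<in> {-1..1}" for y
  proof
    assume "u' y = 0"
    then have "- (2 * \<epsilon> * ((u y)\<^sup>2 - 1 / 4)\<^sup>2) = (u' (-1))\<^sup>2" using first_integral[OF y] by simp
    moreover have "(u' (-1))\<^sup>2 > 0" using \<open>u' (-1) \<noteq> 0\<close> by simp
    moreover have "2 * \<epsilon> * ((u y)\<^sup>2 - 1 / 4)\<^sup>2 \<ge> 0" using \<epsilon> by simp
    ultimately show False by linarith
  qed
  have False if pq: "p \<in> {-1..1}" "q \<in> {-1..1}" "p < q" "u p = u q" for p q
  proof -
    have d: "(u has_real_derivative u' y) (at y)" if "p < y" "y < q" for y
      using u(1)[of y] pq that by (simp add: at_within_Icc_at)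
    have "continuous_on {p..q} u"
      using pq by (intro continuous_on_subset[OF DERIV_continuous_on[OF u(1)]]) auto
    obtain y where y: "p < y" "y < q" "(u has_real_derivative 0) (at y)"
    proof -
      have "u differentiable (at y)" if "p < y" "y < q" for y
        using d[OF that] real_differentiable_def by blast
      from Rolle[OF pq(3,4) \<open>continuous_on {p..q} u\<close> this] show ?thesis using that by blast
    qed
    then have "u' y = 0" using DERIV_unique[OF d[OF y(1,2)] y(3)] by simp
    then show False using nz[of y] y pq by auto
  qed
  note no = this
  show ?thesis
  proof (rule inj_onI, rule ccontr)
    fix p q assume pq: "p \<in> {-1..1}" "q \<in> {-1..1}" "u p = u q" "p \<noteq> q"
    then consider "p < q" | "q < p" by linarith
    then show False by cases (use no[of p q] no[of q p] pq in simp_all)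
  qed
qed

section \<open>Existence of domain walls for \<omega> = 1/4 and \<omega> = -1/4\<close>

lemma has_second_derivative_zero: "has_second_derivative (\<lambda>_. 0) (\<lambda>_. 0)"
  unfolding has_second_derivative_def by (intro exI[of _ "\<lambda>_. 0"]) auto

lemma director_angle_vertical:
  assumes "\<sigma> = 1 \<or> \<sigma> = -1" "\<sigma> * q \<ge> 0"
  shows "director_angle (\<sigma> * pi / 4) 0 q"
  using assms by (auto simp: director_angle_def scalar_order_def)

text \<open>Here the boundary values are (0, -\<sigma>/2) and (0, \<sigma>/2), so a scalar solution
  can be placed in the second component. Its only zero is the wall, where the angle jumps from
  -\<sigma> pi/4 to \<sigma> pi/4.\<close>

lemma OR_solution_exists:
  fixes \<epsilon> \<sigma> :: real
  assumes \<epsilon>: "\<epsilon> \<ge> 0" and \<sigma>: "\<sigma> = 1 \<or> \<sigma> = -1"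
  shows "\<exists>Q11 Q12. OR_solution \<epsilon> (\<sigma> / 4) Q11 Q12"
proof -
  obtain u where u: "u \<in> W12" "u (-1) = - \<sigma> / 2" "u 1 = \<sigma> / 2"
    and sol: "has_second_derivative u (\<lambda>t. \<epsilon> * u t * (4 * (u t)\<^sup>2 - 1))"
    by (rule scalar_solution_exists[OF \<epsilon>])
  have sq: "\<sigma> * \<sigma> = 1" using \<sigma> by auto
  have inj: "inj_on u {-1..1}"
    by (rule scalar_solution_inj[OF \<epsilon> sol, of 1]) (use \<sigma> u in \<open>auto simp: power2_eq_square\<close>)
  \<comment> \<open>The sign makes v run from -1/2 to 1/2 in both cases.\<close>
  define v where "v y = \<sigma> * u y" for y
  have cv: "continuous_on {-1..1} v"
    using u(1) unfolding v_def W12_def by (auto intro!: continuous_intros)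
  have v: "v (-1) = - 1 / 2" "v 1 = 1 / 2" by (simp_all add: v_def u(2,3) sq)
  have v0: "p = q" if "v p = 0" "v q = 0" "p \<in> {-1..1}" "q \<in> {-1..1}" for p q
  proof -
    have "u p = u q" using that \<sigma> by (auto simp: v_def)
    then show ?thesis using inj that by (auto dest: inj_onD)
  qed
  obtain z where z: "-1 \<le> z" "z \<le> 1" "v z = 0"
    using IVT'[of v "-1" 0 1] cv v by auto
  have "z \<noteq> -1" "z \<noteq> 1" using v z by auto
  then have z': "-1 < z" "z < 1" using z by auto
  \<comment> \<open>A wrong sign would produce, by the intermediate value theorem, a zero other than
    z; the same holds on the right.\<close>
  have left: "v y \<le> 0" if y: "y \<in> {-1..z}" for y
  proof (rule ccontr)
    assume "\<not> v y \<le> 0"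
    then obtain w where w: "-1 \<le> w" "w \<le> y" "v w = 0"
      using IVT'[of v "-1" 0 y] continuous_on_subset[OF cv, of "{-1..y}"] v y z by auto
    then have "w = z" using v0[of w z] y z by auto
    then show False using w y \<open>\<not> v y \<le> 0\<close> by auto
  qed
  have right: "v y \<ge> 0" if y: "y \<in> {z..1}" for y
  proof (rule ccontr)
    assume "\<not> v y \<ge> 0"
    then obtain w where w: "y \<le> w" "w \<le> 1" "v w = 0"
      using IVT'[of v y 0 1] continuous_on_subset[OF cv, of "{y..1}"] v y z by auto
    then have "w = z" using v0[of w z] y z by auto
    then show False using w y \<open>\<not> v y \<ge> 0\<close> by auto
  qed
  define t :: "nat \<Rightarrow> real" where "t i = (if i = 0 then - 1 else if i = 1 then z else 1)" for i
  have "has_polydomains (\<lambda>_. 0) u"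
    unfolding has_polydomains_def
  proof (intro exI[of _ "2::nat"] exI[of _ t] conjI allI impI ballI)
    fix i :: nat assume i: "i < 2"
    show "t i < t (Suc i)" using i z' by (auto simp: t_def)
    have "i = 0 \<or> i = 1" using i by auto
    then show "\<exists>\<theta>. \<forall>y\<in>{t i..t (Suc i)}. director_angle \<theta> 0 (u y)"
    proof
      assume "i = 0"
      then show ?thesis
        using left \<sigma> by (intro exI[of _ "(- \<sigma>) * pi / 4"] ballI director_angle_vertical) (auto simp: t_def v_def)
    next
      assume "i = 1"
      then show ?thesis
        using right \<sigma> by (intro exI[of _ "\<sigma> * pi / 4"] ballI director_angle_vertical) (auto simp: t_def v_def)
    qed
  next
    fix i :: nat assume "i \<in> {0<..<2}"
    then have "i = 1" by auto
    moreover have "u z = 0" using z \<sigma> by (auto simp: v_def)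
    ultimately show "scalar_order 0 (u (t i)) = 0" by (simp add: t_def scalar_order_def)
  qed (auto simp: t_def)
  moreover have "solves_system \<epsilon> (\<lambda>_. 0) u"
    using sol has_second_derivative_zero by (simp add: solves_system_def)
  moreover have "((\<lambda>_. 0), u) \<in> admissible (\<sigma> / 4)"
  proof -
    have "(\<lambda>_. 0) \<in> W12"
      by (rule W12_primitive[OF L2_const[of 0], of _ 0]) (simp add: primitive_const)
    moreover have "cos (2 * (\<sigma> / 4) * pi) = 0" "sin (2 * (\<sigma> / 4) * pi) = \<sigma>" using \<sigma> by auto
    ultimately show ?thesis using u by (simp add: admissible_def)
  qed
  ultimately show ?thesis unfolding OR_solution_def by blast
qed

section \<open>Necessity of \<omega> = 1/4 or \<omega> = -1/4\<close>

lemma director_angle_parallel: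
  assumes "director_angle \<theta> a b" "director_angle \<theta> c d"
  shows "a * d = b * c"
proof -
  define A C where "A = scalar_order a b / 2" and "C = scalar_order c d / 2"
  have "a = A * cos (2 * \<theta>)" "b = A * sin (2 * \<theta>)" "c = C * cos (2 * \<theta>)" "d = C * sin (2 * \<theta>)"
    using assms unfolding director_angle_def A_def C_def by blast+
  then show ?thesis by (simp add: mult_ac)
qed

lemma solution_on_line:
  assumes \<epsilon>: "\<epsilon> \<ge> 0" and sol: "solves_system \<epsilon> u v"
    and line: "-1 \<le> l" "l < r" "r \<le> 1" "\<And>y. y \<in> {l..r} \<Longrightarrow> \<alpha> * v y = \<beta> * u y"
    and y: "y \<in> {-1..1}"
  shows "\<alpha> * v y = \<beta> * u y"
proof -
  obtain u' v' where
    D: "\<And>y. y \<in> {-1..1} \<Longrightarrow> (u has_real_derivative u' y) (at y within {-1..1})"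
      "\<And>y. y \<in> {-1..1} \<Longrightarrow> (u' has_real_derivative \<epsilon> * u y * (4 * ((u y)\<^sup>2 + (v y)\<^sup>2) - 1)) (at y within {-1..1})"
      "\<And>y. y \<in> {-1..1} \<Longrightarrow> (v has_real_derivative v' y) (at y within {-1..1})"
      "\<And>y. y \<in> {-1..1} \<Longrightarrow> (v' has_real_derivative \<epsilon> * v y * (4 * ((u y)\<^sup>2 + (v y)\<^sup>2) - 1)) (at y within {-1..1})"
    using sol unfolding solves_system_def has_second_derivative_def by blast
  define c where "c y = \<epsilon> * (4 * ((u y)\<^sup>2 + (v y)\<^sup>2) - 1)" for y
  define w w' where "w y = \<alpha> * v y - \<beta> * u y" and "w' y = \<alpha> * v' y - \<beta> * u' y" for y
  have w: "(w has_real_derivative w' y) (at y within {-1..1})" "(w' has_real_derivative c y * w y) (at y within {-1..1})"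
    if "y \<in> {-1..1}" for y
    using D[OF that] unfolding w_def [abs_def] w'_def [abs_def]
    by (auto intro!: derivative_eq_intros simp: c_def algebra_simps)
  have "continuous_on {-1..1} c"
    unfolding c_def by (intro continuous_intros DERIV_continuous_on[OF D(1)] DERIV_continuous_on[OF D(3)])
  then have "bounded (c ` {-1..1})" by (intro compact_imp_bounded compact_continuous_image) auto
  then obtain K where "\<forall>y\<in>{-1..1}. \<bar>c y\<bar> \<le> K" by (auto simp: bounded_iff)
  then have K: "\<bar>c y\<bar> \<le> K" if "y \<in> {-1..1}" for y using that by blast
  \<comment> \<open>At an interior point of the given interval, w = 0 nearby also gives w' = 0, so
    both initial values vanish for the linear equation w'' = c w.\<close>
  define x0 where "x0 = (l + r) / 2"
  have x0: "l < x0" "x0 < r" "x0 \<in> {-1..1}" using line by (auto simp: x0_def)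
  have w0: "w y = 0" if "y \<in> {l..r}" for y using line(4)[OF that] by (simp add: w_def)
  have Dw: "(w has_real_derivative w' x0) (at x0)"
    using w(1)[OF x0(3)] x0 line by (simp add: at_within_Icc_at)
  have near: "\<forall>y. \<bar>x0 - y\<bar> < min (x0 - l) (r - x0) \<longrightarrow> w x0 = w y"
    using w0 x0 by (auto simp: abs_less_iff)
  have "0 < min (x0 - l) (r - x0)" using x0 by simp
  from DERIV_local_const[OF Dw this near] have w'0: "w' x0 = 0" .
  have "w y = 0 \<and> (0::real) = 0"
  proof (rule second_order_zero[where ?x0.0 = x0 and a = "-1" and b = 1 and f = w and f' = w' and f'' = "\<lambda>y. c y * w y"
        and g = "\<lambda>_. 0" and g' = "\<lambda>_. 0" and g'' = "\<lambda>_. 0" and K = K])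
    fix y :: real assume y: "y \<in> {-1..1}"
    show "(w has_real_derivative w' y) (at y within {-1..1})" "(w' has_real_derivative c y * w y) (at y within {-1..1})"
      using w[OF y] by auto
    show "\<bar>c y * w y\<bar> \<le> K * (\<bar>w y\<bar> + \<bar>0\<bar>)" using K[OF y] by (simp add: abs_mult mult_right_mono)
    have "K \<ge> 0" using K[OF y] by linarith
    then show "\<bar>0\<bar> \<le> K * (\<bar>w y\<bar> + \<bar>0\<bar>)" by simp
  qed (use x0 w0 w'0 y in auto)
  then show ?thesis by (simp add: w_def)
qed

lemma OR_solution_imp_quarter:
  assumes \<epsilon>: "\<epsilon> \<ge> 0" and \<omega>: "\<omega> \<in> {-1/2..1/2}" and OR: "OR_solution \<epsilon> \<omega> u v"
  shows "\<omega> = 1 / 4 \<or> \<omega> = -1 / 4"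
proof -
  define c s where "c = cos (2 * \<omega> * pi)" and "s = sin (2 * \<omega> * pi)"
  have sol: "solves_system \<epsilon> u v" using OR by (simp add: OR_solution_def)
  have bc: "u (-1) = c / 2" "u 1 = c / 2" "v (-1) = - s / 2" "v 1 = s / 2"
    using OR by (auto simp: OR_solution_def admissible_def c_def s_def)
  obtain n and t :: "nat \<Rightarrow> real" where n: "n \<ge> 2" and t: "t 0 = -1" "t n = 1" "\<And>i. i < n \<Longrightarrow> t i < t (Suc i)"
    and wall: "\<And>i. i \<in> {0<..<n} \<Longrightarrow> scalar_order (u (t i)) (v (t i)) = 0"
    and angle: "\<And>i. i < n \<Longrightarrow> \<exists>\<theta>. \<forall>y\<in>{t i..t (Suc i)}. director_angle \<theta> (u y) (v y)"
    using OR unfolding OR_solution_def has_polydomains_def by blast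
  have t1: "-1 < t 1" "t 1 \<le> 1"
  proof -
    show "-1 < t 1" using t(3)[of 0] t(1) n by simp
    have "t 1 \<le> t k" if "1 \<le> k" "k \<le> n" for k
      using that
    proof (induction k rule: dec_induct)
      case (step k)
      then show ?case using t(3)[of k] by simp
    qed simp
    from this[of n] show "t 1 \<le> 1" using n t(2) by simp
  qed
  have "scalar_order (u (t 1)) (v (t 1)) = 0" using wall[of 1] n by simp
  then have z: "u (t 1) = 0" "v (t 1) = 0"
    unfolding scalar_order_def by simp_all
  obtain \<theta> where "\<forall>y\<in>{t 0..t (Suc 0)}. director_angle \<theta> (u y) (v y)"
    using angle[of 0] n by auto
  then have \<theta>: "director_angle \<theta> (u y) (v y)" if "y \<in> {-1..t 1}" for y
    using that t(1) by simp
  \<comment> \<open>The boundary vector at -1 can serve as direction of the line, since it shares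
    the angle \<open>\<theta>\<close> with the whole first polydomain.\<close>
  have line: "u (-1) * v y = v (-1) * u y" if "y \<in> {-1..1}" for y
  proof (rule solution_on_line[OF \<epsilon> sol order_refl t1 _ that])
    fix y assume "y \<in> {-1..t 1}"
    then show "u (-1) * v y = v (-1) * u y" using t1 by (intro director_angle_parallel[OF \<theta> \<theta>]) auto
  qed
  \<comment> \<open>At y = 1 the relation reads c s/4 = - c s/4: the second component changes sign
    between the end points, the first does not.\<close>
  from line[of 1] have "c * s = 0" by (simp add: bc)
  \<comment> \<open>If s = 0, then v vanishes and u is a scalar solution with equal end values; the
    wall at \<open>t 1\<close> makes it nonconstant and hence injective, a contradiction.\<close>
  moreover have "s \<noteq> 0"
  proof
    assume s: "s = 0"
    have "s\<^sup>2 + c\<^sup>2 = 1" unfolding s_def c_def by (rule sin_cos_squared_add)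
    then have c2: "c\<^sup>2 = 1" using s by simp
    then have "c \<noteq> 0" by auto
    then have v0: "v y = 0" if "y \<in> {-1..1}" for y using line[OF that] s by (simp add: bc)
    have "has_second_derivative u (\<lambda>y. \<epsilon> * u y * (4 * (u y)\<^sup>2 - 1))"
    proof -
      obtain u' where D: "\<And>y. y \<in> {-1..1} \<Longrightarrow> (u has_real_derivative u' y) (at y within {-1..1})"
        "\<And>y. y \<in> {-1..1} \<Longrightarrow> (u' has_real_derivative \<epsilon> * u y * (4 * ((u y)\<^sup>2 + (v y)\<^sup>2) - 1)) (at y within {-1..1})"
        using sol unfolding solves_system_def has_second_derivative_def by blast
      have "(u' has_real_derivative \<epsilon> * u y * (4 * (u y)\<^sup>2 - 1)) (at y within {-1..1})" if "y \<in> {-1..1}" for y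
        using D(2)[OF that] v0[OF that] by simp
      then show ?thesis unfolding has_second_derivative_def using D(1) by blast
    qed
    moreover have "(u (-1))\<^sup>2 = 1 / 4" using c2 by (simp add: bc power_divide)
    ultimately have "inj_on u {-1..1}"
      by (rule scalar_solution_inj[OF \<epsilon>, of u "t 1"]) (use t1 z \<open>c \<noteq> 0\<close> in \<open>auto simp: bc\<close>)
    from inj_onD[OF this, of "-1" 1] show False by (simp add: bc)
  qed
  ultimately have "c = 0" by simp
  \<comment> \<open>The absolute value moves the angle into [0, pi], where the cosine is
    injective.\<close>
  define x where "x = \<bar>2 * \<omega> * pi\<bar>"
  have x: "x = (2 * \<bar>\<omega>\<bar>) * pi" by (simp add: x_def abs_mult)
  have "2 * \<bar>\<omega>\<bar> \<le> 1" using \<omega> abs_leI[of \<omega> "1 / 2"] by simp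
  then have "x \<le> 1 * pi" unfolding x by (rule mult_right_mono) simp
  moreover have "cos x = cos (pi / 2)"
    using \<open>c = 0\<close> unfolding x_def c_def cos_abs_real by simp
  moreover have "0 \<le> x" by (simp add: x_def)
  ultimately have "x = pi / 2" using cos_inj_pi[of x "pi / 2"] by simp
  then have "(2 * \<bar>\<omega>\<bar>) * pi = (1 / 2) * pi" using x by simp
  then have "2 * \<bar>\<omega>\<bar> = 1 / 2" using pi_neq_zero mult_right_cancel by blast
  then show ?thesis by linarith
qed

theorem theorem3p1:
  fixes \<omega> :: real
  assumes "\<omega> \<in> {-1/2..1/2}"
  shows "(\<forall>\<epsilon>\<ge>0. \<exists>Q11 Q12. is_minimizer \<epsilon> \<omega> Q11 Q12) \<and>
         (\<forall>\<epsilon>\<ge>0. \<exists>Q11 Q12. (Q11, Q12) \<in> admissible \<omega> \<and> solves_system \<epsilon> Q11 Q12 \<and>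
            real_analytic_on Q11 {-1..1} \<and> real_analytic_on Q12 {-1..1}) \<and>
         (\<forall>\<epsilon>\<ge>0. (\<exists>Q11 Q12. OR_solution \<epsilon> \<omega> Q11 Q12) \<longleftrightarrow> \<omega> = 1/4 \<or> \<omega> = -1/4)"
proof (intro conjI allI impI)
  fix \<epsilon> :: real assume \<epsilon>: "\<epsilon> \<ge> 0"
  obtain Q11 Q12 where Q: "is_minimizer \<epsilon> \<omega> Q11 Q12" "solves_system \<epsilon> Q11 Q12"
    using minimizer_and_solution_exist[OF \<epsilon>] by blast
  then show "\<exists>Q11 Q12. is_minimizer \<epsilon> \<omega> Q11 Q12" by blast
  show "\<exists>Q11 Q12. (Q11, Q12) \<in> admissible \<omega> \<and> solves_system \<epsilon> Q11 Q12 \<and>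
    real_analytic_on Q11 {-1..1} \<and> real_analytic_on Q12 {-1..1}"
    using Q solution_analytic[OF \<epsilon> Q(2)] unfolding is_minimizer_def by blast
  show "(\<exists>Q11 Q12. OR_solution \<epsilon> \<omega> Q11 Q12) \<longleftrightarrow> \<omega> = 1/4 \<or> \<omega> = -1/4"
  proof
    assume "\<exists>Q11 Q12. OR_solution \<epsilon> \<omega> Q11 Q12"
    then show "\<omega> = 1/4 \<or> \<omega> = -1/4" using OR_solution_imp_quarter[OF \<epsilon> assms] by blast
  next
    assume "\<omega> = 1/4 \<or> \<omega> = -1/4"
    then show "\<exists>Q11 Q12. OR_solution \<epsilon> \<omega> Q11 Q12"
    proof
      assume w: "\<omega> = 1/4"
      show ?thesis unfolding w using OR_solution_exists[OF \<epsilon>, of 1] by simp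
    next
      assume w: "\<omega> = -1/4"
      show ?thesis unfolding w using OR_solution_exists[OF \<epsilon>, of "-1"] by simp
    qed
  qed
qed

end
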